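(* Let $H\in(0,1)$ and $T>0$. Assume $f_1\in H_0^1(D)$, $f_2\in L^2(D)$ and $g_2\in L^2(0,T)$. Assume additionally that $g_1\in C^{0,\rho}([0,T])$ for some $\rho>\frac12-H$ if $H\in(0,\frac12)$, and that $g_1\in L^2(0,T)$ if $H\in[\frac12,1)$. Then the stochastic Moore-Gibson-Thompson evolution equation $$dX(t)=AX(t)\,dt+\Phi(t)\,dB^H(t)+\tilde\Phi(t)\,dt,\quad t\in[0,T],\qquad X(0)=0,$$ in $\mathcal H$ admits a unique mild solution, given by $$X(t)=\int_0^t e^{A(t-s)}\Phi(s)\,dB^H(s)+\int_0^t e^{A(t-s)}\tilde\Phi(s)\,ds .$$ Moreover, $X(t)\in L^2(\Omega;\mathcal H)$ for all $t\in[0,T]$.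
   Context: $D\subset\mathbb R^d$ is a bounded open set with $C^2$ boundary. $\alpha,b,c^2>0$ are constants with $\gamma:=\alpha-\frac{c^2}{b}>0$. $(\Omega,\mathcal F,\mathbb P)$ is a complete probability space carrying a one-dimensional fractional Brownian motion $B^H$ with Hurst index $H$, i.e. a centered Gaussian process with $B^H(0)=0$ and covariance $R_H(t,s)=\frac12(t^{2H}+s^{2H}-|t-s|^{2H})$. The functions $f_1,f_2$ (on $D$) and $g_1,g_2$ (on $[0,T]$) are deterministic and real-valued. $-\Delta$ denotes the Laplacian on $D$ with homogeneous Dirichlet boundary conditions, $\dot H^s(D)=\mathcal D((-\Delta)^{s/2})$, normed by $\|u\|_{\dot H^s(D)}=\big(\sum_k\lambda_k^s\langle u,\varphi_k\rangle^2\big)^{1/2}$, where $(\lambda_k,\varphi_k)$ are the eigenvalues and $L^2(D)$-orthonormal eigenfunctions of $-\Delta$. Set $\mathcal H=\dot H^2(D)\times\dot H^1(D)\times L^2(D)$, $$A=\begin{bmatrix}0&I&0\\ 0&0&I\\ c^2\Delta&b\Delta&-\alpha\end{bmatrix},\quad \mathcal D(A)=\mathcal D(-\Delta)\times\mathcal D(-\Delta)\times\mathcal D((-\Delta)^{1/2}),\quad \Phi(t)=\begin{bmatrix}0\\ 0\\ f_1g_1(t)\end{bmatrix},\quad \tilde\Phi(t)=\begin{bmatrix}0\\ 0\\ f_2g_2(t)\end{bmatrix}.$$ $A$ generates a strongly continuous semigroup $e^{At}$ on $\mathcal H$. With $X=(u,u_t,u_{tt})^T$ this is the first-order form of $u_{ttt}+\alpha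 u_{tt}-b\Delta u_t-c^2\Delta u=f_1(x)g_1(t)\dot B^H(t)+f_2(x)g_2(t)$ in $D\times[0,T]$, with $u=0$ on $\partial D\times[0,T]$ and $u=u_t=u_{tt}=0$ at $t=0$. Wiener integral: for a separable Hilbert space $E$ and an $E$-valued step function $\Psi=\sum_j a_j\mathbf 1_{(t_j,t_{j+1}]}$, $\int_0^t\Psi\,dB^H=\sum_j a_j(B^H(t_{j+1})-B^H(t_j))$. This is extended by isometry to $\mathcal H_0([0,t];E)$, the completion of the step functions on $[0,t]$ for the inner product determined by $\langle a\mathbf 1_{[0,r]},a'\mathbf 1_{[0,s]}\rangle=R_H(r,s)\langle a,a'\rangle_E$; values are in $L^2(\Omega;E)$. Mild solution: an $\mathcal H$-valued process $X$ on $[0,T]$, predictable with respect to the filtration generated by $B^H$, such that for every $t\in[0,T]$, almost surely, $X(t)=\int_0^te^{A(t-s)}\Phi(s)\,dB^H(s)+\int_0^te^{A(t-s)}\tilde\Phi(s)\,ds$. Uniqueness is up to modification. *)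

theory Defs
  imports "HOL-Probability.Probability"
begin

section \<open>Spaces of square-integrable functions\<close>

text \<open>Elements are functions; almost-everywhere equal functions are not identified. The same
  definition serves for the scalar spaces over a domain or a time interval, for gradient fields,
  and for Hilbert-space-valued random variables.\<close>

definition L2 :: "'m measure \<Rightarrow> ('m \<Rightarrow> 'e::{real_normed_vector,second_countable_topology}) set" where
  "L2 M = {f \<in> borel_measurable M. integrable M (\<lambda>x. (norm (f x))\<^sup>2)}"

definition L2_norm :: "'m measure \<Rightarrow> ('m \<Rightarrow> 'e::{real_normed_vector,second_countable_topology}) \<Rightarrow> real" where
  "L2_norm M f = sqrt (LINT x|M. (norm (f x))\<^sup>2)"

definition L2_inner :: "'m measure \<Rightarrow> ('m \<Rightarrow> 'e::{real_inner,second_countable_topology}) \<Rightarrow> ('m \<Rightarrow> 'e) \<Rightarrow> real" where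
  "L2_inner M f g = (LINT x|M. f x \<bullet> g x)"

definition holder_on :: "real set \<Rightarrow> real \<Rightarrow> (real \<Rightarrow> real) \<Rightarrow> bool" where
  "holder_on I \<rho> g \<longleftrightarrow> (\<exists>C. \<forall>s\<in>I. \<forall>t\<in>I. \<bar>g s - g t\<bar> \<le> C * \<bar>s - t\<bar> powr \<rho>)"


section \<open>Domains and Sobolev spaces\<close>

primrec cont_diff :: "nat \<Rightarrow> ('a::euclidean_space \<Rightarrow> real) \<Rightarrow> bool" where
  "cont_diff 0 f \<longleftrightarrow> continuous_on UNIV f"
| "cont_diff (Suc k) f \<longleftrightarrow>
     (\<exists>G. (\<forall>x. GDERIV f x :> G x) \<and> (\<forall>i\<in>Basis. cont_diff k (\<lambda>x. G x \<bullet> i)))"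

text \<open>Near each boundary point, after choosing a direction e as the last coordinate axis, the set
  is the region above the graph of a function of class \<open>C\<^sup>2\<close>; the function does not depend on
  the last coordinate.\<close>

definition C2_boundary :: "'a::euclidean_space set \<Rightarrow> bool" where
  "C2_boundary D \<longleftrightarrow> (\<forall>p\<in>frontier D. \<exists>r>0. \<exists>e h. norm e = 1 \<and> cont_diff 2 h \<and>
      (\<forall>y t. h (y + t *\<^sub>R e) = h y) \<and> D \<inter> ball p r = {y \<in> ball p r. h y < y \<bullet> e})"

definition test_functions :: "'a::euclidean_space set \<Rightarrow> ('a \<Rightarrow> real) set" where
  "test_functions D = {\<psi>. (\<forall>k. cont_diff k \<psi>) \<and>
      compact (closure {x. \<psi> x \<noteq> 0}) \<and> closure {x. \<psi> x \<noteq> 0} \<subseteq> D}"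

definition has_weak_gradient :: "'a::euclidean_space set \<Rightarrow> ('a \<Rightarrow> real) \<Rightarrow> ('a \<Rightarrow> 'a) \<Rightarrow> bool" where
  "has_weak_gradient D u G \<longleftrightarrow> (\<forall>\<psi>\<in>test_functions D. \<forall>i\<in>Basis.
      (LINT x|lebesgue_on D. u x * frechet_derivative \<psi> (at x) i)
        = - (LINT x|lebesgue_on D. (G x \<bullet> i) * \<psi> x))"

definition H1 :: "'a::euclidean_space set \<Rightarrow> ('a \<Rightarrow> real) set" where
  "H1 D = {u \<in> L2 (lebesgue_on D). \<exists>G\<in>L2 (lebesgue_on D). has_weak_gradient D u G}"

definition weak_gradient :: "'a::euclidean_space set \<Rightarrow> ('a \<Rightarrow> real) \<Rightarrow> 'a \<Rightarrow> 'a" where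
  "weak_gradient D u = (SOME G. G \<in> L2 (lebesgue_on D) \<and> has_weak_gradient D u G)"

definition H1_norm :: "'a::euclidean_space set \<Rightarrow> ('a \<Rightarrow> real) \<Rightarrow> real" where
  "H1_norm D u = sqrt ((L2_norm (lebesgue_on D) u)\<^sup>2
                        + (L2_norm (lebesgue_on D) (weak_gradient D u))\<^sup>2)"

definition H10 :: "'a::euclidean_space set \<Rightarrow> ('a \<Rightarrow> real) set" where
  "H10 D = {u \<in> H1 D. \<forall>\<epsilon>>0. \<exists>\<psi>\<in>test_functions D. H1_norm D (\<lambda>x. u x - \<psi> x) < \<epsilon>}"


section \<open>The Dirichlet Laplacian and its fractional domains\<close>

text \<open>The relation holds iff u lies in the domain of the Dirichlet Laplacian and the Laplacian
  of u is p (almost everywhere on D).\<close>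

definition dirichlet_laplacian ::
    "'a::euclidean_space set \<Rightarrow> ('a \<Rightarrow> real) \<Rightarrow> ('a \<Rightarrow> real) \<Rightarrow> bool" where
  "dirichlet_laplacian D u p \<longleftrightarrow> u \<in> H10 D \<and> p \<in> L2 (lebesgue_on D) \<and>
     (\<forall>v\<in>H10 D. L2_inner (lebesgue_on D) (weak_gradient D u) (weak_gradient D v)
                 = - L2_inner (lebesgue_on D) p v)"

text \<open>The functions \<open>\<phi> k\<close> form a complete orthonormal system of eigenfunctions. Each \<open>\<mu> k\<close> is
  then automatically positive when D is bounded, by the Poincare inequality.\<close>

definition dirichlet_eigensystem ::
    "'a::euclidean_space set \<Rightarrow> (nat \<Rightarrow> real) \<Rightarrow> (nat \<Rightarrow> 'a \<Rightarrow> real) \<Rightarrow> bool" where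
  "dirichlet_eigensystem D \<mu> \<phi> \<longleftrightarrow>
     (\<forall>k. dirichlet_laplacian D (\<phi> k) (\<lambda>x. - \<mu> k * \<phi> k x)) \<and>
     (\<forall>j k. L2_inner (lebesgue_on D) (\<phi> j) (\<phi> k) = (if j = k then 1 else 0)) \<and>
     (\<forall>u\<in>L2 (lebesgue_on D). (\<forall>k. L2_inner (lebesgue_on D) u (\<phi> k) = 0)
         \<longrightarrow> (AE x in lebesgue_on D. u x = 0))"

definition Hdot :: "'a::euclidean_space set \<Rightarrow> (nat \<Rightarrow> real) \<Rightarrow> (nat \<Rightarrow> 'a \<Rightarrow> real) \<Rightarrow> real
    \<Rightarrow> ('a \<Rightarrow> real) set" where
  "Hdot D \<mu> \<phi> s = {u \<in> L2 (lebesgue_on D).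
     summable (\<lambda>k. \<mu> k powr s * (L2_inner (lebesgue_on D) u (\<phi> k))\<^sup>2)}"

definition Hdot_norm :: "'a::euclidean_space set \<Rightarrow> (nat \<Rightarrow> real) \<Rightarrow> (nat \<Rightarrow> 'a \<Rightarrow> real) \<Rightarrow> real
    \<Rightarrow> ('a \<Rightarrow> real) \<Rightarrow> real" where
  "Hdot_norm D \<mu> \<phi> s u = sqrt (\<Sum>k. \<mu> k powr s * (L2_inner (lebesgue_on D) u (\<phi> k))\<^sup>2)"


section \<open>The state space and the operator of the Moore-Gibson-Thompson equation\<close>

text \<open>The state space depends on the set D, so it cannot be a single closed type. Instead
  \<open>'h\<close> is any separable Hilbert space that is the quotient of the triples of functions in
  \<open>Hdot 2 \<times> Hdot 1 \<times> L2\<close> by almost-everywhere equality: \<open>cls u v w\<close> is the class of the triple,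
  \<open>cls\<close> is linear, norm preserving and onto. This determines \<open>'h\<close> up to a unique isometric
  isomorphism compatible with \<open>cls\<close>, and implies that two triples have the same class iff they
  agree almost everywhere on D. Values of \<open>cls\<close> outside the product are irrelevant.\<close>

definition is_state_space :: "'a::euclidean_space set \<Rightarrow> (nat \<Rightarrow> real) \<Rightarrow> (nat \<Rightarrow> 'a \<Rightarrow> real)
    \<Rightarrow> (('a \<Rightarrow> real) \<Rightarrow> ('a \<Rightarrow> real) \<Rightarrow> ('a \<Rightarrow> real) \<Rightarrow> 'h::{real_inner,polish_space}) \<Rightarrow> bool" where
  "is_state_space D \<mu> \<phi> cls \<longleftrightarrow>
     (\<forall>u\<in>Hdot D \<mu> \<phi> 2. \<forall>v\<in>Hdot D \<mu> \<phi> 1. \<forall>w\<in>L2 (lebesgue_on D).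
        (norm (cls u v w))\<^sup>2
          = (Hdot_norm D \<mu> \<phi> 2 u)\<^sup>2 + (Hdot_norm D \<mu> \<phi> 1 v)\<^sup>2 + (L2_norm (lebesgue_on D) w)\<^sup>2 \<and>
        (\<forall>r. cls (\<lambda>x. r * u x) (\<lambda>x. r * v x) (\<lambda>x. r * w x) = r *\<^sub>R cls u v w) \<and>
        (\<forall>u'\<in>Hdot D \<mu> \<phi> 2. \<forall>v'\<in>Hdot D \<mu> \<phi> 1. \<forall>w'\<in>L2 (lebesgue_on D).
           cls (\<lambda>x. u x + u' x) (\<lambda>x. v x + v' x) (\<lambda>x. w x + w' x) = cls u v w + cls u' v' w')) \<and>
     (\<forall>z. \<exists>u\<in>Hdot D \<mu> \<phi> 2. \<exists>v\<in>Hdot D \<mu> \<phi> 1. \<exists>w\<in>L2 (lebesgue_on D). z = cls u v w)"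

text \<open>Unbounded operators are given by their graphs.\<close>

definition MGT_operator :: "'a::euclidean_space set \<Rightarrow> (nat \<Rightarrow> real) \<Rightarrow> (nat \<Rightarrow> 'a \<Rightarrow> real)
    \<Rightarrow> (('a \<Rightarrow> real) \<Rightarrow> ('a \<Rightarrow> real) \<Rightarrow> ('a \<Rightarrow> real) \<Rightarrow> 'h)
    \<Rightarrow> real \<Rightarrow> real \<Rightarrow> real \<Rightarrow> ('h \<times> 'h) set" where
  "MGT_operator D \<mu> \<phi> cls \<alpha> b c =
     {(cls u v w, cls v w (\<lambda>x. c\<^sup>2 * p x + b * q x - \<alpha> * w x)) | u v w p q.
        dirichlet_laplacian D u p \<and> dirichlet_laplacian D v q \<and> w \<in> Hdot D \<mu> \<phi> 1}"

definition C0_semigroup :: "(real \<Rightarrow> 'h::real_normed_vector \<Rightarrow>\<^sub>L 'h) \<Rightarrow> bool" where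
  "C0_semigroup S \<longleftrightarrow> S 0 = id_blinfun \<and> (\<forall>s\<ge>0. \<forall>t\<ge>0. S (s + t) = S s o\<^sub>L S t) \<and>
     (\<forall>z. continuous_on {0..} (\<lambda>t. blinfun_apply (S t) z))"

definition generator :: "(real \<Rightarrow> 'h::real_normed_vector \<Rightarrow>\<^sub>L 'h) \<Rightarrow> ('h \<times> 'h) set" where
  "generator S = {(z, y). ((\<lambda>t. (blinfun_apply (S t) z - z) /\<^sub>R t) \<longlongrightarrow> y) (at_right 0)}"


section \<open>Fractional Brownian motion and its Wiener integral\<close>

definition fbm_cov :: "real \<Rightarrow> real \<Rightarrow> real \<Rightarrow> real" where
  "fbm_cov H t s = (t powr (2 * H) + s powr (2 * H) - \<bar>t - s\<bar> powr (2 * H)) / 2"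

definition centered_gaussian :: "'o measure \<Rightarrow> ('o \<Rightarrow> real) \<Rightarrow> bool" where
  "centered_gaussian M Z \<longleftrightarrow> Z \<in> borel_measurable M \<and>
     ((\<exists>\<sigma>>0. distributed M lborel Z (normal_density 0 \<sigma>)) \<or> (AE \<omega> in M. Z \<omega> = 0))"

definition fractional_brownian_motion ::
    "'o measure \<Rightarrow> real \<Rightarrow> (real \<Rightarrow> 'o \<Rightarrow> real) \<Rightarrow> bool" where
  "fractional_brownian_motion M H B \<longleftrightarrow>
     (\<forall>I a. finite I \<longrightarrow> I \<subseteq> {0..} \<longrightarrow> centered_gaussian M (\<lambda>\<omega>. \<Sum>t\<in>I. a t * B t \<omega>)) \<and>
     (AE \<omega> in M. B 0 \<omega> = 0) \<and>
     (\<forall>t\<ge>0. \<forall>s\<ge>0. (LINT \<omega>|M. B t \<omega> * B s \<omega>) = fbm_cov H t s)"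

text \<open>A step function is coded by a list of triples \<open>(a, l, r)\<close>, standing for the sum of the
  functions with value a on \<open>(l, r]\<close> and 0 elsewhere.\<close>

definition step_list :: "real \<Rightarrow> ('e \<times> real \<times> real) list \<Rightarrow> bool" where
  "step_list t xs \<longleftrightarrow> (\<forall>(a, l, r)\<in>set xs. 0 \<le> l \<and> l \<le> r \<and> r \<le> t)"

definition step_fun :: "('e::real_vector \<times> real \<times> real) list \<Rightarrow> real \<Rightarrow> 'e" where
  "step_fun xs s = (\<Sum>(a, l, r)\<leftarrow>xs. indicat_real {l<..r} s *\<^sub>R a)"

definition step_integral ::
    "(real \<Rightarrow> 'o \<Rightarrow> real) \<Rightarrow> ('e::real_vector \<times> real \<times> real) list \<Rightarrow> 'o \<Rightarrow> 'e" where
  "step_integral B xs \<omega> = (\<Sum>(a, l, r)\<leftarrow>xs. (B r \<omega> - B l \<omega>) *\<^sub>R a)"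

text \<open>The bilinear extension of \<open>\<langle>a 1\<^bsub>[0,r]\<^esub>, a' 1\<^bsub>[0,r']\<^esub>\<rangle> = R(r, r') \<langle>a, a'\<rangle>\<close>, using that the indicator
  of \<open>(l, r]\<close> is the difference of those of \<open>[0, r]\<close> and \<open>[0, l]\<close>.\<close>

definition H0_inner :: "real \<Rightarrow> ('e::real_inner \<times> real \<times> real) list
    \<Rightarrow> ('e \<times> real \<times> real) list \<Rightarrow> real" where
  "H0_inner H xs ys = (\<Sum>(a, l, r)\<leftarrow>xs. \<Sum>(a', l', r')\<leftarrow>ys.
     (fbm_cov H r r' - fbm_cov H r l' - fbm_cov H l r' + fbm_cov H l l') * (a \<bullet> a'))"

definition H0_dist :: "real \<Rightarrow> ('e::real_inner \<times> real \<times> real) list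
    \<Rightarrow> ('e \<times> real \<times> real) list \<Rightarrow> real" where
  "H0_dist H xs ys = sqrt (H0_inner H xs xs - 2 * H0_inner H xs ys + H0_inner H ys ys)"

text \<open>Elements of the completion are Cauchy sequences of step functions. A function f on \<open>[0, t]\<close>
  is identified with the element given by a Cauchy sequence that also converges to f in
  \<open>L\<^sup>1([0, t])\<close>. At most one element arises in this way: for bounded k with integral 0 over
  \<open>[0, t]\<close>, taking the inner product of a step function with the element \<open>r \<mapsto> \<integral>\<^bsub>r\<^esub>\<^bsup>t\<^esup> k(s) ds\<close> is
  integration against a bounded function, and such elements are total, so a Cauchy sequence
  tending to 0 in \<open>L\<^sup>1\<close> tends to 0 in the completion.
  For Hurst index 1/2 the functions obtained are those in \<open>L\<^sup>2\<close>, for larger H all those in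
  \<open>L\<^bsup>1/H\<^esup>\<close> are included.\<close>

definition H0_represents :: "real \<Rightarrow> real \<Rightarrow> (nat \<Rightarrow> ('e::{real_inner,polish_space} \<times> real \<times> real) list)
    \<Rightarrow> (real \<Rightarrow> 'e) \<Rightarrow> bool" where
  "H0_represents H t \<Psi> f \<longleftrightarrow>
     (\<forall>n. step_list t (\<Psi> n)) \<and>
     (\<forall>\<epsilon>>0. \<exists>N. \<forall>m\<ge>N. \<forall>n\<ge>N. H0_dist H (\<Psi> m) (\<Psi> n) < \<epsilon>) \<and>
     set_integrable lebesgue {0..t} f \<and>
     (\<lambda>n. LINT s:{0..t}|lebesgue. norm (step_fun (\<Psi> n) s - f s)) \<longlonglongrightarrow> 0"

text \<open>The integral is determined up to almost sure equality.\<close>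

definition has_wiener_integral :: "'o measure \<Rightarrow> real \<Rightarrow> (real \<Rightarrow> 'o \<Rightarrow> real) \<Rightarrow> real
    \<Rightarrow> (real \<Rightarrow> 'e::{real_inner,polish_space}) \<Rightarrow> ('o \<Rightarrow> 'e) \<Rightarrow> bool" where
  "has_wiener_integral M H B t f W \<longleftrightarrow> W \<in> L2 M \<and>
     (\<exists>\<Psi>. H0_represents H t \<Psi> f \<and>
        (\<lambda>n. L2_norm M (\<lambda>\<omega>. step_integral B (\<Psi> n) \<omega> - W \<omega>)) \<longlonglongrightarrow> 0)"


section \<open>Predictable processes and mild solutions\<close>

definition generated_filtration :: "'o measure \<Rightarrow> (real \<Rightarrow> 'o \<Rightarrow> real) \<Rightarrow> real \<Rightarrow> 'o set set" where
  "generated_filtration M B t =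
     sigma_sets (space M) {B s -` C \<inter> space M | s C. 0 \<le> s \<and> s \<le> t \<and> C \<in> sets borel}"

definition predictable_algebra ::
    "'o measure \<Rightarrow> (real \<Rightarrow> 'o set set) \<Rightarrow> real \<Rightarrow> (real \<times> 'o) measure" where
  "predictable_algebra M F T = sigma ({0..T} \<times> space M)
     ({{0} \<times> A | A. A \<in> F 0} \<union> {{s<..t} \<times> A | s t A. 0 \<le> s \<and> s \<le> t \<and> t \<le> T \<and> A \<in> F s})"

definition mild_solution :: "'o measure \<Rightarrow> real \<Rightarrow> (real \<Rightarrow> 'o \<Rightarrow> real) \<Rightarrow> real
    \<Rightarrow> (real \<Rightarrow> 'h::{real_inner,polish_space} \<Rightarrow>\<^sub>L 'h) \<Rightarrow> (real \<Rightarrow> 'h) \<Rightarrow> (real \<Rightarrow> 'h)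
    \<Rightarrow> (real \<Rightarrow> 'o \<Rightarrow> 'h) \<Rightarrow> bool" where
  "mild_solution M H B T S \<Phi> \<Phi>' X \<longleftrightarrow>
     (\<lambda>(t, \<omega>). X t \<omega>) \<in>
        borel_measurable (predictable_algebra M (generated_filtration M B) T) \<and>
     (\<forall>t\<in>{0..T}.
        set_integrable lebesgue {0..t} (\<lambda>s. blinfun_apply (S (t - s)) (\<Phi>' s)) \<and>
        (\<exists>W. has_wiener_integral M H B t (\<lambda>s. blinfun_apply (S (t - s)) (\<Phi> s)) W \<and>
           (AE \<omega> in M. X t \<omega> = W \<omega> + (LINT s:{0..t}|lebesgue. blinfun_apply (S (t - s)) (\<Phi>' s)))))"

end

theory Submission
  imports Defs
begin

text \<open>The class of \<open>(0, 0, f\<^sub>1)\<close> lies in the domain of \<open>A\<close>, so its orbit \<open>F\<close> under the semigroup is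
  Lipschitz on \<open>[0, T]\<close> and the stochastic integrand is \<open>g\<^sub>1(s) F(t - s)\<close>. Increments of fractional
  Brownian motion over disjoint intervals are nonnegatively correlated for \<open>H \<ge> 1/2\<close> and nonpositively
  correlated for \<open>H \<le> 1/2\<close>; with Schur's test this bounds the variance of \<open>\<Sum>\<^sub>j d\<^sub>j \<Delta>B\<^sub>j\<close> on a grid of
  mesh \<open>\<delta>\<close> by \<open>K \<delta>\<^bsup>min(1, 2H)\<^esup> \<Sum>\<^sub>j |d\<^sub>j|\<^sup>2\<close>. For \<open>H \<ge> 1/2\<close> this is an \<open>L\<^sup>2\<close> bound and \<open>g\<^sub>1\<close> is approximated by
  continuous functions; for \<open>H < 1/2\<close> passing from one dyadic level to the next costs
  \<open>O(\<delta>\<^bsup>2\<rho> + 2H - 1\<^esup> + \<delta>\<^bsup>2H\<^esup>)\<close>, which is geometric as \<open>\<rho> > 1/2 - H\<close>. The grid sums are predictable in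
  \<open>(t, \<omega>)\<close> and converge almost surely for every \<open>t\<close>, so their limit is a predictable solution. Uniqueness
  is uniqueness of the Wiener integral, i.e. closability of the integral of step functions with respect
  to \<open>L\<^sup>1\<close> convergence.\<close>

section \<open>Bochner integrability\<close>

text \<open>The obstacle is joint measurability in (t, \<omega>). Plain mean-square convergence
  would give, for each t, an almost sure limit only along a subsequence depending on t. Hence grids
  and sampled functions are chosen independently of t, and a geometric rate in n is demanded at each
  t: the whole sequence then converges almost surely at each t, and its pathwise limit is one
  process. The same step functions must also converge to the integrand in L1, because this is what
  ties a Cauchy sequence to a function in \<open>H0_represents\<close>. The domain property of the
  class of \<open>(0, 0, f\<^sub>1)\<close> rests on \<open>f\<^sub>1 \<in> H10 D\<close>, as the
  third component of the domain is \<open>Hdot D \<mu> \<phi> 1\<close>. For H < 1/2 the energy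
  bound exceeds an L2 bound by the factor \<delta> to the power 2H - 1. Strong continuity of the
  semigroup gives no rate to compensate this; a Lipschitz orbit does, so that the Hoelder exponent
  of \<open>g\<^sub>1\<close> is the only remaining restriction.\<close>

text \<open>The sort \<open>{real_normed_vector, polish_space}\<close> does not entail the class \<open>banach\<close>, so the corresponding
  library facts do not apply to it.\<close>

lemma integrable_of_norm:
  fixes f :: "'m \<Rightarrow> 'e::{real_normed_vector,polish_space}"
  assumes f[measurable]: "f \<in> borel_measurable M" and fin: "(\<integral>\<^sup>+x. norm (f x) \<partial>M) < \<infinity>"
  shows "integrable M f"
proof -
  obtain s where s: "\<And>i. simple_function M (s i)"
    and lim: "\<And>x. x \<in> space M \<Longrightarrow> (\<lambda>i. s i x) \<longlonglongrightarrow> f x"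
    and bnd: "\<And>i x. x \<in> space M \<Longrightarrow> dist (s i x) 0 \<le> 2 * dist (f x) 0"
    using borel_measurable_implies_sequence_metric[OF f, of 0] by metis
  have sm[measurable]: "s i \<in> borel_measurable M" for i
    using s by (rule borel_measurable_simple_function)
  have fin2: "(\<integral>\<^sup>+x. ennreal (2 * norm (f x)) \<partial>M) < \<infinity>"
    using fin by (simp add: ennreal_mult nn_integral_cmult ennreal_mult_less_top)
  have si: "Bochner_Integration.simple_bochner_integrable M (s i)" for i
  proof (rule simple_bochner_integrableI_bounded)
    show "simple_function M (s i)" by fact
    have "(\<integral>\<^sup>+x. norm (s i x) \<partial>M) \<le> (\<integral>\<^sup>+x. ennreal (2 * norm (f x)) \<partial>M)"
      using bnd by (intro nn_integral_mono ennreal_leI) auto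
    then show "(\<integral>\<^sup>+x. norm (s i x) \<partial>M) < \<infinity>" using fin2 by simp
  qed
  have conv: "(\<lambda>i. \<integral>\<^sup>+ x. ennreal (norm (f x - s i x)) \<partial>M) \<longlonglongrightarrow> 0"
  proof (rule nn_integral_dominated_convergence_norm[where w="\<lambda>x. 2 * norm (f x)"])
    show "AE x in M. norm (s j x) \<le> 2 * norm (f x)" for j using bnd by auto
  qed (use lim fin2 in auto)
  let ?I = "\<lambda>i. Bochner_Integration.simple_bochner_integral M (s i)"
  let ?e = "\<lambda>i. \<integral>\<^sup>+ x. ennreal (norm (f x - s i x)) \<partial>M"
  \<comment> \<open>Completeness of the space enters here: the integrals of the simple approximants
    form a Cauchy sequence, and the Bochner integral asks for their limit.\<close>
  have "Cauchy ?I"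
  proof (rule metric_CauchyI)
    fix e :: real assume e: "0 < e"
    have "eventually (\<lambda>i. ?e i < ennreal (e/2)) sequentially"
      using conv e by (intro order_tendstoD(2)) auto
    then obtain N where N: "\<And>n. n \<ge> N \<Longrightarrow> ?e n < ennreal (e/2)"
      by (auto simp: eventually_sequentially)
    have "dist (?I m) (?I n) < e" if "m \<ge> N" "n \<ge> N" for m n
    proof -
      have "ennreal (norm (?I m - ?I n)) \<le> ?e m + ?e n"
        using simple_bochner_integral_bounded[OF f si si, of m n] .
      also have "\<dots> < ennreal (e/2) + ennreal (e/2)"
        using N[OF that(1)] N[OF that(2)] by (intro add_strict_mono)
      also have "\<dots> = ennreal e" using e by (subst ennreal_plus[symmetric]) auto
      finally show ?thesis using e by (simp add: dist_norm ennreal_less_iff)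
    qed
    then show "\<exists>N. \<forall>m\<ge>N. \<forall>n\<ge>N. dist (?I m) (?I n) < e" by blast
  qed
  then obtain x where "?I \<longlonglongrightarrow> x" using Cauchy_convergent convergent_def by blast
  then have "has_bochner_integral M f x"
    using si conv by (intro has_bochner_integral.intros[where s=s]) auto
  then show ?thesis by (rule integrable.intros)
qed

lemma integrable_dominated:
  fixes f :: "'m \<Rightarrow> 'e::{real_normed_vector,polish_space}" and g :: "'m \<Rightarrow> real"
  assumes "f \<in> borel_measurable M" "integrable M g" "AE x in M. norm (f x) \<le> g x"
  shows "integrable M f"
proof (rule integrable_of_norm)
  have "(\<integral>\<^sup>+x. norm (f x) \<partial>M) \<le> (\<integral>\<^sup>+x. norm (g x) \<partial>M)"
    using assms(3) by (intro nn_integral_mono_AE) (auto intro: ennreal_leI)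
  then show "(\<integral>\<^sup>+x. norm (f x) \<partial>M) < \<infinity>"
    using assms(2) by (auto simp: integrable_iff_bounded)
qed fact

lemma integrable_norm_of:
  fixes f :: "'m \<Rightarrow> 'e::{real_normed_vector,second_countable_topology}"
  assumes "integrable M f" shows "integrable M (\<lambda>x. norm (f x))"
proof (rule integrableI_bounded)
  obtain v where "has_bochner_integral M f v" using assms by (auto simp: integrable.simps)
  then show "(\<integral>\<^sup>+ x. ennreal (norm (norm (f x))) \<partial>M) < \<infinity>"
    using has_bochner_integral_implies_finite_norm by fastforce
  show "(\<lambda>x. norm (f x)) \<in> borel_measurable M"
    by (rule measurable_compose[OF borel_measurable_integrable[OF assms] borel_measurable_norm])
qed

lemma norm_integral_le:
  fixes f :: "'m \<Rightarrow> 'e::{real_normed_vector,second_countable_topology}"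
  assumes "integrable M f"
  shows "norm (integral\<^sup>L M f) \<le> (LINT x|M. norm (f x))"
proof -
  have "ennreal (norm (integral\<^sup>L M f)) \<le> (\<integral>\<^sup>+x. norm (f x) \<partial>M)"
    using assms by (rule integral_norm_bound_ennreal)
  also have "\<dots> = ennreal (LINT x|M. norm (f x))"
    using integrable_norm_of[OF assms] by (intro nn_integral_eq_integral) auto
  finally show ?thesis by (subst (asm) ennreal_le_iff) (auto intro: integral_nonneg_AE)
qed

section \<open>Square-integrable functions\<close>

lemma L2_D: "f \<in> L2 M \<Longrightarrow> f \<in> borel_measurable M" "f \<in> L2 M \<Longrightarrow> integrable M (\<lambda>x. (norm (f x))\<^sup>2)"
  by (auto simp: L2_def)

lemma L2_bound:
  assumes "f \<in> borel_measurable M" "integrable M g" "AE x in M. (norm (f x))\<^sup>2 \<le> g x"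
  shows "f \<in> L2 M"
  unfolding L2_def using assms
  by (auto intro!: Bochner_Integration.integrable_bound[OF assms(2)])

lemma power2_sum_le: "((a::real) + b)\<^sup>2 \<le> 2 * a\<^sup>2 + 2 * b\<^sup>2"
  using sum_squares_bound[of a b] by (simp add: power2_sum)

lemma norm_add_power2_le: "(norm (x + y))\<^sup>2 \<le> 2 * (norm x)\<^sup>2 + 2 * (norm (y::'a::real_normed_vector))\<^sup>2"
proof -
  have "(norm (x + y))\<^sup>2 \<le> (norm x + norm y)\<^sup>2" by (intro power_mono norm_triangle_ineq) auto
  then show ?thesis using power2_sum_le[of "norm x" "norm y"] by linarith
qed

lemma L2_add: assumes "f \<in> L2 M" "g \<in> L2 M" shows "(\<lambda>x. f x + g x) \<in> L2 M"
proof (rule L2_bound)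
  show "integrable M (\<lambda>x. 2 * (norm (f x))\<^sup>2 + 2 * (norm (g x))\<^sup>2)"
    using assms[THEN L2_D(2)] by simp
qed (use assms in \<open>auto intro!: norm_add_power2_le borel_measurable_add dest: L2_D\<close>)

lemma L2_scaleR: assumes "f \<in> L2 M" shows "(\<lambda>x. c *\<^sub>R f x) \<in> L2 M"
proof (rule L2_bound)
  show "integrable M (\<lambda>x. c\<^sup>2 * (norm (f x))\<^sup>2)" using assms by (auto dest: L2_D)
qed (use assms in \<open>auto simp: power_mult_distrib intro!: borel_measurable_scaleR dest: L2_D\<close>)

lemma L2_diff: assumes "f \<in> L2 M" "g \<in> L2 M" shows "(\<lambda>x. f x - g x) \<in> L2 M"
  using L2_add[OF assms(1) L2_scaleR[OF assms(2), of "-1"]] by simp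

lemma L2_zero [simp]: "(\<lambda>x. 0) \<in> L2 M"
  by (simp add: L2_def)

lemma L2_sum: "(\<And>i. i \<in> I \<Longrightarrow> f i \<in> L2 M) \<Longrightarrow> (\<lambda>x. \<Sum>i\<in>I. f i x) \<in> L2 M"
  by (induction I rule: infinite_finite_induct) (auto intro: L2_add)

lemma L2_scaleR_const: "f \<in> L2 M \<Longrightarrow> (\<lambda>x. f x *\<^sub>R c) \<in> L2 M"
  for c :: "'e::{real_normed_vector,second_countable_topology}"
proof (rule L2_bound)
  assume f: "f \<in> L2 M"
  show "integrable M (\<lambda>x. (norm c)\<^sup>2 * (norm (f x))\<^sup>2)" using L2_D[OF f] by (auto simp del: real_norm_def)
qed (auto simp: power_mult_distrib intro!: borel_measurable_scaleR dest: L2_D)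

lemma L2_norm_power2: "(L2_norm M f)\<^sup>2 = (LINT x|M. (norm (f x))\<^sup>2)"
  unfolding L2_norm_def by (subst real_sqrt_pow2) (auto intro: integral_nonneg_AE)

lemma L2_norm_nonneg [simp]: "0 \<le> L2_norm M f"
  by (auto simp: L2_norm_def intro: integral_nonneg_AE)

lemma L2_norm_mult_integrable:
  assumes "f \<in> L2 M" "g \<in> L2 M" shows "integrable M (\<lambda>x. norm (f x) * norm (g x))"
proof (rule Bochner_Integration.integrable_bound)
  show "integrable M (\<lambda>x. (norm (f x))\<^sup>2 + (norm (g x))\<^sup>2)" using assms by (auto dest: L2_D)
  show "(\<lambda>x. norm (f x) * norm (g x)) \<in> borel_measurable M"
    using assms by (auto dest!: L2_D(1) intro!: borel_measurable_times borel_measurable_norm)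
  have "norm (f x) * norm (g x) \<le> (norm (f x))\<^sup>2 + (norm (g x))\<^sup>2" for x
    using sum_squares_bound[of "norm (f x)" "norm (g x)"]
      mult_nonneg_nonneg[OF norm_ge_zero norm_ge_zero, of "f x" "g x"] by linarith
  then show "AE x in M. norm (norm (f x) * norm (g x)) \<le> norm ((norm (f x))\<^sup>2 + (norm (g x))\<^sup>2)"
    by auto
qed

text \<open>A nonnegative quadratic in r is evaluated at its minimiser \<open>c / b\<close>. For
  \<open>b = 0\<close> it is affine in r, hence nonnegative everywhere only if
  \<open>c = 0\<close>.\<close>

lemma discriminant_le:
  fixes a b c :: real
  assumes "\<And>r. 0 \<le> a - 2 * r * c + r\<^sup>2 * b" "0 \<le> a" "0 \<le> b" shows "c\<^sup>2 \<le> a * b"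
proof (cases "b = 0")
  case True
  have "c = 0"
  proof (rule ccontr)
    assume "c \<noteq> 0"
    \<comment> \<open>At this r the affine function a - 2 r c has the value -1.\<close>
    then show False using assms(1)[of "(a + 1) / (2 * c)"] True by (auto simp: field_simps)
  qed
  then show ?thesis using assms by simp
next
  case False
  have "0 \<le> a - 2 * (c / b) * c + (c / b)\<^sup>2 * b" by fact
  also have "\<dots> = a - c\<^sup>2 / b" using False by (simp add: power2_eq_square field_simps)
  finally show ?thesis using False assms(3) by (simp add: field_simps)
qed

lemma L2_Cauchy_Schwarz:
  assumes "f \<in> L2 M" "g \<in> L2 M"
  shows "(LINT x|M. norm (f x) * norm (g x)) \<le> L2_norm M f * L2_norm M g"
proof -
  let ?a = "LINT x|M. (norm (f x))\<^sup>2" and ?b = "LINT x|M. (norm (g x))\<^sup>2"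
    and ?c = "LINT x|M. norm (f x) * norm (g x)"
  have "?c\<^sup>2 \<le> ?a * ?b"
  proof (rule discriminant_le)
    fix r :: real
    have "0 \<le> (LINT x|M. (norm (f x) - r * norm (g x))\<^sup>2)" by (rule integral_nonneg_AE) simp
    also have "\<dots> = (LINT x|M. (norm (f x))\<^sup>2 - 2 * r * (norm (f x) * norm (g x)) + r\<^sup>2 * (norm (g x))\<^sup>2)"
      by (simp add: power2_diff power_mult_distrib algebra_simps)
    also have "\<dots> = ?a - 2 * r * ?c + r\<^sup>2 * ?b"
      using assms by (simp add: L2_D L2_norm_mult_integrable)
    finally show "0 \<le> ?a - 2 * r * ?c + r\<^sup>2 * ?b" .
  qed (auto intro: integral_nonneg_AE)
  then have "?c\<^sup>2 \<le> (L2_norm M f * L2_norm M g)\<^sup>2" by (simp add: power_mult_distrib L2_norm_power2)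
  then show ?thesis by (rule power2_le_imp_le) simp
qed

lemma L2_inner_integrable:
  assumes "f \<in> L2 M" "g \<in> L2 M" shows "integrable M (\<lambda>x. f x \<bullet> g x)"
proof (rule Bochner_Integration.integrable_bound[OF L2_norm_mult_integrable[OF assms]])
  show "(\<lambda>x. f x \<bullet> g x) \<in> borel_measurable M"
    using assms by (auto dest!: L2_D(1) intro!: borel_measurable_inner)
qed (auto simp: Cauchy_Schwarz_ineq2)

lemma L2_mult_integrable:
  "f \<in> L2 M \<Longrightarrow> g \<in> L2 M \<Longrightarrow> integrable M (\<lambda>x. f x * g x :: real)"
  using L2_inner_integrable[of f M g] by simp

lemma L2_inner_bound:
  assumes "f \<in> L2 M" "g \<in> L2 M" shows "\<bar>L2_inner M f g\<bar> \<le> L2_norm M f * L2_norm M g"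
proof -
  have "\<bar>L2_inner M f g\<bar> \<le> (LINT x|M. \<bar>f x \<bullet> g x\<bar>)"
    unfolding L2_inner_def by (rule integral_abs_bound)
  also have "\<dots> \<le> (LINT x|M. norm (f x) * norm (g x))"
    using assms by (intro integral_mono integrable_abs L2_inner_integrable L2_norm_mult_integrable)
      (auto simp: Cauchy_Schwarz_ineq2)
  also have "\<dots> \<le> L2_norm M f * L2_norm M g" using assms by (rule L2_Cauchy_Schwarz)
  finally show ?thesis .
qed

lemma L2_norm_triangle:
  assumes "f \<in> L2 M" "g \<in> L2 M"
  shows "L2_norm M (\<lambda>x. f x + g x) \<le> L2_norm M f + L2_norm M g"
proof (rule power2_le_imp_le)
  have "(LINT x|M. (norm (f x + g x))\<^sup>2)
      \<le> (LINT x|M. (norm (f x))\<^sup>2 + 2 * (norm (f x) * norm (g x)) + (norm (g x))\<^sup>2)"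
  proof (rule integral_mono)
    show "integrable M (\<lambda>x. (norm (f x + g x))\<^sup>2)" using L2_add[OF assms] by (rule L2_D)
    show "(norm (f x + g x))\<^sup>2 \<le> (norm (f x))\<^sup>2 + 2 * (norm (f x) * norm (g x)) + (norm (g x))\<^sup>2" for x
      using power_mono[OF norm_triangle_ineq[of "f x" "g x"], of 2] by (simp add: power2_sum)
  qed (use assms in \<open>simp add: L2_D L2_norm_mult_integrable\<close>)
  also have "\<dots> = (L2_norm M f)\<^sup>2 + 2 * (LINT x|M. norm (f x) * norm (g x)) + (L2_norm M g)\<^sup>2"
    using assms by (simp add: L2_D L2_norm_mult_integrable L2_norm_power2)
  also have "\<dots> \<le> (L2_norm M f + L2_norm M g)\<^sup>2"
    using L2_Cauchy_Schwarz[OF assms] by (simp add: power2_sum)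
  finally show "(L2_norm M (\<lambda>x. f x + g x))\<^sup>2 \<le> (L2_norm M f + L2_norm M g)\<^sup>2"
    by (simp add: L2_norm_power2)
qed simp

lemma L2_norm_diff_triangle:
  assumes "f \<in> L2 M" "g \<in> L2 M" "h \<in> L2 M"
  shows "L2_norm M (\<lambda>x. f x - h x) \<le> L2_norm M (\<lambda>x. f x - g x) + L2_norm M (\<lambda>x. g x - h x)"
  using L2_norm_triangle[OF L2_diff[OF assms(1,2)] L2_diff[OF assms(2,3)]] by simp

lemma L2_norm_diff_le:
  "f \<in> L2 M \<Longrightarrow> g \<in> L2 M \<Longrightarrow> L2_norm M (\<lambda>x. f x - g x) \<le> L2_norm M f + L2_norm M g"
  using L2_norm_diff_triangle[of f M "\<lambda>x. 0" g] by (simp add: L2_norm_def)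

lemma L2_norm_minus_commute: "L2_norm M (\<lambda>x. f x - g x) = L2_norm M (\<lambda>x. g x - f x)"
  by (simp add: L2_norm_def norm_minus_commute)

lemma L2_inner_simps:
  assumes "f \<in> L2 M" "g \<in> L2 M" "h \<in> L2 M"
  shows "L2_inner M (\<lambda>x. f x + g x) h = L2_inner M f h + L2_inner M g h"
    and "L2_inner M (\<lambda>x. f x - g x) h = L2_inner M f h - L2_inner M g h"
    and "L2_inner M (\<lambda>x. c *\<^sub>R f x) h = c * L2_inner M f h"
    and "L2_inner M h (\<lambda>x. f x + g x) = L2_inner M h f + L2_inner M h g"
    and "L2_inner M h (\<lambda>x. f x - g x) = L2_inner M h f - L2_inner M h g"
    and "L2_inner M h (\<lambda>x. c *\<^sub>R f x) = c * L2_inner M h f"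
  using assms by (simp_all add: L2_inner_def inner_simps L2_inner_integrable)

lemma L2_inner_commute: "L2_inner M f g = L2_inner M g f"
  by (simp add: L2_inner_def inner_commute)

lemma L2_norm_eq_sqrt_inner: "L2_norm M f = sqrt (L2_inner M f f)"
  by (simp add: L2_norm_def L2_inner_def power2_norm_eq_inner)

lemma L2_norm_eq_0_AE:
  assumes "f \<in> L2 M" "L2_norm M f = 0" shows "AE x in M. f x = 0"
proof -
  have "(LINT x|M. (norm (f x))\<^sup>2) = 0" using assms(2) by (metis L2_norm_power2 zero_power2)
  then have "AE x in M. (norm (f x))\<^sup>2 = 0"
    using assms by (subst (asm) integral_nonneg_eq_0_iff_AE) (auto dest: L2_D)
  then show ?thesis by eventually_elim simp
qed

section \<open>Almost sure and mean-square limits of geometrically convergent sequences\<close>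

lemma (in prob_space) L2_integrable_norm: assumes "f \<in> L2 M"
  shows "integrable M (\<lambda>x. norm (f x))" "(LINT x|M. norm (f x)) \<le> L2_norm M f"
proof -
  have 1: "(\<lambda>x. 1::real) \<in> L2 M" by (simp add: L2_def)
  have "L2_norm M (\<lambda>x. 1::real) = 1" by (simp add: L2_norm_def prob_space)
  then show "integrable M (\<lambda>x. norm (f x))" "(LINT x|M. norm (f x)) \<le> L2_norm M f"
    using L2_norm_mult_integrable[OF assms 1] L2_Cauchy_Schwarz[OF assms 1] by simp_all
qed

text \<open>On a probability space the L1 norm is at most the L2 norm, so the expected total length
  of the path n \<mapsto> \<open>V n x\<close> is bounded by a geometric series. The length is
  therefore finite almost surely, and no subsequence has to be extracted.\<close>

lemma (in prob_space) L2_geometric_AE_Cauchy: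
  fixes V :: "nat \<Rightarrow> 'a \<Rightarrow> 'e::{real_normed_vector,polish_space}"
  assumes V: "\<And>n. V n \<in> L2 M"
    and rate: "\<And>n. L2_norm M (\<lambda>x. V n x - V (Suc n) x) \<le> C * q ^ n" and q: "0 \<le> q" "q < 1"
  shows "AE x in M. Cauchy (\<lambda>n. V n x)"
proof -
  have Vm[measurable]: "V n \<in> borel_measurable M" for n using V by (rule L2_D)
  have L: "(\<lambda>x. V n x - V (Suc n) x) \<in> L2 M" for n using V by (intro L2_diff)
  let ?d = "\<lambda>n x. ennreal (norm (V n x - V (Suc n) x))"
  have "(\<integral>\<^sup>+x. ?d n x \<partial>M) \<le> ennreal (C * q ^ n)" for n
    using L2_integrable_norm[OF L[of n]] rate[of n]
    by (subst nn_integral_eq_integral) (auto intro!: ennreal_leI)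
  then have "(\<Sum>n. \<integral>\<^sup>+x. ?d n x \<partial>M) \<le> (\<Sum>n. ennreal (C * q ^ n))"
    by (intro suminf_le) auto
  also have "\<dots> < \<top>"
  proof -
    \<comment> \<open>The sign of \<open>C\<close> is read off from the rate at n = 0, where the
      left side is a norm.\<close>
    have "0 \<le> C * q ^ 0" using rate[of 0] L2_norm_nonneg order_trans by blast
    then have "0 \<le> C" by simp
    moreover have "summable (\<lambda>n. C * q ^ n)" using q by (intro summable_mult summable_geometric) simp
    ultimately show ?thesis using q by (subst suminf_ennreal2) auto
  qed
  finally have "(\<integral>\<^sup>+x. (\<Sum>n. ?d n x) \<partial>M) < \<top>" by (subst nn_integral_suminf) auto
  then have "AE x in M. (\<Sum>n. ?d n x) \<noteq> \<infinity>" by (intro nn_integral_PInf_AE) auto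
  then show ?thesis
  proof eventually_elim
    case (elim x)
    then have s: "summable (\<lambda>n. norm (V n x - V (Suc n) x))"
      by (intro summable_suminf_not_top) auto
    show ?case
    proof (rule metric_CauchyI)
      fix e :: real assume "0 < e"
      then obtain N where N: "\<And>m n. m \<ge> N \<Longrightarrow> norm (\<Sum>k=m..<n. norm (V k x - V (Suc k) x)) < e"
        using s unfolding summable_Cauchy by blast
      have le: "dist (V m x) (V n x) < e" if "N \<le> m" "m \<le> n" for m n
      proof -
        have "V m x - V n x = (\<Sum>k=m..<n. V k x - V (Suc k) x)"
          using that(2) by (induction n rule: dec_induct) (auto simp: algebra_simps)
        then have "norm (V m x - V n x) \<le> (\<Sum>k=m..<n. norm (V k x - V (Suc k) x))"
          by (metis norm_sum)
        also have "\<dots> < e" using N[OF that(1), of n] by (simp add: abs_of_nonneg sum_nonneg)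
        finally show ?thesis by (simp add: dist_norm)
      qed
      have "dist (V m x) (V n x) < e" if "N \<le> m" "N \<le> n" for m n
        using le[of m n] le[of n m] that by (cases "m \<le> n") (auto simp: dist_commute)
      then show "\<exists>N. \<forall>m\<ge>N. \<forall>n\<ge>N. dist (V m x) (V n x) < e" by blast
    qed
  qed
qed

text \<open>Telescoping bounds the distance from \<open>V n\<close> to every later term by the tail
  of a geometric series. With n fixed, Fatou's lemma passes this bound to the almost sure limit,
  which also yields square integrability of \<open>W\<close>.\<close>

lemma (in prob_space) L2_geometric_limit:
  fixes V :: "nat \<Rightarrow> 'a \<Rightarrow> 'e::{real_normed_vector,polish_space}"
  assumes V: "\<And>n. V n \<in> L2 M"
    and rate: "\<And>n. L2_norm M (\<lambda>x. V n x - V (Suc n) x) \<le> C * q ^ n" and q: "0 \<le> q" "q < 1"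
    and W[measurable]: "W \<in> borel_measurable M" and lim: "AE x in M. (\<lambda>n. V n x) \<longlonglongrightarrow> W x"
  shows "W \<in> L2 M" "(\<lambda>n. L2_norm M (\<lambda>x. V n x - W x)) \<longlonglongrightarrow> 0"
proof -
  have Vm[measurable]: "V n \<in> borel_measurable M" for n using V by (rule L2_D)
  have "0 \<le> C * q ^ 0" using rate[of 0] L2_norm_nonneg order_trans by blast
  then have C: "0 \<le> C" by simp
  let ?K = "\<lambda>n. C * q ^ n / (1 - q)"
  have tail: "L2_norm M (\<lambda>x. V n x - V (n + k) x) \<le> (\<Sum>i<k. C * q ^ (n + i))" for n k
  proof (induction k)
    case 0 then show ?case by (simp add: L2_norm_def)
  next
    case (Suc k)
    then show ?case
      using L2_norm_diff_triangle[OF V[of n] V[of "n + k"] V[of "Suc (n + k)"]] rate[of "n + k"] by simp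
  qed
  have geo: "(\<Sum>i<k. C * q ^ (n + i)) \<le> ?K n" for n k
  proof -
    have "(\<Sum>i<k. C * q ^ (n + i)) = C * q ^ n * (\<Sum>i<k. q ^ i)"
      by (simp add: power_add sum_distrib_left mult.assoc)
    also have "(\<Sum>i<k. q ^ i) = (1 - q ^ k) / (1 - q)" using q by (subst sum_gp_strict) auto
    also have "C * q ^ n * ((1 - q ^ k) / (1 - q)) \<le> C * q ^ n * (1 / (1 - q))"
      using q C by (intro mult_left_mono divide_right_mono) auto
    finally show ?thesis by simp
  qed
  have bound: "(\<integral>\<^sup>+x. ennreal ((norm (V n x - V (n + k) x))\<^sup>2) \<partial>M) \<le> ennreal ((?K n)\<^sup>2)" for n k
  proof -
    have "(LINT x|M. (norm (V n x - V (n + k) x))\<^sup>2) \<le> (?K n)\<^sup>2"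
      unfolding L2_norm_power2[symmetric]
      using order_trans[OF tail geo, of n k] by (intro power_mono) auto
    then show ?thesis
      using L2_D(2)[OF L2_diff[OF V[of n] V[of "n + k"]]]
      by (subst nn_integral_eq_integral) (auto intro!: ennreal_leI)
  qed
  have fatou: "(\<integral>\<^sup>+x. ennreal ((norm (V n x - W x))\<^sup>2) \<partial>M) \<le> ennreal ((?K n)\<^sup>2)" for n
  proof -
    have "(\<integral>\<^sup>+x. ennreal ((norm (V n x - W x))\<^sup>2) \<partial>M)
        = (\<integral>\<^sup>+x. liminf (\<lambda>k. ennreal ((norm (V n x - V (n + k) x))\<^sup>2)) \<partial>M)"
    proof (rule nn_integral_cong_AE)
      show "AE x in M. ennreal ((norm (V n x - W x))\<^sup>2)
          = liminf (\<lambda>k. ennreal ((norm (V n x - V (n + k) x))\<^sup>2))"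
        using lim
      proof eventually_elim
        case (elim x)
        have "(\<lambda>k. V (k + n) x) \<longlonglongrightarrow> W x" using elim by (rule LIMSEQ_ignore_initial_segment)
        then have "(\<lambda>k. ennreal ((norm (V n x - V (n + k) x))\<^sup>2)) \<longlonglongrightarrow> ennreal ((norm (V n x - W x))\<^sup>2)"
          by (intro tendsto_intros) (simp add: add.commute)
        then show ?case by (intro lim_imp_Liminf[symmetric]) auto
      qed
    qed
    also have "\<dots> \<le> liminf (\<lambda>k. \<integral>\<^sup>+x. ennreal ((norm (V n x - V (n + k) x))\<^sup>2) \<partial>M)"
      by (rule nn_integral_liminf) auto
    also have "\<dots> \<le> ennreal ((?K n)\<^sup>2)"
      by (intro Liminf_le always_eventually allI bound) simp
    finally show ?thesis .
  qed
  have D: "(\<lambda>x. V n x - W x) \<in> L2 M" for n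
    unfolding L2_def using fatou[of n]
    by (auto intro!: integrableI_bounded elim!: order.strict_trans1)
  show "W \<in> L2 M" using L2_diff[OF V[of 0] D[of 0]] by simp
  have le: "L2_norm M (\<lambda>x. V n x - W x) \<le> ?K n" for n
  proof (rule power2_le_imp_le)
    have "ennreal (LINT x|M. (norm (V n x - W x))\<^sup>2) \<le> ennreal ((?K n)\<^sup>2)"
      using fatou[of n] L2_D(2)[OF D[of n]] by (subst (asm) nn_integral_eq_integral) auto
    then show "(L2_norm M (\<lambda>x. V n x - W x))\<^sup>2 \<le> (?K n)\<^sup>2"
      by (simp add: L2_norm_power2 ennreal_le_iff)
  qed (use q C in auto)
  have "?K \<longlonglongrightarrow> C * 0 / (1 - q)" using q by (intro tendsto_intros LIMSEQ_power_zero) auto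
  then have K0: "?K \<longlonglongrightarrow> 0" by simp
  show "(\<lambda>n. L2_norm M (\<lambda>x. V n x - W x)) \<longlonglongrightarrow> 0"
    by (rule real_tendsto_sandwich[OF _ _ tendsto_const K0]) (auto simp: le)
qed

section \<open>Increments of fractional Brownian motion\<close>

text \<open>The covariance of the increments of \<open>B\<close> over \<open>(l, r]\<close> and
  \<open>(l', r']\<close>; the same expression is the coefficient in
  \<open>H0_inner\<close>.\<close>

definition incr_cov :: "real \<Rightarrow> real \<Rightarrow> real \<Rightarrow> real \<Rightarrow> real \<Rightarrow> real" where
  "incr_cov H l r l' r' = fbm_cov H r r' - fbm_cov H r l' - fbm_cov H l r' + fbm_cov H l l'"

lemma fbm_cov_commute: "fbm_cov H s t = fbm_cov H t s"
  by (simp add: fbm_cov_def abs_minus_commute)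

lemma incr_cov_commute: "incr_cov H l r l' r' = incr_cov H l' r' l r"
  by (simp add: incr_cov_def fbm_cov_commute)

text \<open>Convexity of the power for p \<ge> 1 and concavity for p \<le> 1, read off from the sign
  of the derivative. The derivative is taken only in the open interval, as the power need not be
  differentiable at 0.\<close>

lemma powr_shift_diff_mono:
  fixes p a x y :: real
  assumes "0 \<le> x" "x \<le> y" "0 \<le> a" "0 < p"
  shows "1 \<le> p \<Longrightarrow> (x + a) powr p - x powr p \<le> (y + a) powr p - y powr p"
    and "p \<le> 1 \<Longrightarrow> (y + a) powr p - y powr p \<le> (x + a) powr p - x powr p"
proof -
  let ?f = "\<lambda>u. (u + a) powr p - u powr p"
  have c: "continuous_on {x..y} ?f"
    using assms by (intro continuous_on_diff continuous_on_powr' continuous_intros) auto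
  have D: "(?f has_real_derivative p * (u + a) powr (p - 1) - p * u powr (p - 1)) (at u)" if "x < u" for u
    using assms that by (auto intro!: derivative_eq_intros)
  have m1: "u powr (p - 1) \<le> (u + a) powr (p - 1)" if "1 \<le> p" "x < u" for u
    using assms that by (intro powr_mono2) auto
  have m2: "(u + a) powr (p - 1) \<le> u powr (p - 1)" if "p \<le> 1" "x < u" for u
    using assms that by (intro powr_mono2') auto
  show "?f x \<le> ?f y" if "1 \<le> p"
  proof (rule DERIV_nonneg_imp_increasing_open[OF \<open>x \<le> y\<close> _ c])
    fix u assume "x < u" "u < y"
    then show "\<exists>d. (?f has_real_derivative d) (at u) \<and> 0 \<le> d"
      using D[of u] m1[OF that, of u] \<open>0 < p\<close> by (intro exI conjI) auto
  qed
  show "?f y \<le> ?f x" if "p \<le> 1"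
  proof (rule DERIV_nonpos_imp_decreasing_open[OF \<open>x \<le> y\<close> _ c])
    fix u assume "x < u" "u < y"
    then show "\<exists>d. (?f has_real_derivative d) (at u) \<and> d \<le> 0"
      using D[of u] m2[OF that, of u] \<open>0 < p\<close> by (intro exI conjI) auto
  qed
qed

text \<open>For ordered intervals the covariance is half a second-order difference of z \<mapsto>
  \<open>z powr (2*H)\<close>, so its sign is decided by convexity or concavity of that
  power.\<close>

lemma incr_cov_sign:
  assumes "0 \<le> l" "l \<le> r" "r \<le> l'" "l' \<le> r'" "0 < H"
  shows "1/2 \<le> H \<Longrightarrow> 0 \<le> incr_cov H l r l' r'" and "H \<le> 1/2 \<Longrightarrow> incr_cov H l r l' r' \<le> 0"
proof -
  have eq: "incr_cov H l r l' r' = (((r' - r) + (r - l)) powr (2*H) - (r' - r) powr (2*H)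
      - (((l' - r) + (r - l)) powr (2*H) - (l' - r) powr (2*H))) / 2"
    using assms by (simp add: incr_cov_def fbm_cov_def field_simps)
  show "1/2 \<le> H \<Longrightarrow> 0 \<le> incr_cov H l r l' r'"
    unfolding eq using powr_shift_diff_mono(1)[of "l' - r" "r' - r" "r - l" "2*H"] assms by auto
  show "H \<le> 1/2 \<Longrightarrow> incr_cov H l r l' r' \<le> 0"
    unfolding eq using powr_shift_diff_mono(2)[of "l' - r" "r' - r" "r - l" "2*H"] assms by auto
qed

lemma incr_cov_diag: "0 \<le> l \<Longrightarrow> l \<le> r \<Longrightarrow> incr_cov H l r l r = (r - l) powr (2*H)"
  by (simp add: incr_cov_def fbm_cov_def field_simps)

lemma incr_cov_total:
  assumes "0 \<le> l" "l \<le> r" "r \<le> T"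
  shows "incr_cov H l r 0 T
    = (r powr (2*H) - l powr (2*H) + (T - l) powr (2*H) - (T - r) powr (2*H)) / 2"
  using assms by (simp add: incr_cov_def fbm_cov_def field_simps)

text \<open>Mean value theorem with the derivative bounded at a common upper end \<open>X\<close>,
  which makes the constant the same for all cells. Applied to both differences in a row sum, with
  \<open>X\<close> equal to T, it is the origin of \<open>2 * H * T powr (2 * H - 1)\<close> in the
  energy bound.\<close>

lemma powr_diff_le:
  fixes p x y X :: real
  assumes "0 \<le> y" "y \<le> x" "x \<le> X" "1 \<le> p"
  shows "x powr p - y powr p \<le> p * X powr (p - 1) * (x - y)"
proof (cases "y < x")
  case True
  have c: "continuous_on {y..x} (\<lambda>u. u powr p)"
    using assms by (intro continuous_on_powr' continuous_intros) auto
  have D: "((\<lambda>u. u powr p) has_real_derivative p * u powr (p - 1)) (at u)" if "y < u" for u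
    using assms that by (auto intro!: derivative_eq_intros)
  obtain k u where u0: "y < u" "u < x" "((\<lambda>u. u powr p) has_real_derivative k) (at u)"
      "x powr p - y powr p = (x - y) * k"
    using MVT[OF True c] D real_differentiable_def by blast
  then have u: "y < u" "u < x" "x powr p - y powr p = (x - y) * (p * u powr (p - 1))"
    using DERIV_unique[OF u0(3) D] by auto
  have "u powr (p - 1) \<le> X powr (p - 1)" using u assms by (intro powr_mono2) auto
  then have "(x - y) * (p * u powr (p - 1)) \<le> (x - y) * (p * X powr (p - 1))"
    using assms by (intro mult_left_mono) auto
  then show ?thesis using u by (simp add: mult_ac)
qed (use assms in auto)

section \<open>The covariance matrix of the increments on a uniform grid\<close>

definition grid_cov :: "real \<Rightarrow> real \<Rightarrow> nat \<Rightarrow> nat \<Rightarrow> real" where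
  "grid_cov H \<delta> i j = incr_cov H (real i * \<delta>) (real (Suc i) * \<delta>) (real j * \<delta>) (real (Suc j) * \<delta>)"

lemma grid_cov_commute: "grid_cov H \<delta> i j = grid_cov H \<delta> j i"
  by (simp add: grid_cov_def incr_cov_commute)

lemma grid_cov_offdiag:
  assumes "0 \<le> \<delta>" "0 < H" "i \<noteq> j"
  shows "1/2 \<le> H \<Longrightarrow> 0 \<le> grid_cov H \<delta> i j" and "H \<le> 1/2 \<Longrightarrow> grid_cov H \<delta> i j \<le> 0"
proof -
  have lt: "(1/2 \<le> H \<longrightarrow> 0 \<le> grid_cov H \<delta> i j) \<and> (H \<le> 1/2 \<longrightarrow> grid_cov H \<delta> i j \<le> 0)" if "i < j" for i j
  proof -
    have "real (Suc i) \<le> real j" using that by simp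
    then have "real (Suc i) * \<delta> \<le> real j * \<delta>" using assms by (rule_tac mult_right_mono)
    moreover have "real i * \<delta> \<le> real (Suc i) * \<delta>" "real j * \<delta> \<le> real (Suc j) * \<delta>" "0 \<le> real i * \<delta>"
      using assms by (auto intro!: mult_right_mono)
    ultimately show ?thesis
      unfolding grid_cov_def using assms(2) incr_cov_sign by blast
  qed
  show "1/2 \<le> H \<Longrightarrow> 0 \<le> grid_cov H \<delta> i j" "H \<le> 1/2 \<Longrightarrow> grid_cov H \<delta> i j \<le> 0"
    using lt[of i j] lt[of j i] assms(3) grid_cov_commute[of H \<delta> i j] by (auto simp: neq_iff)
qed

lemma grid_cov_row: "(\<Sum>j<N. grid_cov H \<delta> i j) = incr_cov H (real i * \<delta>) (real (Suc i) * \<delta>) 0 (real N * \<delta>)"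
  by (induction N) (simp_all add: grid_cov_def incr_cov_def)

text \<open>Row sums telescope to the covariance of one increment with the whole path. For \<open>H \<ge> 1/2\<close> all
  entries are nonnegative, so this bounds the absolute row sum. For \<open>H \<le> 1/2\<close> only the diagonal entry
  is positive, and as the row sum is nonnegative the off-diagonal part is dominated by it.\<close>

lemma grid_cov_abs_row:
  assumes "0 < H" "0 < T" "i < N"
  shows "(\<Sum>j<N. \<bar>grid_cov H (T / N) i j\<bar>)
    \<le> max 2 (2 * H * T powr (2 * H - 1)) * (T / N) powr (min 1 (2 * H))"
proof -
  define \<delta> where "\<delta> = T / N"
  have \<delta>: "0 < \<delta>" "real N * \<delta> = T" using assms by (auto simp: \<delta>_def)
  let ?l = "real i * \<delta>" and ?r = "real (Suc i) * \<delta>"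
  have lr: "0 \<le> ?l" "?l \<le> ?r" "?r - ?l = \<delta>" using \<delta> by (auto simp: algebra_simps)
  have "?r \<le> real N * \<delta>" using assms(3) \<delta>(1) by (intro mult_right_mono) auto
  then have rT: "?r \<le> T" using \<delta> by simp
  have row: "(\<Sum>j<N. grid_cov H \<delta> i j)
      = (?r powr (2*H) - ?l powr (2*H) + (T - ?l) powr (2*H) - (T - ?r) powr (2*H)) / 2"
    unfolding grid_cov_row \<delta>(2) by (rule incr_cov_total) (use lr rT in auto)
  have diag: "grid_cov H \<delta> i i = \<delta> powr (2*H)"
    unfolding grid_cov_def using incr_cov_diag[OF lr(1,2)] lr(3) by simp
  show ?thesis
  proof (cases "1/2 \<le> H")
    case True
    have "0 \<le> grid_cov H \<delta> i j" for j
      using grid_cov_offdiag(1)[of \<delta> H i j] True assms \<delta> diag by (cases "i = j") auto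
    then have "(\<Sum>j<N. \<bar>grid_cov H \<delta> i j\<bar>) = (\<Sum>j<N. grid_cov H \<delta> i j)" by simp
    also have "\<dots> \<le> 2 * H * T powr (2 * H - 1) * \<delta>"
    proof -
      have "?r powr (2*H) - ?l powr (2*H) \<le> (2*H) * T powr (2*H - 1) * (?r - ?l)"
        using lr rT True by (intro powr_diff_le) auto
      moreover have "(T - ?l) powr (2*H) - (T - ?r) powr (2*H)
          \<le> (2*H) * T powr (2*H - 1) * ((T - ?l) - (T - ?r))"
        using lr rT True by (intro powr_diff_le) auto
      moreover have "(T - ?l) - (T - ?r) = \<delta>" using lr(3) by simp
      ultimately show ?thesis unfolding row using lr(3) by simp
    qed
    also have "\<dots> \<le> max 2 (2 * H * T powr (2 * H - 1)) * \<delta>" using \<delta> by (intro mult_right_mono) auto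
    finally show ?thesis using True \<delta> unfolding \<delta>_def[symmetric] by (simp add: min_def)
  next
    case False
    \<comment> \<open>The absolute value is minus the entry except on the diagonal, where the entry
      \<open>\<delta> powr (2*H)\<close> has to be counted twice to make up for the sign. This is
      the source of the constant 2.\<close>
    have off: "\<bar>grid_cov H \<delta> i j\<bar> = (if i = j then 2 * \<delta> powr (2*H) else 0) - grid_cov H \<delta> i j" for j
      using grid_cov_offdiag(2)[of \<delta> H i j] False assms \<delta> diag by (cases "i = j") auto
    have "0 \<le> (\<Sum>j<N. grid_cov H \<delta> i j)"
    proof -
      have "?l powr (2*H) \<le> ?r powr (2*H)" "(T - ?r) powr (2*H) \<le> (T - ?l) powr (2*H)"
        using lr rT assms by (auto intro!: powr_mono2)
      then show ?thesis unfolding row by simp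
    qed
    then have "(\<Sum>j<N. \<bar>grid_cov H \<delta> i j\<bar>) \<le> 2 * \<delta> powr (2*H)"
      unfolding off using assms(3) by (simp add: sum_subtractf)
    also have "\<dots> \<le> max 2 (2 * H * T powr (2 * H - 1)) * \<delta> powr (2*H)" by (intro mult_right_mono) auto
    finally show ?thesis using False unfolding \<delta>_def[symmetric] by (simp add: min_def)
  qed
qed

section \<open>The isometry on step functions and the energy bound for grid sums\<close>

locale fbm_space = prob_space M for M :: "'o measure" +
  fixes H :: real and B :: "real \<Rightarrow> 'o \<Rightarrow> real"
  assumes H: "0 < H" "H < 1" and fbm: "fractional_brownian_motion M H B"
begin

lemma B_L2: assumes "0 \<le> t" shows "B t \<in> L2 M"
proof -
  have "centered_gaussian M (\<lambda>\<omega>. \<Sum>s\<in>{t}. 1 * B s \<omega>)"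
    using fbm assms unfolding fractional_brownian_motion_def by (elim conjE allE[of _ "{t}"] allE[of _ "\<lambda>_. 1"]) auto
  then have cg: "centered_gaussian M (B t)" by simp
  then have m: "B t \<in> borel_measurable M" by (simp add: centered_gaussian_def)
  from cg consider \<sigma> where "\<sigma> > 0" "distributed M lborel (B t) (normal_density 0 \<sigma>)"
    | "AE \<omega> in M. B t \<omega> = 0" by (auto simp: centered_gaussian_def)
  then have "integrable M (\<lambda>\<omega>. (B t \<omega>)\<^sup>2)"
  proof cases
    case 1
    have "integrable lborel (\<lambda>x. normal_density 0 \<sigma> x * x\<^sup>2)"
      using integrable_normal_moment[OF 1(1), of 0 2] by simp
    then show ?thesis
      by (subst (asm) distributed_integrable[OF 1(2)]) auto
  next
    case 2
    then have "AE \<omega> in M. (B t \<omega>)\<^sup>2 = 0" by eventually_elim simp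
    then show ?thesis
      using m by (subst integrable_cong_AE[where g="\<lambda>_. 0"]) auto
  qed
  then show ?thesis using m by (simp add: L2_def)
qed

lemma incr_L2: "0 \<le> l \<Longrightarrow> 0 \<le> r \<Longrightarrow> (\<lambda>\<omega>. B r \<omega> - B l \<omega>) \<in> L2 M"
  by (intro L2_diff B_L2)

lemma B_cov: "0 \<le> s \<Longrightarrow> 0 \<le> t \<Longrightarrow> (LINT \<omega>|M. B s \<omega> * B t \<omega>) = fbm_cov H s t"
  using fbm by (simp add: fractional_brownian_motion_def)

lemma incr_B_cov:
  assumes "0 \<le> l" "0 \<le> r" "0 \<le> s"
  shows "(LINT \<omega>|M. (B r \<omega> - B l \<omega>) * B s \<omega>) = fbm_cov H r s - fbm_cov H l s"
  using assms by (simp add: left_diff_distrib L2_mult_integrable B_L2 B_cov)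

lemma incr_incr_cov:
  assumes "0 \<le> l" "0 \<le> r" "0 \<le> l'" "0 \<le> r'"
  shows "(LINT \<omega>|M. (B r \<omega> - B l \<omega>) * (B r' \<omega> - B l' \<omega>)) = incr_cov H l r l' r'"
  using assms
  by (simp add: right_diff_distrib left_diff_distrib L2_mult_integrable B_L2 B_cov incr_cov_def)

lemma step_integral_simps:
  "step_integral B [] = (\<lambda>\<omega>. 0)"
  "step_integral B ((a, l, r) # xs) = (\<lambda>\<omega>. (B r \<omega> - B l \<omega>) *\<^sub>R a + step_integral B xs \<omega>)"
  by (auto simp: step_integral_def)

lemma step_integral_L2:
  fixes xs :: "('e::{real_normed_vector,second_countable_topology} \<times> real \<times> real) list"
  shows "step_list t xs \<Longrightarrow> step_integral B xs \<in> L2 M"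
proof (induction xs)
  case (Cons x xs)
  then show ?case
    by (cases x) (auto simp: step_integral_simps step_list_def intro!: L2_add L2_scaleR_const incr_L2)
qed (simp add: step_integral_simps)

text \<open>The Wiener isometry. Bilinearity reduces it to a single pair of increments; the outer
  induction runs over \<open>xs\<close>, the inner one over \<open>ys\<close>.\<close>

lemma step_integral_inner:
  fixes xs ys :: "('e::{real_inner,second_countable_topology} \<times> real \<times> real) list"
  assumes "step_list t xs" "step_list t ys"
  shows "L2_inner M (step_integral B xs) (step_integral B ys) = H0_inner H xs ys"
  using assms(1)
proof (induction xs)
  case Nil
  then show ?case by (simp add: step_integral_simps L2_inner_def H0_inner_def)
next
  case (Cons x xs)
  obtain a l r where x: "x = (a, l, r)" by (cases x)
  have lr: "0 \<le> l" "0 \<le> r" and xs: "step_list t xs" using Cons.prems by (auto simp: step_list_def x)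
  have 1: "L2_inner M (\<lambda>\<omega>. (B r \<omega> - B l \<omega>) *\<^sub>R a) (step_integral B ys)
      = (\<Sum>(a', l', r')\<leftarrow>ys. incr_cov H l r l' r' * (a \<bullet> a'))"
    using assms(2)
  proof (induction ys)
    case Nil
    then show ?case by (simp add: step_integral_simps L2_inner_def)
  next
    case (Cons y ys)
    obtain a' l' r' where y: "y = (a', l', r')" by (cases y)
    have lr': "0 \<le> l'" "0 \<le> r'" and ys: "step_list t ys" using Cons.prems by (auto simp: step_list_def y)
    have "L2_inner M (\<lambda>\<omega>. (B r \<omega> - B l \<omega>) *\<^sub>R a) (\<lambda>\<omega>. (B r' \<omega> - B l' \<omega>) *\<^sub>R a')
        = incr_cov H l r l' r' * (a \<bullet> a')"
      unfolding L2_inner_def incr_incr_cov[OF lr lr', symmetric]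
      by (subst integral_mult_left_zero[symmetric]) (simp add: mult_ac)
    then show ?case
      using Cons.IH[OF ys] lr lr' ys
      by (simp add: y step_integral_simps L2_inner_simps L2_scaleR_const incr_L2 step_integral_L2)
  qed
  show ?case
    using Cons.IH[OF xs] 1 lr xs assms(2)
    by (simp add: x step_integral_simps L2_inner_simps L2_scaleR_const incr_L2 step_integral_L2
        H0_inner_def incr_cov_def)
qed

text \<open>Translates mean-square estimates of integrals into the Cauchy condition of
  \<open>H0_represents\<close>.\<close>

lemma H0_dist_eq:
  fixes xs ys :: "('e::{real_inner,second_countable_topology} \<times> real \<times> real) list"
  assumes "step_list t xs" "step_list t ys"
  shows "H0_dist H xs ys = L2_norm M (\<lambda>\<omega>. step_integral B xs \<omega> - step_integral B ys \<omega>)"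
proof -
  note L = step_integral_L2[OF assms(1)] step_integral_L2[OF assms(2)]
  have "L2_inner M (\<lambda>\<omega>. step_integral B xs \<omega> - step_integral B ys \<omega>)
          (\<lambda>\<omega>. step_integral B xs \<omega> - step_integral B ys \<omega>)
      = H0_inner H xs xs - 2 * H0_inner H xs ys + H0_inner H ys ys"
    using L by (simp add: L2_inner_simps L2_diff step_integral_inner[OF assms(1,1), symmetric]
        step_integral_inner[OF assms, symmetric] step_integral_inner[OF assms(2,2), symmetric]
        L2_inner_commute[of M "step_integral B ys" "step_integral B xs"])
  then show ?thesis by (simp add: H0_dist_def L2_norm_eq_sqrt_inner)
qed

definition grid_sum :: "real \<Rightarrow> nat \<Rightarrow> (nat \<Rightarrow> 'e::real_normed_vector) \<Rightarrow> 'o \<Rightarrow> 'e" where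
  "grid_sum \<delta> N d \<omega> = (\<Sum>j<N. (B (real (Suc j) * \<delta>) \<omega> - B (real j * \<delta>) \<omega>) *\<^sub>R d j)"

lemma grid_sum_L2:
  fixes d :: "nat \<Rightarrow> 'e::{real_normed_vector,second_countable_topology}"
  shows "0 \<le> \<delta> \<Longrightarrow> grid_sum \<delta> N d \<in> L2 M"
  unfolding grid_sum_def by (intro L2_sum L2_scaleR_const incr_L2) auto

lemma grid_sum_diff: "grid_sum \<delta> N (\<lambda>j. d j - d' j) \<omega> = grid_sum \<delta> N d \<omega> - grid_sum \<delta> N d' \<omega>"
  by (simp add: grid_sum_def sum_subtractf scaleR_diff_right)

text \<open>The variance is a quadratic form in the vectors \<open>d j\<close>. Splitting each
  product by 2|xy| \<le> x^2 + y^2 gives two halves, which agree by symmetry of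
  \<open>grid_cov\<close>; what remains is the absolute row sum, bounded uniformly in the
  row.\<close>

lemma grid_sum_energy:
  fixes d :: "nat \<Rightarrow> 'e::{real_inner,second_countable_topology}"
  assumes "0 < T"
  shows "(L2_norm M (grid_sum (T / N) N d))\<^sup>2
    \<le> max 2 (2 * H * T powr (2 * H - 1)) * (T / N) powr (min 1 (2 * H)) * (\<Sum>j<N. (norm (d j))\<^sup>2)"
proof -
  let ?\<delta> = "T / N"
  let ?c = "grid_cov H ?\<delta>"
  let ?K = "max 2 (2 * H * T powr (2 * H - 1)) * ?\<delta> powr (min 1 (2 * H))"
  have \<delta>: "0 \<le> ?\<delta>" using assms by simp
  let ?D = "\<lambda>j \<omega>. B (real (Suc j) * ?\<delta>) \<omega> - B (real j * ?\<delta>) \<omega>"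
  have D: "?D j \<in> L2 M" for j using \<delta> by (intro incr_L2 mult_nonneg_nonneg) auto
  have E: "(LINT \<omega>|M. ?D i \<omega> * ?D j \<omega>) = ?c i j" for i j
    unfolding grid_cov_def using \<delta> by (intro incr_incr_cov mult_nonneg_nonneg) auto
  have "(L2_norm M (grid_sum ?\<delta> N d))\<^sup>2 = (LINT \<omega>|M. (\<Sum>i<N. \<Sum>j<N. (?D i \<omega> * ?D j \<omega>) * (d i \<bullet> d j)))"
    unfolding L2_norm_power2 power2_norm_eq_inner grid_sum_def inner_sum_left
    unfolding inner_sum_right inner_scaleR_left inner_scaleR_right
    by (subst sum.swap) (simp only: mult.assoc inner_commute)
  also have "\<dots> = (\<Sum>i<N. \<Sum>j<N. ?c i j * (d i \<bullet> d j))"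
  proof -
    have int: "integrable M (\<lambda>\<omega>. ?D i \<omega> * ?D j \<omega> * (d i \<bullet> d j))" for i j
      using D by (intro integrable_mult_left L2_mult_integrable)
    have eq: "(LINT \<omega>|M. ?D i \<omega> * ?D j \<omega> * (d i \<bullet> d j)) = ?c i j * (d i \<bullet> d j)" for i j
      unfolding E[symmetric] by (rule integral_mult_left_zero)
    show ?thesis
      unfolding eq[symmetric] 
      by (subst Bochner_Integration.integral_sum, intro Bochner_Integration.integrable_sum int,
          intro sum.cong refl Bochner_Integration.integral_sum int)
  qed
  also have "\<dots> \<le> (\<Sum>i<N. \<Sum>j<N. \<bar>?c i j\<bar> * (norm (d i))\<^sup>2 / 2 + \<bar>?c i j\<bar> * (norm (d j))\<^sup>2 / 2)"
  proof (intro sum_mono)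
    fix i j
    have "\<bar>d i \<bullet> d j\<bar> \<le> norm (d i) * norm (d j)" by (rule Cauchy_Schwarz_ineq2)
    also have "\<dots> \<le> ((norm (d i))\<^sup>2 + (norm (d j))\<^sup>2) / 2"
      using sum_squares_bound[of "norm (d i)" "norm (d j)"] by simp
    finally have "\<bar>?c i j\<bar> * \<bar>d i \<bullet> d j\<bar> \<le> \<bar>?c i j\<bar> * (((norm (d i))\<^sup>2 + (norm (d j))\<^sup>2) / 2)"
      by (intro mult_left_mono) auto
    moreover have "?c i j * (d i \<bullet> d j) \<le> \<bar>?c i j\<bar> * \<bar>d i \<bullet> d j\<bar>"
      by (metis abs_ge_self abs_mult)
    ultimately show "?c i j * (d i \<bullet> d j)
        \<le> \<bar>?c i j\<bar> * (norm (d i))\<^sup>2 / 2 + \<bar>?c i j\<bar> * (norm (d j))\<^sup>2 / 2"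
      by (simp add: field_simps)
  qed
  also have "\<dots> = (\<Sum>i<N. (norm (d i))\<^sup>2 * (\<Sum>j<N. \<bar>?c i j\<bar>))"
  proof -
    have 1: "(\<Sum>i<N. \<Sum>j<N. \<bar>?c i j\<bar> * (norm (d i))\<^sup>2 / 2) = (\<Sum>i<N. (norm (d i))\<^sup>2 * (\<Sum>j<N. \<bar>?c i j\<bar>)) / 2"
      by (simp add: sum_distrib_left sum_divide_distrib mult.commute)
    have "(\<Sum>i<N. \<Sum>j<N. \<bar>?c i j\<bar> * (norm (d j))\<^sup>2 / 2) = (\<Sum>j<N. \<Sum>i<N. \<bar>?c i j\<bar> * (norm (d j))\<^sup>2 / 2)"
      by (rule sum.swap)
    also have "\<dots> = (\<Sum>j<N. \<Sum>i<N. \<bar>?c j i\<bar> * (norm (d j))\<^sup>2 / 2)"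
      by (simp add: grid_cov_commute)
    finally show ?thesis using 1 by (simp add: sum.distrib)
  qed
  also have "\<dots> \<le> (\<Sum>i<N. (norm (d i))\<^sup>2 * ?K)"
    using grid_cov_abs_row[OF H(1) assms] by (intro sum_mono mult_left_mono) auto
  finally show ?thesis by (simp add: sum_distrib_right mult.commute)
qed

end

section \<open>Uniqueness of the Wiener integral\<close>

text \<open>The odd antiderivative of z \<mapsto> \<open>\<bar>z\<bar> powr p\<close> on the whole
  line. With it, integrals of |s - y| to the power 2H need no distinction by the sign of s -
  y.\<close>

definition powr_prim :: "real \<Rightarrow> real \<Rightarrow> real" where
  "powr_prim p z = z * \<bar>z\<bar> powr p / (p + 1)"

lemma continuous_on_Icc_norm_bounded:
  fixes f :: "real \<Rightarrow> 'e::real_normed_vector"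
  assumes "continuous_on {a..b} f"
  obtains K where "0 \<le> K" "\<And>s. s \<in> {a..b} \<Longrightarrow> norm (f s) \<le> K"
proof -
  have "bounded (f ` {a..b})" using assms by (intro compact_imp_bounded compact_continuous_image) auto
  then obtain K where "\<And>s. s \<in> {a..b} \<Longrightarrow> norm (f s) \<le> K" unfolding bounded_iff by blast
  then show thesis using that[of "max 0 K"] by (meson max.cobounded1 max.coboundedI2)
qed

lemma continuous_abs_powr: "0 < (p::real) \<Longrightarrow> continuous_on S f \<Longrightarrow> continuous_on S (\<lambda>x. \<bar>f x\<bar> powr p)"
  by (intro continuous_on_powr' continuous_intros) auto

lemma powr_prim_deriv:
  assumes "0 < p" shows "(powr_prim p has_real_derivative \<bar>z\<bar> powr p) (at z)"
proof (cases z "0::real" rule: linorder_cases)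
  case less
  have "((\<lambda>z. z * (- z) powr p / (p + 1)) has_real_derivative
      ((- z) powr p + z * (- (p * (- z) powr (p - 1)))) / (p + 1)) (at z)"
    using less assms by (auto intro!: derivative_eq_intros)
  moreover have "((- z) powr p + z * (- (p * (- z) powr (p - 1)))) / (p + 1) = \<bar>z\<bar> powr p"
  proof -
    have "(- z) powr p = (- z) * (- z) powr (p - 1)"
      using less powr_mult_base[of "- z" "p - 1"] by simp
    then have "(- z) powr p + z * (- (p * (- z) powr (p - 1))) = (p + 1) * (- z) powr p"
      by (simp add: algebra_simps)
    then show ?thesis using less assms by simp
  qed
  ultimately show ?thesis
    using less by (auto simp: powr_prim_def elim!: has_field_derivative_transform_within_open[of _ _ _ "{..<0}"])
next
  case equal
  \<comment> \<open>The function is the difference quotient of \<open>powr_prim p\<close> at 0,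
    extended continuously by its limit 0.\<close>
  have "continuous_on UNIV (\<lambda>h. \<bar>h\<bar> powr p / (p + 1))"
    using assms by (intro continuous_intros continuous_abs_powr) auto
  then have "((\<lambda>h. \<bar>h\<bar> powr p / (p + 1)) \<longlongrightarrow> \<bar>0\<bar> powr p / (p + 1)) (at 0)"
    unfolding continuous_on_eq_continuous_at[OF open_UNIV] isCont_def by blast
  then have "((\<lambda>h. \<bar>h\<bar> powr p / (p + 1)) \<longlongrightarrow> 0) (at 0)" using assms by simp
  then have "((\<lambda>h. (powr_prim p (0 + h) - powr_prim p 0) / h) \<longlongrightarrow> 0) (at 0)"
    by (rule Lim_transform_eventually) (auto simp: powr_prim_def eventually_at_filter)
  then show ?thesis using equal assms by (simp add: DERIV_def)
next
  case greater
  have "((\<lambda>z. z * z powr p / (p + 1)) has_real_derivative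
      (z powr p + z * (p * z powr (p - 1))) / (p + 1)) (at z)"
    using greater assms by (auto intro!: derivative_eq_intros)
  moreover have "(z powr p + z * (p * z powr (p - 1))) / (p + 1) = \<bar>z\<bar> powr p"
  proof -
    have "z powr p = z * z powr (p - 1)" using greater powr_mult_base[of z "p - 1"] by simp
    then have "z powr p + z * (p * z powr (p - 1)) = (p + 1) * z powr p" by (simp add: algebra_simps)
    then show ?thesis using greater assms by simp
  qed
  ultimately show ?thesis
    using greater by (auto simp: powr_prim_def elim!: has_field_derivative_transform_within_open[of _ _ _ "{0<..}"])
qed

section \<open>Pairing of step functions with continuous kernels\<close>

lemma interval_indicator_integral:
  fixes K k :: "real \<Rightarrow> real"
  assumes "0 \<le> l" "l \<le> r" "r \<le> t" and K: "\<And>x. (K has_real_derivative k x) (at x)"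
    and k: "continuous_on UNIV k"
  shows "set_integrable lebesgue {0..t} (\<lambda>s. indicator {l<..r} s * k s)"
    and "(LINT s:{0..t}|lebesgue. indicator {l<..r} s * k s) = K r - K l"
proof -
  have km[measurable]: "k \<in> borel_measurable borel" using k by (rule borel_measurable_continuous_onI)
  have h: "has_bochner_integral lborel (\<lambda>x. indicator {l..r} x *\<^sub>R k x) (K r - K l)"
    using assms by (intro has_bochner_integral_FTC_Icc)
      (auto intro: has_field_derivative_at_within continuous_on_subset simp flip: has_real_derivative_iff_has_vector_derivative)
  \<comment> \<open>The fundamental theorem speaks of the closed interval, which differs from the
    half-open one in the null set {l}.\<close>
  have "AE x in lborel. x \<noteq> l" by (rule AE_lborel_singleton)
  then have ae: "AE x in lborel. indicator {l..r} x *\<^sub>R k x = indicator {0..t} x *\<^sub>R (indicator {l<..r} x * k x)"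
    by eventually_elim (use assms in \<open>auto split: split_indicator\<close>)
  have "has_bochner_integral lborel (\<lambda>x. indicator {0..t} x *\<^sub>R (indicator {l<..r} x * k x)) (K r - K l)"
    using h by (subst (asm) has_bochner_integral_cong_AE[OF _ _ ae]) auto
  then have "has_bochner_integral lebesgue (\<lambda>x. indicator {0..t} x *\<^sub>R (indicator {l<..r} x * k x)) (K r - K l)"
    by (simp add: has_bochner_integral_iff integrable_completion integral_completion)
  then show "set_integrable lebesgue {0..t} (\<lambda>s. indicator {l<..r} s * k s)"
    "(LINT s:{0..t}|lebesgue. indicator {l<..r} s * k s) = K r - K l"
    by (auto simp: set_integrable_def set_lebesgue_integral_def integrable.simps has_bochner_integral_integral_eq)
qed

lemma step_fun_simps:
  "step_fun [] s = 0"
  "step_fun ((a, l, r) # xs) s = indicator {l<..r} s *\<^sub>R a + step_fun xs s"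
  by (auto simp: step_fun_def)

lemma step_fun_integral:
  fixes K k :: "real \<Rightarrow> real"
  assumes "step_list t xs" and K: "\<And>x. (K has_real_derivative k x) (at x)"
    and k: "continuous_on UNIV k"
  shows "set_integrable lebesgue {0..t} (\<lambda>s. step_fun xs s * k s)
    \<and> (LINT s:{0..t}|lebesgue. step_fun xs s * k s) = (\<Sum>(a, l, r)\<leftarrow>xs. a * (K r - K l))"
  using assms(1)
proof (induction xs)
  case Nil
  then show ?case by (simp add: step_fun_simps set_integrable_def set_lebesgue_integral_def)
next
  case (Cons x xs)
  obtain a l r where x: "x = (a, l, r)" by (cases x)
  have lr: "0 \<le> l" "l \<le> r" "r \<le> t" and xs: "step_list t xs" using Cons.prems by (auto simp: step_list_def x)
  note I = interval_indicator_integral[OF lr K k]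
  have "set_integrable lebesgue {0..t} (\<lambda>s. a * (indicator {l<..r} s * k s))"
    using I(1) by (intro set_integrable_mult_right)
  moreover have "step_fun (x # xs) s * k s = a * (indicator {l<..r} s * k s) + step_fun xs s * k s" for s
    by (simp add: x step_fun_simps algebra_simps)
  ultimately show ?case using Cons.IH[OF xs] I(2)
    by (simp add: x set_integral_add set_integral_mult_right)
qed

text \<open>A functional that pairs each interval with the increment of a function \<open>K\<close>
  is continuous in the L1 norm of the step function as soon as the derivative of \<open>K\<close> is
  bounded on [0, t]. This is the way in which L1 convergence is exploited.\<close>

lemma step_fun_pairing_bound:
  fixes K k :: "real \<Rightarrow> real"
  assumes xs: "step_list t xs" and K: "\<And>x. (K has_real_derivative k x) (at x)"
    and k: "continuous_on UNIV k" and C: "\<And>s. s \<in> {0..t} \<Longrightarrow> \<bar>k s\<bar> \<le> C"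
    and int: "set_integrable lebesgue {0..t} (step_fun xs)"
  shows "\<bar>\<Sum>(a, l, r)\<leftarrow>xs. a * (K r - K l)\<bar> \<le> C * (LINT s:{0..t}|lebesgue. \<bar>step_fun xs s\<bar>)"
proof -
  note I = step_fun_integral[OF xs K k]
  have "\<bar>\<Sum>(a, l, r)\<leftarrow>xs. a * (K r - K l)\<bar> = \<bar>LINT s:{0..t}|lebesgue. step_fun xs s * k s\<bar>"
    using I by simp
  also have "\<dots> \<le> (LINT s:{0..t}|lebesgue. \<bar>step_fun xs s * k s\<bar>)"
    using set_integral_norm_bound[of lebesgue "{0..t}" "\<lambda>s. step_fun xs s * k s"] I by simp
  also have "\<dots> \<le> (LINT s:{0..t}|lebesgue. C * \<bar>step_fun xs s\<bar>)"
  proof (rule set_integral_mono)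
    show "set_integrable lebesgue {0..t} (\<lambda>s. \<bar>step_fun xs s * k s\<bar>)"
      using I by (intro set_integrable_abs) simp
    show "set_integrable lebesgue {0..t} (\<lambda>s. C * \<bar>step_fun xs s\<bar>)"
      using int by (intro set_integrable_mult_right set_integrable_abs)
    fix s assume "s \<in> {0..t}"
    then have "\<bar>step_fun xs s\<bar> * \<bar>k s\<bar> \<le> \<bar>step_fun xs s\<bar> * C" by (intro mult_left_mono C) auto
    then show "\<bar>step_fun xs s * k s\<bar> \<le> C * \<bar>step_fun xs s\<bar>" by (simp add: abs_mult mult.commute)
  qed
  also have "\<dots> = C * (LINT s:{0..t}|lebesgue. \<bar>step_fun xs s\<bar>)" by (rule set_integral_mult_right)
  finally show ?thesis .
qed

lemma step_fun_set_integrable: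
  fixes xs :: "('e::{real_normed_vector,second_countable_topology} \<times> real \<times> real) list"
  shows "set_integrable lebesgue {0..t} (step_fun xs)"
  unfolding set_integrable_def
proof (induction xs)
  case (Cons x xs)
  obtain a l r where x: "x = (a, l, r)" by (cases x)
  have "integrable lborel (indicat_real ({0..t} \<inter> {l<..r}))"
  proof (rule integrable_real_indicator)
    have "emeasure lborel ({0..t} \<inter> {l<..r}) \<le> emeasure lborel {0..t}" by (intro emeasure_mono) auto
    then show "emeasure lborel ({0..t} \<inter> {l<..r}) < \<infinity>"
      using emeasure_lborel_cbox_finite[of 0 t] by (auto simp: cbox_interval)
  qed simp
  then have "integrable lebesgue (indicat_real ({0..t} \<inter> {l<..r}))" by (simp add: integrable_completion)
  then have "integrable lebesgue (\<lambda>s. indicat_real ({0..t} \<inter> {l<..r}) s *\<^sub>R a)"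
    by (intro integrable_scaleR_left)
  then have "integrable lebesgue (\<lambda>s. indicat_real {0..t} s *\<^sub>R indicat_real {l<..r} s *\<^sub>R a)"
    by (simp add: indicator_inter_arith)
  then show ?case using Cons
    by (simp add: x step_fun_simps scaleR_add_right)
qed (simp add: step_fun_simps)

lemma sum_list_diff_real:
  "(\<Sum>(a, l, r)\<leftarrow>xs. a * (f r - f l)) - (\<Sum>(a, l, r)\<leftarrow>xs. a * (g r - g l))
    = (\<Sum>(a, l, r)\<leftarrow>xs. a * ((f r - g r) - (f l - g l :: real)))"
  by (induction xs) (auto simp: algebra_simps)

text \<open>The vanishing primitive is differentiated within [0, d]; as d > 0 no point is isolated,
  so the derivative there is unique, also at the end points.\<close>

lemma integral_zero_imp_zero:
  fixes \<psi> :: "real \<Rightarrow> real"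
  assumes c: "continuous_on {0..d} \<psi>" and "0 < d" and z: "\<And>e. e \<in> {0..d} \<Longrightarrow> integral {0..e} \<psi> = 0"
    and s: "s \<in> {0..d}"
  shows "\<psi> s = 0"
proof -
  have "((\<lambda>e. integral {0..e} \<psi>) has_vector_derivative \<psi> s) (at s within {0..d})"
    using c s by (rule integral_has_vector_derivative)
  then have "((\<lambda>e. 0) has_vector_derivative \<psi> s) (at s within {0..d})"
    by (rule has_vector_derivative_transform[OF s, rotated]) (simp add: z)
  moreover have "((\<lambda>e. 0) has_vector_derivative 0) (at s within {0..d})" by simp
  moreover have "at s within {0..d} \<noteq> bot" using s \<open>0 < d\<close> by (simp add: trivial_limit_within islimpt_Icc)
  ultimately show ?thesis using vector_derivative_unique_within by blast
qed

section \<open>Closability of the scalar integral\<close>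

context fbm_space
begin

lemma step_integral_B_cov:
  fixes xs :: "(real \<times> real \<times> real) list"
  assumes "step_list t xs" "0 \<le> s"
  shows "(LINT \<omega>|M. step_integral B xs \<omega> * B s \<omega>) = (\<Sum>(a, l, r)\<leftarrow>xs. a * (fbm_cov H r s - fbm_cov H l s))"
  using assms(1)
proof (induction xs)
  case Nil then show ?case by (simp add: step_integral_simps)
next
  case (Cons x xs)
  obtain a l r where x: "x = (a, l, r)" by (cases x)
  have lr: "0 \<le> l" "0 \<le> r" and xs: "step_list t xs" using Cons.prems by (auto simp: step_list_def x)
  have i1: "integrable M (\<lambda>\<omega>. a * ((B r \<omega> - B l \<omega>) * B s \<omega>))"
    using lr assms(2) by (intro integrable_mult_right L2_mult_integrable incr_L2 B_L2)
  have i2: "integrable M (\<lambda>\<omega>. step_integral B xs \<omega> * B s \<omega>)"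
    using xs assms(2) by (intro L2_mult_integrable step_integral_L2 B_L2)
  have "(LINT \<omega>|M. step_integral B (x # xs) \<omega> * B s \<omega>)
      = (LINT \<omega>|M. a * ((B r \<omega> - B l \<omega>) * B s \<omega>) + step_integral B xs \<omega> * B s \<omega>)"
    by (simp add: x step_integral_simps algebra_simps)
  also have "\<dots> = a * (LINT \<omega>|M. (B r \<omega> - B l \<omega>) * B s \<omega>) + (LINT \<omega>|M. step_integral B xs \<omega> * B s \<omega>)"
    using i1 i2 by simp
  finally show ?case using Cons.IH[OF xs] incr_B_cov[OF lr assms(2)] by (simp add: x)
qed

text \<open>\<open>Z\<close> enters only through the function r \<mapsto> E(Z B_r). If that function
  vanishes on [0, t], then \<open>Z\<close> is orthogonal to all step integrals on [0, t].\<close>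

lemma inner_step_integral:
  fixes xs :: "(real \<times> real \<times> real) list"
  assumes "Z \<in> L2 M" "step_list t xs"
  shows "L2_inner M Z (step_integral B xs)
    = (\<Sum>(a, l, r)\<leftarrow>xs. a * ((LINT \<omega>|M. Z \<omega> * B r \<omega>) - (LINT \<omega>|M. Z \<omega> * B l \<omega>)))"
  using assms(2)
proof (induction xs)
  case Nil then show ?case by (simp add: step_integral_simps L2_inner_def)
next
  case (Cons x xs)
  obtain a l r where x: "x = (a, l, r)" by (cases x)
  have lr: "0 \<le> l" "0 \<le> r" and xs: "step_list t xs" using Cons.prems by (auto simp: step_list_def x)
  have "L2_inner M Z (\<lambda>\<omega>. a *\<^sub>R (B r \<omega> - B l \<omega>)) = a * ((LINT \<omega>|M. Z \<omega> * B r \<omega>) - (LINT \<omega>|M. Z \<omega> * B l \<omega>))"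
    using lr assms(1)
    by (simp add: L2_inner_simps incr_L2 B_L2 del: real_scaleR_def) (simp add: L2_inner_def)
  then show ?case
    using Cons.IH[OF xs] L2_inner_simps(4)[OF L2_scaleR[OF incr_L2[OF lr], of a] step_integral_L2[OF xs] assms(1)]
    by (simp add: x step_integral_simps mult.commute)
qed

text \<open>Closability. The covariance \<open>\<phi>(r) = E(Z B\<^sub>r)\<close> is a uniform limit of the covariances of the step
  integrals. Integrating \<open>\<phi>(x + s) - \<phi>(s)\<close> over \<open>s\<close> in \<open>[0, e]\<close> is pairing the integrands with a function
  that is bounded for every Hurst index, as the singular part of the covariance cancels. So \<open>L\<^sup>1\<close> convergence
  forces \<open>\<phi>\<close> to be constant, hence zero.\<close>

lemma step_integral_closable:
  fixes \<theta> :: "nat \<Rightarrow> (real \<times> real \<times> real) list"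
  assumes \<theta>: "\<And>n. step_list t (\<theta> n)" and Z: "Z \<in> L2 M"
    and lim: "(\<lambda>n. L2_norm M (\<lambda>\<omega>. step_integral B (\<theta> n) \<omega> - Z \<omega>)) \<longlonglongrightarrow> 0"
    and L1: "(\<lambda>n. LINT s:{0..t}|lebesgue. \<bar>step_fun (\<theta> n) s\<bar>) \<longlonglongrightarrow> 0"
  shows "AE \<omega> in M. Z \<omega> = 0"
proof -
  define \<phi> where "\<phi> s = (LINT \<omega>|M. Z \<omega> * B s \<omega>)" for s
  define \<phi>n where "\<phi>n n s = (\<Sum>(a, l, r)\<leftarrow>\<theta> n. a * (fbm_cov H r s - fbm_cov H l s))" for n s
  let ?e = "\<lambda>n. L2_norm M (\<lambda>\<omega>. step_integral B (\<theta> n) \<omega> - Z \<omega>)"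
  have I: "step_integral B (\<theta> n) \<in> L2 M" for n using \<theta> by (rule step_integral_L2)
  \<comment> \<open>Uniformity in s comes from the norm of \<open>B s\<close>, which is s to the
    power H and hence at most \<open>t powr H\<close>.\<close>
  have close: "\<bar>\<phi>n n s - \<phi> s\<bar> \<le> ?e n * t powr H" if "s \<in> {0..t}" for n s
  proof -
    have s: "0 \<le> s" "s \<le> t" using that by auto
    have "\<phi>n n s - \<phi> s = L2_inner M (\<lambda>\<omega>. step_integral B (\<theta> n) \<omega> - Z \<omega>) (B s)"
      unfolding \<phi>n_def \<phi>_def step_integral_B_cov[OF \<theta> s(1), symmetric] L2_inner_def
      using I Z s by (simp add: left_diff_distrib L2_mult_integrable B_L2)
    then have "\<bar>\<phi>n n s - \<phi> s\<bar> \<le> ?e n * L2_norm M (B s)"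
      using L2_inner_bound[OF L2_diff[OF I Z] B_L2[OF s(1)], of n] by simp
    also have "L2_norm M (B s) = sqrt (s powr (2 * H))"
      using B_cov[OF s(1) s(1)] s by (simp add: L2_norm_def power2_eq_square fbm_cov_def)
    also have "\<dots> = s powr H" using s by (simp add: powr_half_sqrt[symmetric] powr_powr)
    also have "?e n * \<dots> \<le> ?e n * t powr H" using s H by (intro mult_left_mono powr_mono2) auto
    finally show ?thesis .
  qed
  have e0: "(\<lambda>n. ?e n * t powr H) \<longlonglongrightarrow> 0" using tendsto_mult_left_zero[OF lim] by simp
  have unif: "uniform_limit {0..t} \<phi>n \<phi> sequentially"
    unfolding uniform_limit_iff
  proof (intro allI impI)
    fix \<epsilon> :: real assume "0 < \<epsilon>"
    from order_tendstoD(2)[OF e0 this]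
    show "\<forall>\<^sub>F n in sequentially. \<forall>x\<in>{0..t}. dist (\<phi>n n x) (\<phi> x) < \<epsilon>"
    proof eventually_elim
      case (elim n)
      then show ?case
        unfolding dist_real_def by (blast intro: le_less_trans[OF close])
    qed
  qed
  have p: "0 < 2 * H" using H by simp
  have cov_cont: "continuous_on S (\<lambda>s. fbm_cov H r s)" if "S \<subseteq> {0..}" for S r
  proof -
    have "continuous_on S (\<lambda>s. s powr (2 * H))"
      using that p by (intro continuous_on_powr' continuous_intros) auto
    then show ?thesis unfolding fbm_cov_def
      using p by (intro continuous_on_divide continuous_on_diff continuous_on_add continuous_on_const
          continuous_abs_powr continuous_on_id) auto
  qed
  have \<phi>n_cont: "continuous_on {0..t} (\<phi>n n)" for n
  proof -
    have "continuous_on {0..t} (\<lambda>s. \<Sum>(a, l, r)\<leftarrow>xs. a * (fbm_cov H r s - fbm_cov H l s))" for xs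
      by (induction xs) (auto intro!: continuous_intros cov_cont)
    then show ?thesis by (simp add: \<phi>n_def[abs_def])
  qed
  have \<phi>_cont: "continuous_on {0..t} \<phi>"
    using uniform_limit_theorem[OF _ unif] \<phi>n_cont by simp
  have \<phi>0: "\<phi> 0 = 0"
  proof -
    have "AE \<omega> in M. B 0 \<omega> = 0" using fbm by (simp add: fractional_brownian_motion_def)
    then have "AE \<omega> in M. Z \<omega> * B 0 \<omega> = 0" by eventually_elim simp
    then show ?thesis unfolding \<phi>_def by (rule integral_eq_zero_AE)
  qed
  have shift: "\<phi> (x + s) = \<phi> s" if x: "0 \<le> x" "0 < d" "x + d \<le> t" and s: "s \<in> {0..d}" for x d s
  proof -
    let ?\<psi> = "\<lambda>s. \<phi> (x + s) - \<phi> s" and ?\<psi>n = "\<lambda>n s. \<phi>n n (x + s) - \<phi>n n s"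
    have shift_cont: "continuous_on {0..d} (\<lambda>s. f (x + s) - f s)" if "continuous_on {0..t} f" for f :: "real \<Rightarrow> real"
    proof (rule continuous_on_diff)
      show "continuous_on {0..d} (\<lambda>s. f (x + s))"
        using x by (intro continuous_on_compose2[OF that] continuous_intros) auto
      show "continuous_on {0..d} f" using x by (intro continuous_on_subset[OF that]) auto
    qed
    have "integral {0..e} ?\<psi> = 0" if e: "e \<in> {0..d}" for e
    proof -
      let ?P = "powr_prim (2 * H)"
      \<comment> \<open>\<open>K y\<close> is the integral over s in [0, e] of the part of
        \<open>fbm_cov H y (x + s) - fbm_cov H y s\<close> that depends on y. The shift by x removes
        \<open>y powr (2*H)\<close>, whose derivative is unbounded near 0 for H < 1/2. For the
        remaining terms, integration over s and differentiation in y offset each other, so the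
        derivative \<open>k\<close> contains only powers with exponent 2H and is continuous.\<close>
      define K where "K y = (- ?P (y - e) + ?P (y - x - e) + ?P y - ?P (y - x)) / 2" for y
      define k where "k y = (- (\<bar>y - e\<bar> powr (2*H)) + \<bar>y - x - e\<bar> powr (2*H) + \<bar>y\<bar> powr (2*H)
          - \<bar>y - x\<bar> powr (2*H)) / 2" for y
      have PD: "(?P has_real_derivative \<bar>z\<bar> powr (2*H)) (at z)" for z by (rule powr_prim_deriv[OF p])
      have P1: "((\<lambda>y. ?P (y - c)) has_real_derivative \<bar>y - c\<bar> powr (2*H)) (at y)" for y c
      proof -
        have "((\<lambda>y. y - c) has_real_derivative 1) (at y)" by (auto intro!: derivative_eq_intros)
        from DERIV_chain2[where f="?P" and g="\<lambda>y. y - c" and x=y, OF PD this] show ?thesis by simp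
      qed
      have K: "(K has_real_derivative k y) (at y)" for y
      proof -
        have "((\<lambda>y. (- ?P (y - e) + ?P (y - (x + e)) + ?P y - ?P (y - x)) / 2) has_real_derivative
            (- (\<bar>y - e\<bar> powr (2*H)) + \<bar>y - (x + e)\<bar> powr (2*H) + \<bar>y\<bar> powr (2*H) - \<bar>y - x\<bar> powr (2*H)) / 2) (at y)"
          by (intro DERIV_cdivide DERIV_diff DERIV_add DERIV_minus P1 PD)
        then show ?thesis by (simp add: K_def[abs_def] k_def diff_diff_eq)
      qed
      have kc: "continuous_on S k" for S
        unfolding k_def by (intro continuous_on_divide continuous_on_diff continuous_on_add
            continuous_on_minus continuous_on_const continuous_abs_powr continuous_on_id p) auto
      obtain C where C: "\<And>s. s \<in> {0..t} \<Longrightarrow> \<bar>k s\<bar> \<le> C"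
        using continuous_on_Icc_norm_bounded[OF kc[of "{0..t}"]] unfolding real_norm_def by blast
      have pair: "integral {0..e} (?\<psi>n n) = (\<Sum>(a, l, r)\<leftarrow>\<theta> n. a * (K r - K l))" for n
      proof -
        \<comment> \<open>The subtracted term does not depend on y, so it drops out when the values
          at the two ends of an interval are subtracted.\<close>
        have S: "((\<lambda>s. fbm_cov H y (x + s) - fbm_cov H y s - ((x + s) powr (2*H) - s powr (2*H)) / 2)
            has_integral K y) {0..e}" for y
        proof -
          let ?Q = "\<lambda>s. (- ?P (s - y) + ?P (s - (y - x))) / 2"
          have "((\<lambda>s. (\<bar>s - y\<bar> powr (2*H) - \<bar>s - (y - x)\<bar> powr (2*H)) / 2) has_integral
              (- ?Q e) - (- ?Q 0)) {0..e}"
          proof (rule fundamental_theorem_of_calculus)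
            fix s
            have "((\<lambda>s. - ?Q s) has_real_derivative - ((- (\<bar>s - y\<bar> powr (2*H)) + \<bar>s - (y - x)\<bar> powr (2*H)) / 2)) (at s)"
              by (intro DERIV_cdivide DERIV_diff DERIV_add DERIV_minus P1 PD)
            then have "((\<lambda>s. - ?Q s) has_real_derivative (\<bar>s - y\<bar> powr (2*H) - \<bar>s - (y - x)\<bar> powr (2*H)) / 2) (at s within {0..e})"
              by (rule has_field_derivative_at_within[OF DERIV_cong]) (simp add: field_simps)
            then show "((\<lambda>s. - ?Q s) has_vector_derivative (\<bar>s - y\<bar> powr (2*H) - \<bar>s - (y - x)\<bar> powr (2*H)) / 2) (at s within {0..e})"
              by (simp add: has_real_derivative_iff_has_vector_derivative)
          qed (use e in auto)
          moreover have "(- ?Q e) - (- ?Q 0) = K y"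
          proof -
            have odd: "?P (- z) = - ?P z" for z by (simp add: powr_prim_def)
            show ?thesis using odd[of "y - e"] odd[of "y - x - e"] odd[of y] odd[of "y - x"]
              by (simp add: K_def algebra_simps) (simp add: field_simps)
          qed
          moreover have "fbm_cov H y (x + s) - fbm_cov H y s - ((x + s) powr (2*H) - s powr (2*H)) / 2
              = (\<bar>s - y\<bar> powr (2*H) - \<bar>s - (y - x)\<bar> powr (2*H)) / 2" for s
          proof -
            have "\<bar>y - (x + s)\<bar> = \<bar>s - (y - x)\<bar>" "\<bar>y - s\<bar> = \<bar>s - y\<bar>" by auto
            then show ?thesis by (simp add: fbm_cov_def field_simps)
          qed
          ultimately show ?thesis by (simp only:)
        qed
        have D: "((\<lambda>s. (fbm_cov H r (x + s) - fbm_cov H r s) - (fbm_cov H l (x + s) - fbm_cov H l s))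
            has_integral (K r - K l)) {0..e}" for l r
          by (rule has_integral_eq[OF _ has_integral_diff[OF S[of r] S[of l]]]) simp
        have "((\<lambda>s. \<Sum>(a, l, r)\<leftarrow>xs. a * ((fbm_cov H r (x + s) - fbm_cov H r s) - (fbm_cov H l (x + s) - fbm_cov H l s)))
            has_integral (\<Sum>(a, l, r)\<leftarrow>xs. a * (K r - K l))) {0..e}" for xs
          by (induction xs) (auto intro!: has_integral_add has_integral_mult_right D)
        then show ?thesis
          unfolding \<phi>n_def sum_list_diff_real by (rule integral_unique)
      qed
      have "(\<lambda>n. integral {0..e} (?\<psi>n n)) \<longlonglongrightarrow> 0"
      proof (rule Lim_null_comparison)
        show "\<forall>\<^sub>F n in sequentially. norm (integral {0..e} (?\<psi>n n))
            \<le> C * (LINT s:{0..t}|lebesgue. \<bar>step_fun (\<theta> n) s\<bar>)"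
          unfolding pair real_norm_def
          by (intro always_eventually allI step_fun_pairing_bound[OF \<theta> K kc C step_fun_set_integrable])
        show "(\<lambda>n. C * (LINT s:{0..t}|lebesgue. \<bar>step_fun (\<theta> n) s\<bar>)) \<longlonglongrightarrow> 0"
          using tendsto_mult_right_zero[OF L1] by simp
      qed
      moreover have "(\<lambda>n. integral {0..e} (?\<psi>n n)) \<longlonglongrightarrow> integral {0..e} ?\<psi>"
      proof (rule LIM_zero_cancel, rule Lim_null_comparison)
        have "norm (integral {0..e} (?\<psi>n n) - integral {0..e} ?\<psi>) \<le> (?e n * t powr H * 2) * e" for n
        proof -
          have c1: "continuous_on {0..e} (?\<psi>n n)" and c2: "continuous_on {0..e} ?\<psi>"
            using shift_cont[OF \<phi>n_cont[of n]] shift_cont[OF \<phi>_cont] e by (auto elim: continuous_on_subset)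
          have "integral {0..e} (?\<psi>n n) - integral {0..e} ?\<psi> = integral {0..e} (\<lambda>s. ?\<psi>n n s - ?\<psi> s)"
            using c1 c2 by (intro integral_diff[symmetric] integrable_continuous_real)
          also have "norm \<dots> \<le> (?e n * t powr H * 2) * (e - 0)"
          proof (rule integral_bound)
            show "norm (?\<psi>n n s - ?\<psi> s) \<le> ?e n * t powr H * 2" if "s \<in> {0..e}" for s
              using close[of "x + s" n] close[of s n] that e x by auto
          qed (use e c1 c2 in \<open>auto intro: continuous_on_diff\<close>)
          finally show ?thesis by simp
        qed
        then show "\<forall>\<^sub>F n in sequentially. norm (integral {0..e} (?\<psi>n n) - integral {0..e} ?\<psi>)
            \<le> (?e n * t powr H * 2) * e" by simp
        show "(\<lambda>n. (?e n * t powr H * 2) * e) \<longlonglongrightarrow> 0"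
          using tendsto_mult_left_zero[OF tendsto_mult_left_zero[OF e0, of 2], of e] by simp
      qed
      ultimately show ?thesis using LIMSEQ_unique by blast
    qed
    then have "?\<psi> s = 0"
      using integral_zero_imp_zero[OF shift_cont[OF \<phi>_cont] x(2) _ s] by blast
    then show ?thesis by simp
  qed
  have \<phi>_zero: "\<phi> u = 0" if "u \<in> {0..t}" for u
  proof (cases "u = 0")
    case False
    \<comment> \<open>Two shifts by u/2 lead from u to u/2 and from u/2 to 0. Both use x = d = u/2,
      which is admissible because x + d = u \<le> t.\<close>
    then show ?thesis using shift[of "u/2" "u/2" "u/2"] shift[of "u/2" "u/2" 0] that \<phi>0 by auto
  qed (simp add: \<phi>0)
  have orth: "L2_inner M Z (step_integral B (\<theta> n)) = 0" for n
  proof -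
    have "step_list t xs \<Longrightarrow> (\<Sum>(a, l, r)\<leftarrow>xs. a * (\<phi> r - \<phi> l)) = 0" for xs
    proof (induction xs)
      case (Cons x xs)
      then show ?case by (cases x) (auto simp: step_list_def \<phi>_zero)
    qed simp
    then show ?thesis using \<theta> unfolding inner_step_integral[OF Z \<theta>] \<phi>_def by blast
  qed
  \<comment> \<open>\<open>Z\<close> is orthogonal to each of the step integrals that converge to
    it, so its squared norm is minus its inner product with the error.\<close>
  have "(L2_norm M Z)\<^sup>2 \<le> L2_norm M Z * ?e n" for n
  proof -
    have "(L2_norm M Z)\<^sup>2 = L2_inner M Z Z" by (simp only: L2_norm_power2 L2_inner_def power2_norm_eq_inner)
    also have "\<dots> = - L2_inner M Z (\<lambda>\<omega>. step_integral B (\<theta> n) \<omega> - Z \<omega>)"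
      using orth[of n] I[of n] Z by (simp add: L2_inner_simps)
    also have "\<dots> \<le> L2_norm M Z * ?e n"
      using L2_inner_bound[OF Z L2_diff[OF I Z], of n] by linarith
    finally show ?thesis .
  qed
  moreover have "(\<lambda>n. L2_norm M Z * ?e n) \<longlonglongrightarrow> 0" using tendsto_mult_right_zero[OF lim] by simp
  ultimately have "(L2_norm M Z)\<^sup>2 \<le> 0" by (intro LIMSEQ_le_const) auto
  then have "L2_norm M Z = 0" by simp
  with Z show ?thesis by (rule L2_norm_eq_0_AE)
qed

end

text \<open>A countable dense set of vectors e shares one null set. Off that set
  \<open>Z \<omega>\<close> is orthogonal to a dense set, and by Pythagoras no vector orthogonal to
  a nonzero \<open>Z \<omega>\<close> lies closer to it than 0 does.\<close>

lemma AE_zero_of_inner: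
  fixes Z :: "'o \<Rightarrow> 'e::{real_inner,second_countable_topology}"
  assumes "\<And>e. AE \<omega> in M. Z \<omega> \<bullet> e = 0" shows "AE \<omega> in M. Z \<omega> = 0"
proof -
  obtain D :: "'e set" where D: "countable D" "\<And>X. open X \<Longrightarrow> X \<noteq> {} \<Longrightarrow> \<exists>d\<in>D. d \<in> X"
    using countable_dense_exists by blast
  have "AE \<omega> in M. \<forall>e\<in>D. Z \<omega> \<bullet> e = 0" using D(1) assms by (subst AE_ball_countable) auto
  then show ?thesis
  proof eventually_elim
    case (elim \<omega>)
    show ?case
    proof (rule ccontr)
      assume "Z \<omega> \<noteq> 0"
      then obtain d where d: "d \<in> D" "d \<in> ball (Z \<omega>) (norm (Z \<omega>))" using D(2)[of "ball (Z \<omega>) (norm (Z \<omega>))"] by auto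
      have "(norm (Z \<omega> - d))\<^sup>2 = (norm (Z \<omega>))\<^sup>2 + (norm d)\<^sup>2"
        using elim d(1) by (simp add: power2_norm_eq_inner inner_diff inner_commute)
      moreover have "(norm (Z \<omega> - d))\<^sup>2 < (norm (Z \<omega>))\<^sup>2"
        using d(2) by (intro power_strict_mono) (auto simp: dist_norm)
      ultimately show False by (smt (verit) zero_le_power2)
    qed
  qed
qed

section \<open>Uniqueness for Hilbert-space-valued integrands\<close>

context fbm_space
begin

text \<open>Both sequences of step functions tend to the same f in L1, so their difference tends to
  0 in L1 while its integrals tend to W - W'. Taking the inner product with a fixed vector makes
  this a case of scalar closability.\<close>

lemma wiener_integral_unique:
  fixes f :: "real \<Rightarrow> 'e::{real_inner,polish_space}"
  assumes "has_wiener_integral M H B t f W" "has_wiener_integral M H B t f W'"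
  shows "AE \<omega> in M. W \<omega> = W' \<omega>"
proof -
  obtain \<Psi> where \<Psi>: "H0_represents H t \<Psi> f" "(\<lambda>n. L2_norm M (\<lambda>\<omega>. step_integral B (\<Psi> n) \<omega> - W \<omega>)) \<longlonglongrightarrow> 0"
    and W: "W \<in> L2 M" using assms(1) by (auto simp: has_wiener_integral_def)
  obtain \<Psi>' where \<Psi>': "H0_represents H t \<Psi>' f" "(\<lambda>n. L2_norm M (\<lambda>\<omega>. step_integral B (\<Psi>' n) \<omega> - W' \<omega>)) \<longlonglongrightarrow> 0"
    and W': "W' \<in> L2 M" using assms(2) by (auto simp: has_wiener_integral_def)
  have sl: "step_list t (\<Psi> n)" "step_list t (\<Psi>' n)" for n using \<Psi> \<Psi>' by (auto simp: H0_represents_def)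
  note f = \<Psi>(1)[unfolded H0_represents_def] \<Psi>'(1)[unfolded H0_represents_def]
  have "AE \<omega> in M. (W \<omega> - W' \<omega>) \<bullet> e = 0" for e
  proof (rule step_integral_closable)
    \<comment> \<open>Step functions and step integrals are additive under concatenation of lists,
      so a difference is coded by appending the second list with negated values.\<close>
    define \<theta> where "\<theta> n = map (\<lambda>(a, l, r). (a \<bullet> e, l, r)) (\<Psi> n) @ map (\<lambda>(a, l, r). (- (a \<bullet> e), l, r)) (\<Psi>' n)" for n
    have I: "step_integral B (\<theta> n) \<omega> = (step_integral B (\<Psi> n) \<omega> - step_integral B (\<Psi>' n) \<omega>) \<bullet> e" for n \<omega>
    proof -
      have "step_integral B (map (\<lambda>(a, l, r). (c * (a \<bullet> e), l, r)) xs) \<omega> = c * (step_integral B xs \<omega> \<bullet> e)" for xs and c :: real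
        by (induction xs) (auto simp: step_integral_simps inner_simps algebra_simps)
      from this[of 1] this[of "-1"] show ?thesis
        by (simp add: \<theta>_def step_integral_def inner_simps)
    qed
    have F: "step_fun (\<theta> n) s = (step_fun (\<Psi> n) s - step_fun (\<Psi>' n) s) \<bullet> e" for n s
    proof -
      have "step_fun (map (\<lambda>(a, l, r). (c * (a \<bullet> e), l, r)) xs) s = c * (step_fun xs s \<bullet> e)" for xs and c :: real
        by (induction xs) (auto simp: step_fun_simps inner_simps algebra_simps)
      from this[of 1] this[of "-1"] show ?thesis
        by (simp add: \<theta>_def step_fun_def inner_simps)
    qed
    show \<theta>: "step_list t (\<theta> n)" for n using sl[of n] by (auto simp: \<theta>_def step_list_def)
    show "(\<lambda>\<omega>. (W \<omega> - W' \<omega>) \<bullet> e) \<in> L2 M"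
    proof (rule L2_bound)
      show "integrable M (\<lambda>\<omega>. (norm e)\<^sup>2 * (norm (W \<omega> - W' \<omega>))\<^sup>2)" using L2_D(2)[OF L2_diff[OF W W']] by simp
      show "(\<lambda>\<omega>. (W \<omega> - W' \<omega>) \<bullet> e) \<in> borel_measurable M"
        using L2_D(1)[OF L2_diff[OF W W']] by (intro borel_measurable_inner) auto
      show "AE \<omega> in M. (norm ((W \<omega> - W' \<omega>) \<bullet> e))\<^sup>2 \<le> (norm e)\<^sup>2 * (norm (W \<omega> - W' \<omega>))\<^sup>2"
        unfolding power_mult_distrib[symmetric]
        by (intro AE_I2 power_mono) (auto intro: order_trans[OF Cauchy_Schwarz_ineq2] simp: mult.commute)
    qed
    show "(\<lambda>n. L2_norm M (\<lambda>\<omega>. step_integral B (\<theta> n) \<omega> - (W \<omega> - W' \<omega>) \<bullet> e)) \<longlonglongrightarrow> 0"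
    proof (rule Lim_null_comparison)
      let ?a = "\<lambda>n \<omega>. step_integral B (\<Psi> n) \<omega> - W \<omega>" and ?b = "\<lambda>n \<omega>. step_integral B (\<Psi>' n) \<omega> - W' \<omega>"
      have ab: "?a n \<in> L2 M" "?b n \<in> L2 M" for n using sl W W' by (auto intro: L2_diff step_integral_L2)
      have "L2_norm M (\<lambda>\<omega>. step_integral B (\<theta> n) \<omega> - (W \<omega> - W' \<omega>) \<bullet> e)
          \<le> norm e * (L2_norm M (?a n) + L2_norm M (?b n))" for n
      proof -
        have "L2_norm M (\<lambda>\<omega>. step_integral B (\<theta> n) \<omega> - (W \<omega> - W' \<omega>) \<bullet> e)
            \<le> L2_norm M (\<lambda>\<omega>. norm e *\<^sub>R (?a n \<omega> - ?b n \<omega>))"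
          unfolding L2_norm_def
        proof (intro real_sqrt_le_mono integral_mono_AE' AE_I2)
          show "integrable M (\<lambda>\<omega>. (norm (norm e *\<^sub>R (?a n \<omega> - ?b n \<omega>)))\<^sup>2)"
            by (intro L2_D(2) L2_scaleR L2_diff ab)
          fix \<omega>
          have "step_integral B (\<theta> n) \<omega> - (W \<omega> - W' \<omega>) \<bullet> e = (?a n \<omega> - ?b n \<omega>) \<bullet> e"
            by (simp add: I inner_simps)
          then show "(norm (step_integral B (\<theta> n) \<omega> - (W \<omega> - W' \<omega>) \<bullet> e))\<^sup>2 \<le> (norm (norm e *\<^sub>R (?a n \<omega> - ?b n \<omega>)))\<^sup>2"
            by (intro power_mono) (auto intro: order_trans[OF Cauchy_Schwarz_ineq2] simp: mult.commute)
        qed auto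
        also have "\<dots> = norm e * L2_norm M (\<lambda>\<omega>. ?a n \<omega> - ?b n \<omega>)"
          by (simp add: L2_norm_def power_mult_distrib real_sqrt_mult)
        also have "\<dots> \<le> norm e * (L2_norm M (?a n) + L2_norm M (?b n))"
          by (intro mult_left_mono L2_norm_diff_le ab) auto
        finally show ?thesis .
      qed
      then show "\<forall>\<^sub>F n in sequentially. norm (L2_norm M (\<lambda>\<omega>. step_integral B (\<theta> n) \<omega> - (W \<omega> - W' \<omega>) \<bullet> e))
          \<le> norm e * (L2_norm M (?a n) + L2_norm M (?b n))" by simp
      show "(\<lambda>n. norm e * (L2_norm M (?a n) + L2_norm M (?b n))) \<longlonglongrightarrow> 0"
        using tendsto_mult_right_zero[OF tendsto_add_zero[OF \<Psi>(2) \<Psi>'(2)]] by simp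
    qed
    let ?A = "\<lambda>n s. norm (step_fun (\<Psi> n) s - f s)" and ?B = "\<lambda>n s. norm (step_fun (\<Psi>' n) s - f s)"
    have si: "set_integrable lebesgue {0..t} (\<lambda>s. norm (step_fun xs s - f s))" for xs
    proof -
      have "set_integrable lebesgue {0..t} f" using f by blast
      then have "integrable lebesgue (\<lambda>s. norm (indicator {0..t} s *\<^sub>R step_fun xs s - indicator {0..t} s *\<^sub>R f s))"
        using step_fun_set_integrable[of t xs] unfolding set_integrable_def
        by (intro integrable_norm_of Bochner_Integration.integrable_diff)
      then show ?thesis unfolding set_integrable_def
        by (rule Bochner_Integration.integrable_cong[THEN iffD1, rotated -1]) (auto split: split_indicator)
    qed
    show "(\<lambda>n. LINT s:{0..t}|lebesgue. \<bar>step_fun (\<theta> n) s\<bar>) \<longlonglongrightarrow> 0"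
    proof (rule Lim_null_comparison)
      have "norm (LINT s:{0..t}|lebesgue. \<bar>step_fun (\<theta> n) s\<bar>)
          \<le> norm e * ((LINT s:{0..t}|lebesgue. ?A n s) + (LINT s:{0..t}|lebesgue. ?B n s))" for n
      proof -
        have "norm (LINT s:{0..t}|lebesgue. \<bar>step_fun (\<theta> n) s\<bar>) = (LINT s:{0..t}|lebesgue. \<bar>step_fun (\<theta> n) s\<bar>)"
          unfolding set_lebesgue_integral_def real_norm_def
          by (intro abs_of_nonneg integral_nonneg_AE) auto
        also have "\<dots> \<le> (LINT s:{0..t}|lebesgue. norm e * (?A n s + ?B n s))"
        proof (rule set_integral_mono)
          fix s assume "s \<in> {0..t}"
          have "\<bar>step_fun (\<theta> n) s\<bar> \<le> norm (step_fun (\<Psi> n) s - step_fun (\<Psi>' n) s) * norm e"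
            unfolding F by (rule Cauchy_Schwarz_ineq2)
          also have "\<dots> \<le> (?A n s + ?B n s) * norm e"
            using norm_triangle_ineq4[of "step_fun (\<Psi> n) s - f s" "step_fun (\<Psi>' n) s - f s"]
            by (intro mult_right_mono) auto
          finally show "\<bar>step_fun (\<theta> n) s\<bar> \<le> norm e * (?A n s + ?B n s)" by (simp add: mult.commute)
        qed (intro set_integrable_abs step_fun_set_integrable set_integrable_mult_right set_integral_add si)+
        also have "\<dots> = norm e * ((LINT s:{0..t}|lebesgue. ?A n s) + (LINT s:{0..t}|lebesgue. ?B n s))"
          using si by (simp add: set_integral_add)
        finally show ?thesis .
      qed
      then show "\<forall>\<^sub>F n in sequentially. norm (LINT s:{0..t}|lebesgue. \<bar>step_fun (\<theta> n) s\<bar>)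
          \<le> norm e * ((LINT s:{0..t}|lebesgue. ?A n s) + (LINT s:{0..t}|lebesgue. ?B n s))" by simp
      have "(\<lambda>n. LINT s:{0..t}|lebesgue. ?A n s) \<longlonglongrightarrow> 0" "(\<lambda>n. LINT s:{0..t}|lebesgue. ?B n s) \<longlonglongrightarrow> 0"
        using f by blast+
      from tendsto_mult_right_zero[OF tendsto_add_zero[OF this]]
      show "(\<lambda>n. norm e * ((LINT s:{0..t}|lebesgue. ?A n s) + (LINT s:{0..t}|lebesgue. ?B n s))) \<longlonglongrightarrow> 0" .
    qed
  qed
  then have "AE \<omega> in M. W \<omega> - W' \<omega> = 0" by (rule AE_zero_of_inner)
  then show ?thesis by eventually_elim simp
qed

end

section \<open>The semigroup and the domain of its generator\<close>

text \<open>A generator provides right derivatives only, which excludes the usual mean value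
  theorem. Instead the last point s is taken at which the bound from u holds with slope L +
  \<epsilon>; if s < v, the right derivative at s carries the bound past s.\<close>

lemma lipschitz_of_right_derivative:
  fixes F :: "real \<Rightarrow> 'e::real_normed_vector"
  assumes c: "continuous_on {u..v} F" and "u \<le> v"
    and d: "\<And>s. s \<in> {u..<v} \<Longrightarrow> \<exists>y. ((\<lambda>h. (F (s + h) - F s) /\<^sub>R h) \<longlongrightarrow> y) (at_right 0) \<and> norm y \<le> L"
  shows "norm (F v - F u) \<le> L * (v - u)"
proof (rule ccontr)
  assume "\<not> ?thesis"
  then have n: "norm (F v - F u) > L * (v - u)" by simp
  with \<open>u \<le> v\<close> have "u < v" by (cases "u = v") auto
  \<comment> \<open>With this \<epsilon> the slope L + \<epsilon> is the mean of L and the supposed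
    average slope over [u, v], so the bound fails at v and the slack is still positive.\<close>
  define \<epsilon> where "\<epsilon> = (norm (F v - F u) - L * (v - u)) / (2 * (v - u))"
  have \<epsilon>: "0 < \<epsilon>" using n \<open>u < v\<close> by (simp add: \<epsilon>_def)
  have "(L + \<epsilon>) * (v - u) = (norm (F v - F u) + L * (v - u)) / 2"
    using \<open>u < v\<close> by (simp add: \<epsilon>_def field_simps)
  then have v: "(L + \<epsilon>) * (v - u) < norm (F v - F u)" using n by simp
  let ?A = "{x \<in> {u..v}. norm (F x - F u) \<le> (L + \<epsilon>) * (x - u)}"
  have "closed ?A"
    by (intro continuous_on_closed_Collect_le continuous_intros c closed_atLeastAtMost)
  moreover have "bounded ?A" by (rule bounded_subset[OF bounded_closed_interval[of u v]]) auto
  ultimately have "compact ?A" by (simp add: compact_eq_bounded_closed)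
  moreover have "u \<in> ?A" using \<open>u \<le> v\<close> by simp
  ultimately obtain s where s: "s \<in> ?A" "\<And>x. x \<in> ?A \<Longrightarrow> x \<le> s"
    using compact_attains_sup[of ?A] by blast
  have "s \<noteq> v" using s(1) v by auto
  then have sv: "s \<in> {u..<v}" using s(1) by auto
  obtain y where y: "((\<lambda>h. (F (s + h) - F s) /\<^sub>R h) \<longlongrightarrow> y) (at_right 0)" "norm y \<le> L" using d[OF sv] by blast
  have "((\<lambda>h. norm ((F (s + h) - F s) /\<^sub>R h)) \<longlongrightarrow> norm y) (at_right 0)" using y(1) by (rule tendsto_norm)
  then have "\<forall>\<^sub>F h in at_right 0. norm ((F (s + h) - F s) /\<^sub>R h) < L + \<epsilon>"
    by (rule order_tendstoD) (use y \<epsilon> in simp)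
  then obtain b where b: "0 < b" "\<And>h. 0 < h \<Longrightarrow> h < b \<Longrightarrow> norm ((F (s + h) - F s) /\<^sub>R h) < L + \<epsilon>"
    by (auto simp: eventually_at_right_field)
  define h where "h = min (b / 2) (v - s)"
  have h: "0 < h" "h < b" "s + h \<le> v" using b(1) sv by (auto simp: h_def)
  have "norm (F (s + h) - F s) / h < L + \<epsilon>" using b(2)[OF h(1,2)] h(1) by (simp add: divide_inverse mult.commute)
  then have "norm (F (s + h) - F s) \<le> (L + \<epsilon>) * h" using h(1) by (simp add: field_simps)
  moreover have "norm (F s - F u) \<le> (L + \<epsilon>) * (s - u)" using s(1) by simp
  moreover have "norm (F (s + h) - F u) \<le> norm (F (s + h) - F s) + norm (F s - F u)"
    by (metis norm_triangle_ineq diff_add_cancel add_diff_eq)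
  ultimately have "norm (F (s + h) - F u) \<le> (L + \<epsilon>) * (s + h - u)" by (simp add: algebra_simps)
  then have "s + h \<in> ?A" using h sv by auto
  then show False using s(2) h(1) by fastforce
qed

lemma semigroup_orbit_bounded:
  assumes "C0_semigroup S"
  obtains C where "0 \<le> C" "\<And>u. u \<in> {0..T} \<Longrightarrow> norm (blinfun_apply (S u) z) \<le> C"
proof -
  have "continuous_on {0..T} (\<lambda>t. blinfun_apply (S t) z)"
    using assms by (auto simp: C0_semigroup_def intro: continuous_on_subset)
  then show thesis using that by (rule continuous_on_Icc_norm_bounded)
qed

text \<open>The right derivative of the orbit of \<open>z\<close> at s is \<open>S s\<close> applied
  to \<open>y\<close>, by the semigroup law; the orbit of \<open>y\<close> is continuous and hence
  bounded on [0, T].\<close>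

lemma semigroup_orbit_lipschitz:
  assumes S: "C0_semigroup S" and zy: "(z, y) \<in> generator S"
  obtains L where "0 \<le> L"
    "\<And>u v. u \<in> {0..T} \<Longrightarrow> v \<in> {0..T} \<Longrightarrow> norm (blinfun_apply (S u) z - blinfun_apply (S v) z) \<le> L * \<bar>u - v\<bar>"
proof -
  obtain L where L: "0 \<le> L" "\<And>u. u \<in> {0..T} \<Longrightarrow> norm (blinfun_apply (S u) y) \<le> L"
    using semigroup_orbit_bounded[OF S] by metis
  have le: "norm (blinfun_apply (S v) z - blinfun_apply (S u) z) \<le> L * (v - u)" if "0 \<le> u" "u \<le> v" "v \<le> T" for u v
  proof (rule lipschitz_of_right_derivative)
    show "continuous_on {u..v} (\<lambda>t. blinfun_apply (S t) z)"
      using S that by (auto simp: C0_semigroup_def intro: continuous_on_subset)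
    fix s assume s: "s \<in> {u..<v}"
    have "((\<lambda>h. blinfun_apply (S s) ((blinfun_apply (S h) z - z) /\<^sub>R h)) \<longlongrightarrow> blinfun_apply (S s) y) (at_right 0)"
      using zy by (intro blinfun.tendsto tendsto_const) (simp add: generator_def)
    then have "((\<lambda>h. (blinfun_apply (S (s + h)) z - blinfun_apply (S s) z) /\<^sub>R h) \<longlongrightarrow> blinfun_apply (S s) y) (at_right 0)"
    proof (rule Lim_transform_eventually)
      show "\<forall>\<^sub>F h in at_right 0. blinfun_apply (S s) ((blinfun_apply (S h) z - z) /\<^sub>R h)
          = (blinfun_apply (S (s + h)) z - blinfun_apply (S s) z) /\<^sub>R h"
        using eventually_at_right_less[of 0]
      proof eventually_elim
        case (elim h)
        then have "S (s + h) = S s o\<^sub>L S h" using S s that by (auto simp: C0_semigroup_def)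
        then show ?case by (simp add: blinfun.diff_right blinfun.scaleR_right)
      qed
    qed
    then show "\<exists>y. ((\<lambda>h. (blinfun_apply (S (s + h)) z - blinfun_apply (S s) z) /\<^sub>R h) \<longlongrightarrow> y) (at_right 0) \<and> norm y \<le> L"
      using L(2)[of s] s that by (intro exI conjI) auto
  qed (use that in auto)
  have "norm (blinfun_apply (S u) z - blinfun_apply (S v) z) \<le> L * \<bar>u - v\<bar>" if "u \<in> {0..T}" "v \<in> {0..T}" for u v
    using le[of u v] le[of v u] that by (cases "u \<le> v") (auto simp: norm_minus_commute)
  with L(1) show thesis by (rule that)
qed

text \<open>The form with squared norms \<open>m k\<close> covers both the eigenfunctions, with
  \<open>m k = 1\<close>, and their gradients, with \<open>m k = \<mu> k\<close>. Coefficients are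
  given through \<open>m k * c k\<close> so that nothing is divided by \<open>m k\<close>.\<close>

lemma bessel_inequality:
  fixes e :: "nat \<Rightarrow> 'm \<Rightarrow> 'e::{real_inner,second_countable_topology}"
  assumes e: "\<And>k. e k \<in> L2 M" and g: "g \<in> L2 M"
    and orth: "\<And>j k. L2_inner M (e j) (e k) = (if j = k then m k else 0)"
    and c: "\<And>k. L2_inner M g (e k) = m k * c k"
  shows "(\<Sum>k<n. m k * (c k)\<^sup>2) \<le> (L2_norm M g)\<^sup>2"
proof -
  let ?s = "\<lambda>n x. \<Sum>k<n. c k *\<^sub>R e k x"
  have s: "?s n \<in> L2 M" for n by (intro L2_sum L2_scaleR e)
  have ce: "(\<lambda>x. c k *\<^sub>R e k x) \<in> L2 M" for k by (intro L2_scaleR e)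
  have se: "L2_inner M (?s n) (e j) = (if j < n then m j * c j else 0)" for n j
  proof (induction n)
    case (Suc n)
    then show ?case using L2_inner_simps(1)[OF s[of n] ce[of n] e[of j]] L2_inner_simps(3)[OF e[of n] e[of n] e[of j]] orth[of n j]
      by (auto simp: less_Suc_eq)
  qed (simp add: L2_inner_def)
  have gs: "L2_inner M g (?s n) = (\<Sum>k<n. m k * (c k)\<^sup>2)" for n
  proof (induction n)
    case (Suc n)
    then show ?case using L2_inner_simps(4)[OF s[of n] ce[of n] g] L2_inner_simps(6)[OF e[of n] e[of n] g] c[of n]
      by (simp add: power2_eq_square)
  qed (simp add: L2_inner_def)
  have ss: "L2_inner M (?s n) (?s n) = (\<Sum>k<n. m k * (c k)\<^sup>2)" for n
  proof -
    have "L2_inner M (?s n) (?s j) = (\<Sum>k<j. m k * (c k)\<^sup>2)" if "j \<le> n" for j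
      using that
    proof (induction j)
      case (Suc j)
      then show ?case
        using L2_inner_simps(4)[OF s[of j] ce[of j] s[of n]] L2_inner_simps(6)[OF e[of j] e[of j] s[of n]] se[of n j]
        by (simp add: power2_eq_square)
    qed (simp add: L2_inner_def)
    then show ?thesis by simp
  qed
  have "0 \<le> L2_inner M (\<lambda>x. g x - ?s n x) (\<lambda>x. g x - ?s n x)"
    unfolding L2_inner_def by (rule integral_nonneg_AE) simp
  also have "\<dots> = L2_inner M g g - (\<Sum>k<n. m k * (c k)\<^sup>2)"
    using L2_inner_simps(2)[OF g s L2_diff[OF g s], of n n] L2_inner_simps(5)[OF g s g, of n] L2_inner_simps(5)[OF g s s, of n n]
      gs[of n] ss[of n] L2_inner_commute[of M "?s n" g] by simp
  finally show ?thesis by (simp add: L2_norm_power2 L2_inner_def power2_norm_eq_inner)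
qed

lemma weak_gradient_L2: "u \<in> H10 D \<Longrightarrow> weak_gradient D u \<in> L2 (lebesgue_on D)"
proof -
  assume "u \<in> H10 D"
  then have "\<exists>G. G \<in> L2 (lebesgue_on D) \<and> has_weak_gradient D u G" by (auto simp: H10_def H1_def)
  from someI_ex[OF this] show ?thesis by (simp add: weak_gradient_def)
qed

lemma H10_L2: "u \<in> H10 D \<Longrightarrow> u \<in> L2 (lebesgue_on D)"
  by (auto simp: H10_def H1_def)

section \<open>Expansions in Dirichlet eigenfunctions\<close>

context
  fixes D :: "'a::euclidean_space set" and \<mu> \<phi>
  assumes eig: "dirichlet_eigensystem D \<mu> \<phi>"
begin

lemma eigenfunction_H10: "\<phi> k \<in> H10 D"
  using eig by (auto simp: dirichlet_eigensystem_def dirichlet_laplacian_def)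

lemma eigenfunction_orthonormal: "L2_inner (lebesgue_on D) (\<phi> j) (\<phi> k) = (if j = k then 1 else 0)"
  using eig by (auto simp: dirichlet_eigensystem_def)

lemma eigenfunction_gradient_inner:
  assumes "v \<in> H10 D"
  shows "L2_inner (lebesgue_on D) (weak_gradient D (\<phi> k)) (weak_gradient D v) = \<mu> k * L2_inner (lebesgue_on D) v (\<phi> k)"
proof -
  have "dirichlet_laplacian D (\<phi> k) (\<lambda>x. - \<mu> k * \<phi> k x)" using eig by (auto simp: dirichlet_eigensystem_def)
  then have "L2_inner (lebesgue_on D) (weak_gradient D (\<phi> k)) (weak_gradient D v)
      = - L2_inner (lebesgue_on D) (\<lambda>x. - \<mu> k * \<phi> k x) v"
    using assms by (simp add: dirichlet_laplacian_def)
  also have "\<dots> = \<mu> k * L2_inner (lebesgue_on D) (\<phi> k) v"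
    by (simp add: L2_inner_def mult.assoc)
  finally show ?thesis by (simp add: L2_inner_commute)
qed

lemma eigenfunction_gradient_orthogonal:
  "L2_inner (lebesgue_on D) (weak_gradient D (\<phi> j)) (weak_gradient D (\<phi> k)) = (if j = k then \<mu> k else 0)"
  using eigenfunction_gradient_inner[OF eigenfunction_H10] eigenfunction_orthonormal by auto

lemma eigenvalue_nonneg: "0 \<le> \<mu> k"
proof -
  have "\<mu> k = L2_inner (lebesgue_on D) (weak_gradient D (\<phi> k)) (weak_gradient D (\<phi> k))"
    by (simp add: eigenfunction_gradient_orthogonal)
  also have "\<dots> \<ge> 0" unfolding L2_inner_def by (rule integral_nonneg_AE) simp
  finally show ?thesis .
qed

text \<open>The gradients of the eigenfunctions are orthogonal with squared norms
  \<open>\<mu> k\<close>, and the coefficients of the gradient of \<open>f\<close> with respect to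
  them are those of \<open>f\<close> itself. Bessel's inequality for gradients is therefore the
  required summability.\<close>

lemma H10_subset_Hdot1: assumes f: "f \<in> H10 D" shows "f \<in> Hdot D \<mu> \<phi> 1"
proof -
  let ?c = "\<lambda>k. L2_inner (lebesgue_on D) f (\<phi> k)"
  have "(\<Sum>k<n. \<mu> k * (?c k)\<^sup>2) \<le> (L2_norm (lebesgue_on D) (weak_gradient D f))\<^sup>2" for n
  proof (rule bessel_inequality)
    show "weak_gradient D (\<phi> k) \<in> L2 (lebesgue_on D)" for k by (intro weak_gradient_L2 eigenfunction_H10)
    show "weak_gradient D f \<in> L2 (lebesgue_on D)" by (intro weak_gradient_L2 f)
    show "L2_inner (lebesgue_on D) (weak_gradient D f) (weak_gradient D (\<phi> k)) = \<mu> k * ?c k" for k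
      using eigenfunction_gradient_inner[OF f, of k] by (simp add: L2_inner_commute)
  qed (rule eigenfunction_gradient_orthogonal)
  then have "summable (\<lambda>k. \<mu> k * (?c k)\<^sup>2)"
    by (intro bounded_imp_summable[of _ "(L2_norm (lebesgue_on D) (weak_gradient D f))\<^sup>2"])
      (simp_all add: eigenvalue_nonneg flip: lessThan_Suc_atMost del: sum.lessThan_Suc)
  then show ?thesis using H10_L2[OF f] by (simp add: Hdot_def eigenvalue_nonneg)
qed

text \<open>Testing the weak equation with an eigenfunction shows that \<open>\<mu> k\<close> times
  the coefficient of \<open>u\<close> is minus that of \<open>p\<close>, so the weighted series is
  the Bessel series of \<open>p\<close>.\<close>

lemma dirichlet_laplacian_Hdot2: assumes u: "dirichlet_laplacian D u p" shows "u \<in> Hdot D \<mu> \<phi> 2"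
proof -
  let ?c = "\<lambda>k. L2_inner (lebesgue_on D) p (\<phi> k)"
  have uH: "u \<in> H10 D" and p: "p \<in> L2 (lebesgue_on D)" using u by (auto simp: dirichlet_laplacian_def)
  have "(\<Sum>k<n. 1 * (?c k)\<^sup>2) \<le> (L2_norm (lebesgue_on D) p)\<^sup>2" for n
  proof (rule bessel_inequality)
    show "\<phi> k \<in> L2 (lebesgue_on D)" for k by (intro H10_L2 eigenfunction_H10)
  qed (use p eigenfunction_orthonormal in auto)
  then have "summable (\<lambda>k. (?c k)\<^sup>2)"
    by (intro bounded_imp_summable[of _ "(L2_norm (lebesgue_on D) p)\<^sup>2"]) (simp_all flip: lessThan_Suc_atMost del: sum.lessThan_Suc)
  moreover have "(?c k)\<^sup>2 = \<mu> k powr 2 * (L2_inner (lebesgue_on D) u (\<phi> k))\<^sup>2" for k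
  proof -
    have "L2_inner (lebesgue_on D) (weak_gradient D u) (weak_gradient D (\<phi> k)) = - ?c k"
      using u eigenfunction_H10 by (auto simp: dirichlet_laplacian_def)
    then have "- ?c k = \<mu> k * L2_inner (lebesgue_on D) u (\<phi> k)"
      using eigenfunction_gradient_inner[OF uH, of k] by (simp add: L2_inner_commute)
    then have "(?c k)\<^sup>2 = (\<mu> k * L2_inner (lebesgue_on D) u (\<phi> k))\<^sup>2" by (metis power2_minus)
    then show ?thesis using eigenvalue_nonneg[of k] by (simp add: power_mult_distrib powr_numeral)
  qed
  ultimately show ?thesis using H10_L2[OF uH] by (simp add: Hdot_def)
qed

lemma Hdot_add:
  assumes "u \<in> Hdot D \<mu> \<phi> s" "v \<in> Hdot D \<mu> \<phi> s" shows "(\<lambda>x. u x + v x) \<in> Hdot D \<mu> \<phi> s"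
proof -
  let ?L = "lebesgue_on D"
  have L: "u \<in> L2 ?L" "v \<in> L2 ?L" using assms by (auto simp: Hdot_def)
  have "summable (\<lambda>k. 2 * (\<mu> k powr s * (L2_inner ?L u (\<phi> k))\<^sup>2) + 2 * (\<mu> k powr s * (L2_inner ?L v (\<phi> k))\<^sup>2))"
    using assms by (intro summable_add summable_mult) (auto simp: Hdot_def)
  then have "summable (\<lambda>k. \<mu> k powr s * (L2_inner ?L (\<lambda>x. u x + v x) (\<phi> k))\<^sup>2)"
  proof (rule summable_comparison_test'[where N=0])
    fix k
    have "L2_inner ?L (\<lambda>x. u x + v x) (\<phi> k) = L2_inner ?L u (\<phi> k) + L2_inner ?L v (\<phi> k)"
      by (rule L2_inner_simps(1)[OF L H10_L2[OF eigenfunction_H10]])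
    then have "(L2_inner ?L (\<lambda>x. u x + v x) (\<phi> k))\<^sup>2 \<le> 2 * (L2_inner ?L u (\<phi> k))\<^sup>2 + 2 * (L2_inner ?L v (\<phi> k))\<^sup>2"
      by (simp add: power2_sum_le)
    then have "\<mu> k powr s * (L2_inner ?L (\<lambda>x. u x + v x) (\<phi> k))\<^sup>2
        \<le> \<mu> k powr s * (2 * (L2_inner ?L u (\<phi> k))\<^sup>2 + 2 * (L2_inner ?L v (\<phi> k))\<^sup>2)"
      by (intro mult_left_mono) auto
    then show "norm (\<mu> k powr s * (L2_inner ?L (\<lambda>x. u x + v x) (\<phi> k))\<^sup>2)
        \<le> 2 * (\<mu> k powr s * (L2_inner ?L u (\<phi> k))\<^sup>2) + 2 * (\<mu> k powr s * (L2_inner ?L v (\<phi> k))\<^sup>2)"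
      by (simp add: algebra_simps)
  qed
  then show ?thesis using L by (auto simp: Hdot_def intro: L2_add)
qed

lemma Hdot_zero: "(\<lambda>x. 0) \<in> Hdot D \<mu> \<phi> s"
  by (simp add: Hdot_def L2_inner_def)

text \<open>Pulls the time factor out of \<open>\<Phi>\<close> and \<open>\<Phi>'\<close>, so that
  both integrands become a scalar function times the orbit of one fixed vector.\<close>

lemma state_space_scale:
  assumes "is_state_space D \<mu> \<phi> cls" "f \<in> L2 (lebesgue_on D)"
  shows "cls (\<lambda>x. 0) (\<lambda>x. 0) (\<lambda>x. f x * r) = r *\<^sub>R cls (\<lambda>x. 0) (\<lambda>x. 0) f"
proof -
  have "cls (\<lambda>x. r * u x) (\<lambda>x. r * v x) (\<lambda>x. r * w x) = r *\<^sub>R cls u v w"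
    if "u \<in> Hdot D \<mu> \<phi> 2" "v \<in> Hdot D \<mu> \<phi> 1" "w \<in> L2 (lebesgue_on D)" for u v w
    using assms(1) that unfolding is_state_space_def by blast
  from this[OF Hdot_zero Hdot_zero assms(2)] show ?thesis by (simp add: mult.commute)
qed

text \<open>That \<open>(0, 0)\<close> lies in the graph of the generator provides a triple \<open>(u, v, w)\<close> of class \<open>0\<close> in the
  domain. Adding \<open>f\<close> to its last component avoids any appeal to uniqueness of weak gradients.\<close>

lemma H10_in_generator_domain:
  assumes st: "is_state_space D \<mu> \<phi> cls" and gen: "generator S = MGT_operator D \<mu> \<phi> cls \<alpha> b c"
    and f: "f \<in> H10 D"
  shows "\<exists>y. (cls (\<lambda>x. 0) (\<lambda>x. 0) f, y) \<in> generator S"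
proof -
  have "(0, 0) \<in> generator S" by (simp add: generator_def blinfun.zero_right)
  then obtain u v w p q where uv: "0 = cls u v w" "dirichlet_laplacian D u p" "dirichlet_laplacian D v q"
      "w \<in> Hdot D \<mu> \<phi> 1"
    unfolding gen MGT_operator_def by auto
  have u: "u \<in> Hdot D \<mu> \<phi> 2" using uv(2) by (rule dirichlet_laplacian_Hdot2)
  have v: "v \<in> Hdot D \<mu> \<phi> 1" using uv(3) by (intro H10_subset_Hdot1) (auto simp: dirichlet_laplacian_def)
  have w: "w \<in> L2 (lebesgue_on D)" using uv(4) by (simp add: Hdot_def)
  have "cls (\<lambda>x. u x + u' x) (\<lambda>x. v x + v' x) (\<lambda>x. w x + w' x) = cls u v w + cls u' v' w'"
    if "u' \<in> Hdot D \<mu> \<phi> 2" "v' \<in> Hdot D \<mu> \<phi> 1" "w' \<in> L2 (lebesgue_on D)" for u' v' w'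
    using st u v w that unfolding is_state_space_def by blast
  from this[OF Hdot_zero Hdot_zero H10_L2[OF f]] have "cls (\<lambda>x. 0) (\<lambda>x. 0) f = cls u v (\<lambda>x. w x + f x)" using uv(1) by simp
  moreover have "(\<lambda>x. w x + f x) \<in> Hdot D \<mu> \<phi> 1" using uv(4) H10_subset_Hdot1[OF f] by (rule Hdot_add)
  ultimately show ?thesis unfolding gen MGT_operator_def using uv(2,3) by blast
qed

end

section \<open>Approximation in the mean square by continuous functions\<close>

lemma finite_measure_lebesgue_Icc: "finite_measure (lebesgue_on {a..b::real})"
  using finite_measure_lebesgue_on[OF lmeasurable_cbox[of a b]] by (simp only: cbox_interval)

lemma continuous_L2:
  fixes f :: "real \<Rightarrow> real"
  assumes f: "continuous_on {a..b} f" shows "f \<in> L2 (lebesgue_on {a..b})"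
proof -
  interpret finite_measure "lebesgue_on {a..b}" by (rule finite_measure_lebesgue_Icc)
  obtain K where K: "\<And>s. s \<in> {a..b} \<Longrightarrow> norm (f s) \<le> K"
    using continuous_on_Icc_norm_bounded[OF f] by blast
  show ?thesis
  proof (rule L2_bound)
    show "f \<in> borel_measurable (lebesgue_on {a..b})"
      using continuous_imp_measurable_on_sets_lebesgue[OF f] by simp
    show "AE s in lebesgue_on {a..b}. (norm (f s))\<^sup>2 \<le> K\<^sup>2"
      by (intro AE_I2 power_mono K norm_ge_zero) (simp add: space_restrict_space)
  qed simp
qed

text \<open>First \<open>g\<close> is truncated at a level k by \<open>cl k\<close>. A measurable
  function is an almost everywhere limit of continuous ones; after the same truncation these are
  uniformly bounded, so on a finite measure dominated convergence makes the limit one in mean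
  square.\<close>

lemma L2_approx_continuous:
  fixes g :: "real \<Rightarrow> real"
  assumes g: "g \<in> L2 (lebesgue_on {a..b})" and "0 < \<epsilon>"
  obtains \<gamma> where "continuous_on UNIV \<gamma>" "(LINT s|lebesgue_on {a..b}. (\<gamma> s - g s)\<^sup>2) \<le> \<epsilon>"
proof -
  let ?\<nu> = "lebesgue_on {a..b}"
  interpret finite_measure ?\<nu>
    by (rule finite_measure_lebesgue_Icc)
  define cl where "cl k x = max (- real k) (min (real k) x)" for k x
  have gm[measurable]: "g \<in> borel_measurable ?\<nu>" using g by (rule L2_D)
  have clm[measurable]: "cl k \<in> borel_measurable borel" for k unfolding cl_def by measurable
  have cl1: "\<bar>cl k x - x\<bar> \<le> \<bar>x\<bar>" for k x by (auto simp: cl_def)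
  have cl2: "\<bar>cl k x\<bar> \<le> real k" for k x by (auto simp: cl_def)
  have "(\<lambda>k. LINT s|?\<nu>. (cl k (g s) - g s)\<^sup>2) \<longlonglongrightarrow> (LINT s|?\<nu>. 0)"
  proof (rule integral_dominated_convergence)
    show "integrable ?\<nu> (\<lambda>s. (norm (g s))\<^sup>2)" using g by (rule L2_D)
    show "AE s in ?\<nu>. (\<lambda>k. (cl k (g s) - g s)\<^sup>2) \<longlonglongrightarrow> 0"
    proof (rule AE_I2)
      fix s
      obtain k0 where k0: "\<bar>g s\<bar> \<le> real k0" using real_arch_simple by blast
      have "cl k (g s) = g s" if "k \<ge> k0" for k
      proof -
        have "real k0 \<le> real k" using that by simp
        then show ?thesis using k0 by (auto simp: cl_def)
      qed
      then have "\<forall>\<^sub>F k in sequentially. (cl k (g s) - g s)\<^sup>2 = 0"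
        by (auto simp: eventually_sequentially)
      then show "(\<lambda>k. (cl k (g s) - g s)\<^sup>2) \<longlonglongrightarrow> 0" by (rule tendsto_eventually)
    qed
    show "AE s in ?\<nu>. norm ((cl k (g s) - g s)\<^sup>2) \<le> (norm (g s))\<^sup>2" for k
      using cl1 by (intro AE_I2) (simp add: abs_le_square_iff[symmetric])
  qed auto
  then have "\<forall>\<^sub>F k in sequentially. (LINT s|?\<nu>. (cl k (g s) - g s)\<^sup>2) < \<epsilon> / 4"
    using \<open>0 < \<epsilon>\<close> by (intro order_tendstoD) auto
  \<comment> \<open>Each of the two errors gets \<epsilon>/4, because the square of a sum costs a
    factor 2 on each.\<close>
  then obtain k where k: "(LINT s|?\<nu>. (cl k (g s) - g s)\<^sup>2) < \<epsilon> / 4"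
    by (auto simp: eventually_sequentially)
  have "(\<lambda>s. if s \<in> {a..b} then g s else 0) \<in> borel_measurable lebesgue"
    using gm by (subst borel_measurable_if) auto
  then have "(\<lambda>s. if s \<in> {a..b} then g s else 0) measurable_on UNIV"
    by (intro lebesgue_measurable_imp_measurable_on_real) auto
  then obtain N \<gamma> where N: "negligible N" and \<gamma>: "\<And>n. continuous_on UNIV (\<gamma> n)"
    and lim: "\<And>x. x \<notin> N \<Longrightarrow> (\<lambda>n. \<gamma> n x) \<longlonglongrightarrow> (if x \<in> {a..b} then g x else 0)"
    unfolding measurable_on_UNIV by (auto simp: measurable_on_def)
  have "N \<in> null_sets lebesgue" using N by (simp add: negligible_iff_null_sets)
  then have "AE s in lebesgue. s \<notin> N" by (rule AE_not_in)
  then have "AE s in lebesgue. s \<in> {a..b} \<longrightarrow> (\<lambda>n. \<gamma> n s) \<longlonglongrightarrow> g s"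
    by eventually_elim (use lim in presburger)
  then have ae: "AE s in ?\<nu>. (\<lambda>n. \<gamma> n s) \<longlonglongrightarrow> g s" by (subst AE_restrict_space_iff) auto
  have \<gamma>m[measurable]: "\<gamma> n \<in> borel_measurable ?\<nu>" for n
    using continuous_imp_measurable_on_sets_lebesgue[OF continuous_on_subset[OF \<gamma>[of n]]] by auto
  have bnd: "AE s in ?\<nu>. norm ((cl k (\<gamma> n s) - cl k (g s))\<^sup>2) \<le> (2 * real k)\<^sup>2" for n
  proof (rule AE_I2)
    fix s
    have "\<bar>cl k (\<gamma> n s) - cl k (g s)\<bar> \<le> 2 * real k"
      using cl2[of k "\<gamma> n s"] cl2[of k "g s"] by linarith
    from power_mono[OF this abs_ge_zero, of 2]
    show "norm ((cl k (\<gamma> n s) - cl k (g s))\<^sup>2) \<le> (2 * real k)\<^sup>2" by simp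
  qed
  have "(\<lambda>n. LINT s|?\<nu>. (cl k (\<gamma> n s) - cl k (g s))\<^sup>2) \<longlonglongrightarrow> (LINT s|?\<nu>. 0)"
  proof (rule integral_dominated_convergence)
    show "AE s in ?\<nu>. (\<lambda>n. (cl k (\<gamma> n s) - cl k (g s))\<^sup>2) \<longlonglongrightarrow> 0"
      using ae
    proof eventually_elim
      case (elim s)
      have "(\<lambda>n. (cl k (\<gamma> n s) - cl k (g s))\<^sup>2) \<longlonglongrightarrow> (cl k (g s) - cl k (g s))\<^sup>2"
        unfolding cl_def using elim by (intro tendsto_intros)
      then show ?case by simp
    qed
    show "AE s in ?\<nu>. norm ((cl k (\<gamma> n s) - cl k (g s))\<^sup>2) \<le> (2 * real k)\<^sup>2" for n by (rule bnd)
  qed auto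
  then have "\<forall>\<^sub>F n in sequentially. (LINT s|?\<nu>. (cl k (\<gamma> n s) - cl k (g s))\<^sup>2) < \<epsilon> / 4"
    using \<open>0 < \<epsilon>\<close> by (intro order_tendstoD) auto
  then obtain n where n: "(LINT s|?\<nu>. (cl k (\<gamma> n s) - cl k (g s))\<^sup>2) < \<epsilon> / 4"
    by (auto simp: eventually_sequentially)
  have i1: "integrable ?\<nu> (\<lambda>s. (cl k (\<gamma> n s) - cl k (g s))\<^sup>2)"
    using bnd by (rule integrable_const_bound) auto
  have i2: "integrable ?\<nu> (\<lambda>s. (cl k (g s) - g s)\<^sup>2)"
    by (rule Bochner_Integration.integrable_bound[OF L2_D(2)[OF g]])
      (use cl1 in \<open>auto simp: abs_le_square_iff[symmetric]\<close>)
  have "(LINT s|?\<nu>. (cl k (\<gamma> n s) - g s)\<^sup>2)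
      \<le> (LINT s|?\<nu>. 2 * (cl k (\<gamma> n s) - cl k (g s))\<^sup>2 + 2 * (cl k (g s) - g s)\<^sup>2)"
  proof (rule integral_mono_AE')
    show "AE s in ?\<nu>. (cl k (\<gamma> n s) - g s)\<^sup>2 \<le> 2 * (cl k (\<gamma> n s) - cl k (g s))\<^sup>2 + 2 * (cl k (g s) - g s)\<^sup>2"
    proof (rule AE_I2)
      fix s show "(cl k (\<gamma> n s) - g s)\<^sup>2 \<le> 2 * (cl k (\<gamma> n s) - cl k (g s))\<^sup>2 + 2 * (cl k (g s) - g s)\<^sup>2"
        using power2_sum_le[of "cl k (\<gamma> n s) - cl k (g s)" "cl k (g s) - g s"] by simp
    qed
  qed (use i1 i2 in auto)
  also have "\<dots> = 2 * (LINT s|?\<nu>. (cl k (\<gamma> n s) - cl k (g s))\<^sup>2) + 2 * (LINT s|?\<nu>. (cl k (g s) - g s)\<^sup>2)"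
    using i1 i2 by simp
  also have "\<dots> \<le> \<epsilon>" using n k by simp
  finally have fin: "(LINT s|?\<nu>. (cl k (\<gamma> n s) - g s)\<^sup>2) \<le> \<epsilon>" .
  have "continuous_on UNIV (\<lambda>s. cl k (\<gamma> n s))" unfolding cl_def by (intro continuous_intros \<gamma>)
  then show thesis using fin by (rule that)
qed

section \<open>Grid approximations of the stochastic convolution\<close>

context fbm_space
begin

text \<open>An increment over a coarse cell is the sum of the increments over its k subcells. This
  puts two grid sums on a common grid, where \<open>grid_sum_energy\<close> bounds their
  difference.\<close>

lemma grid_sum_refine:
  fixes d :: "nat \<Rightarrow> 'e::real_normed_vector"
  assumes "0 < k" "\<delta> = real k * \<delta>'"
  shows "grid_sum \<delta> N d \<omega> = grid_sum \<delta>' (N * k) (\<lambda>j. d (j div k)) \<omega>"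
proof -
  let ?b = "\<lambda>j. B (real j * \<delta>') \<omega>"
  have "grid_sum \<delta>' (N * k) (\<lambda>j. d (j div k)) \<omega>
      = (\<Sum>i<N. \<Sum>j=i * k..<i * k + k. (?b (Suc j) - ?b j) *\<^sub>R d (j div k))"
    unfolding grid_sum_def by (rule sum.nat_group[symmetric])
  also have "\<dots> = (\<Sum>i<N. (\<Sum>j=i * k..<i * k + k. ?b (Suc j) - ?b j) *\<^sub>R d i)"
  proof (rule sum.cong[OF refl])
    fix i
    have "(?b (Suc j) - ?b j) *\<^sub>R d (j div k) = (?b (Suc j) - ?b j) *\<^sub>R d i" if "j \<in> {i * k..<i * k + k}" for j
    proof -
      have "j div k = i" using that assms(1) by (intro div_nat_eqI) (auto simp: algebra_simps)
      then show ?thesis by simp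
    qed
    then show "(\<Sum>j=i * k..<i * k + k. (?b (Suc j) - ?b j) *\<^sub>R d (j div k))
        = (\<Sum>j=i * k..<i * k + k. ?b (Suc j) - ?b j) *\<^sub>R d i"
      unfolding scaleR_sum_left by (rule sum.cong[OF refl])
  qed
  also have "\<dots> = (\<Sum>i<N. (?b (i * k + k) - ?b (i * k)) *\<^sub>R d i)"
    using sum_Suc_diff'[of "_ * k" "_ * k + k" ?b] by simp
  also have "\<dots> = grid_sum \<delta> N d \<omega>"
    unfolding grid_sum_def assms(2) by (intro sum.cong refl) (simp add: algebra_simps)
  finally show ?thesis ..
qed

end

section \<open>Pointwise and integrated error of the grid coefficients\<close>

abbreviation grid_cell :: "real \<Rightarrow> nat \<Rightarrow> real set" where
  "grid_cell \<delta> j \<equiv> {real j * \<delta><..real (Suc j) * \<delta>}"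

lemma grid_cell_exists:
  fixes \<delta> s :: real
  assumes "0 < s" "s \<le> real N * \<delta>"
  shows "\<exists>j<N. s \<in> grid_cell \<delta> j"
proof -
  let ?P = "\<lambda>j. s \<le> real (Suc j) * \<delta>"
  have "N \<noteq> 0" using assms by (intro notI) simp
  then have P: "?P (N - 1)" using assms(2) by simp
  define j where "j = (LEAST j. ?P j)"
  have j: "?P j" unfolding j_def using P by (rule LeastI)
  have "j \<le> N - 1" unfolding j_def using P by (rule Least_le)
  then have "j < N" using \<open>N \<noteq> 0\<close> by simp
  moreover have "real j * \<delta> < s"
  proof (cases j)
    case (Suc i)
    then have "\<not> ?P i" unfolding j_def by (intro not_less_Least) simp
    then show ?thesis using Suc by simp
  qed (use assms in simp)
  ultimately show ?thesis using j by auto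
qed

lemma grid_cell_unique:
  fixes \<delta> s :: real
  assumes "0 < \<delta>" "s \<in> grid_cell \<delta> i" "s \<in> grid_cell \<delta> j"
  shows "i = j"
proof -
  have *: "\<not> i < j" if "s \<in> grid_cell \<delta> i" "s \<in> grid_cell \<delta> j" for i j
  proof
    assume "i < j"
    then have "real (Suc i) * \<delta> \<le> real j * \<delta>" using assms(1) by (intro mult_right_mono) auto
    then show False using that by auto
  qed
  show ?thesis using *[OF assms(2,3)] *[OF assms(3,2)] by simp
qed

text \<open>Abstracts from the semigroup: \<open>F\<close> stands for the orbit of the class of
  \<open>(0, 0, f\<^sub>1)\<close>, with bound \<open>C\<close> and Lipschitz constant
  \<open>L\<close>.\<close>

locale stoch_convolution = fbm_space M H B for M :: "'o measure" and H B +
  fixes T :: real and F :: "real \<Rightarrow> 'e::{real_inner,polish_space}" and g :: "real \<Rightarrow> real" and C L :: real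
  assumes T: "0 < T"
    and C: "0 \<le> C" "\<And>u. u \<in> {0..T} \<Longrightarrow> norm (F u) \<le> C"
    and L: "0 \<le> L" "\<And>u v. u \<in> {0..T} \<Longrightarrow> v \<in> {0..T} \<Longrightarrow> norm (F u - F v) \<le> L * \<bar>u - v\<bar>"
    and g: "g \<in> L2 (lebesgue_on {0..T})"
begin

abbreviation "\<nu> \<equiv> lebesgue_on {0..T}"

text \<open>Only the cells that end strictly before \<open>t\<close> are kept. The paths of \<open>B\<close> need not be continuous, and
  this makes the grid sums predictable in \<open>(t, \<omega>)\<close> without discretising \<open>t\<close>.\<close>

definition coef :: "nat \<Rightarrow> (real \<Rightarrow> real) \<Rightarrow> real \<Rightarrow> nat \<Rightarrow> 'e" where
  "coef N \<gamma> t j = (if real (Suc j) * (T / N) < t then \<gamma> (real j * (T / N)) *\<^sub>R F (t - real j * (T / N)) else 0)"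

text \<open>Cells that reach t are removed from the list instead of being kept with coefficient 0,
  since \<open>step_list t\<close> asks that every right end be at most t.\<close>

definition grid_steps :: "nat \<Rightarrow> (real \<Rightarrow> real) \<Rightarrow> real \<Rightarrow> ('e \<times> real \<times> real) list" where
  "grid_steps N \<gamma> t = map (\<lambda>j. (coef N \<gamma> t j, real j * (T / N), real (Suc j) * (T / N)))
     (filter (\<lambda>j. real (Suc j) * (T / N) < t) [0..<N])"

definition V :: "nat \<Rightarrow> (real \<Rightarrow> real) \<Rightarrow> real \<Rightarrow> 'o \<Rightarrow> 'e" where
  "V N \<gamma> t = grid_sum (T / N) N (coef N \<gamma> t)"

text \<open>The integrand, extended by zero from t on. The coefficients of later cells vanish too,
  so errors can be integrated over the fixed interval [0, T].\<close>

definition target :: "real \<Rightarrow> real \<Rightarrow> 'e" where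
  "target t s = (if s < t then g s *\<^sub>R F (t - s) else 0)"

lemma step_list_grid_steps: "step_list t (grid_steps N \<gamma> t)"
  using T by (auto simp: step_list_def grid_steps_def intro!: mult_right_mono divide_right_mono)

lemma step_integral_grid_steps: "step_integral B (grid_steps N \<gamma> t) = V N \<gamma> t"
proof
  fix \<omega>
  have "step_integral B (grid_steps N \<gamma> t) \<omega>
    = (\<Sum>j\<leftarrow>[0..<N]. if real (Suc j) * (T / N) < t
        then (B (real (Suc j) * (T / N)) \<omega> - B (real j * (T / N)) \<omega>) *\<^sub>R coef N \<gamma> t j else 0)"
    by (simp only: step_integral_def grid_steps_def map_map o_def prod.case sum_list_map_filter')
  also have "\<dots> = V N \<gamma> t \<omega>"
    unfolding V_def grid_sum_def interv_sum_list_conv_sum_set_nat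
    by (auto simp: coef_def atLeast0LessThan intro!: sum.cong)
  finally show "step_integral B (grid_steps N \<gamma> t) \<omega> = V N \<gamma> t \<omega>" .
qed

lemma step_fun_grid_steps:
  assumes "j < N" "s \<in> grid_cell (T / N) j"
  shows "step_fun (grid_steps N \<gamma> t) s = coef N \<gamma> t j"
proof -
  have \<delta>: "0 < T / N" using T assms(1) by simp
  have "step_fun (grid_steps N \<gamma> t) s
    = (\<Sum>i\<leftarrow>[0..<N]. if real (Suc i) * (T / N) < t
        then indicator (grid_cell (T / N) i) s *\<^sub>R coef N \<gamma> t i else 0)"
    by (simp only: step_fun_def grid_steps_def map_map o_def prod.case sum_list_map_filter')
  also have "\<dots> = (\<Sum>i<N. if i = j then coef N \<gamma> t j else 0)"
    unfolding interv_sum_list_conv_sum_set_nat atLeast0LessThan[symmetric]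
  proof (rule sum.cong)
    fix i
    show "(if real (Suc i) * (T / N) < t
        then indicator (grid_cell (T / N) i) s *\<^sub>R coef N \<gamma> t i else 0)
      = (if i = j then coef N \<gamma> t j else 0)"
    proof (cases "i = j")
      case True
      then show ?thesis using assms(2) by (auto simp: coef_def)
    next
      case False
      then have "s \<notin> grid_cell (T / N) i"
        using grid_cell_unique[OF \<delta> _ assms(2)] by blast
      then show ?thesis using False by simp
    qed
  qed simp
  finally show ?thesis using assms(1) by simp
qed

lemma V_L2: "V N \<gamma> t \<in> L2 M"
  unfolding V_def using T by (intro grid_sum_L2) simp

lemma V_diff_energy:
  assumes "0 < k" "0 < N"
  shows "(L2_norm M (\<lambda>\<omega>. V N \<gamma> t \<omega> - V (N * k) \<gamma>' t \<omega>))\<^sup>2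
    \<le> max 2 (2 * H * T powr (2 * H - 1)) * (T / (N * k)) powr (min 1 (2 * H))
      * (\<Sum>j<N * k. (norm (coef N \<gamma> t (j div k) - coef (N * k) \<gamma>' t j))\<^sup>2)"
proof -
  have "T / real N = real k * (T / real (N * k))" using assms by simp
  then have "(\<lambda>\<omega>. V N \<gamma> t \<omega> - V (N * k) \<gamma>' t \<omega>)
      = grid_sum (T / real (N * k)) (N * k) (\<lambda>j. coef N \<gamma> t (j div k) - coef (N * k) \<gamma>' t j)"
    unfolding V_def grid_sum_diff[abs_def] by (intro ext arg_cong2[where f="(-)"] grid_sum_refine assms refl)
  then show ?thesis using grid_sum_energy[OF T, of "N * k"] by simp
qed

text \<open>The three terms come from replacing g by \<gamma>, from the variation of F and \<gamma>
  within one cell (\<open>w\<close> bounds the oscillation of \<gamma> over a mesh width,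
  \<open>\<Gamma>\<close> its size), and from the cell reaching t, where the coefficient is set to
  0. The factors 2 stem from squaring sums.\<close>

definition cell_error :: "nat \<Rightarrow> (real \<Rightarrow> real) \<Rightarrow> real \<Rightarrow> real \<Rightarrow> real \<Rightarrow> real \<Rightarrow> real" where
  "cell_error N \<gamma> \<Gamma> w t s = 2 * C\<^sup>2 * (\<gamma> s - g s)\<^sup>2 + 2 * (\<Gamma> * L * (T / N) + w * C)\<^sup>2
    + 2 * (C * \<Gamma>)\<^sup>2 * indicator {t - T / N..t} s"

lemma coef_error:
  assumes N: "0 < N" and j: "j < N" "s \<in> grid_cell (T / N) j" and t: "t \<in> {0..T}"
    and \<Gamma>: "\<And>x. x \<in> {0..T} \<Longrightarrow> \<bar>\<gamma> x\<bar> \<le> \<Gamma>"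
    and w: "\<And>x y. x \<in> {0..T} \<Longrightarrow> y \<in> {0..T} \<Longrightarrow> \<bar>x - y\<bar> \<le> T / N \<Longrightarrow> \<bar>\<gamma> x - \<gamma> y\<bar> \<le> w"
  shows "(norm (coef N \<gamma> t j - target t s))\<^sup>2 \<le> cell_error N \<gamma> \<Gamma> w t s"
proof -
  define \<delta> where "\<delta> = T / N"
  have \<delta>: "0 < \<delta>" "real N * \<delta> = T" using N T by (auto simp: \<delta>_def)
  have "real (Suc j) * \<delta> \<le> real N * \<delta>" using j(1) \<delta>(1) by (intro mult_right_mono) auto
  then have jT: "real (Suc j) * \<delta> \<le> T" using \<delta> by simp
  have j0: "0 \<le> real j * \<delta>" using \<delta> by simp
  have js: "real j * \<delta> < s" "s \<le> real (Suc j) * \<delta>" "real (Suc j) * \<delta> = real j * \<delta> + \<delta>"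
    using j(2) unfolding \<delta>_def[symmetric] by (auto simp: algebra_simps)
  have sT: "s \<in> {0..T}" "real j * \<delta> \<in> {0..T}"
    using js j0 jT unfolding atLeastAtMost_iff by linarith+
  have \<Gamma>0: "0 \<le> \<Gamma>" using \<Gamma>[OF sT(1)] by linarith
  have w0: "0 \<le> w" using w[OF sT(1) sT(1)] \<delta>(1) by (simp add: \<delta>_def)
  have sq: "x\<^sup>2 \<le> 2 * a\<^sup>2 + 2 * b\<^sup>2" if "0 \<le> x" "x \<le> a + b" for x a b :: real
    using power_mono[OF that(2,1), of 2] power2_sum_le[of a b] by linarith
  show ?thesis
  proof (cases "real (Suc j) * \<delta> < t")
    case True
    let ?u = "t - real j * \<delta>" and ?v = "t - s"
    have uv: "?u \<in> {0..T}" "?v \<in> {0..T}"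
      using True js j0 t unfolding atLeastAtMost_iff by linarith+
    \<comment> \<open>From the left end of the cell to s: first the argument of F is moved, then
      that of \<gamma>, and finally \<gamma> is replaced by g.\<close>
    have "coef N \<gamma> t j - target t s = \<gamma> (real j * \<delta>) *\<^sub>R (F ?u - F ?v)
        + (\<gamma> (real j * \<delta>) - \<gamma> s) *\<^sub>R F ?v + (\<gamma> s - g s) *\<^sub>R F ?v"
      using True js by (simp add: coef_def target_def flip: \<delta>_def) (simp add: algebra_simps)
    then have "norm (coef N \<gamma> t j - target t s) \<le> \<bar>\<gamma> (real j * \<delta>)\<bar> * norm (F ?u - F ?v)
        + \<bar>\<gamma> (real j * \<delta>) - \<gamma> s\<bar> * norm (F ?v) + \<bar>\<gamma> s - g s\<bar> * norm (F ?v)"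
      by (metis (no_types, lifting) norm_triangle_mono norm_scaleR order_refl)
    also have "\<dots> \<le> \<Gamma> * (L * \<delta>) + w * C + \<bar>\<gamma> s - g s\<bar> * C"
    proof (intro add_mono mult_mono \<Gamma> C w sT uv abs_ge_zero norm_ge_zero \<Gamma>0 w0)
      have "norm (F ?u - F ?v) \<le> L * \<bar>?u - ?v\<bar>" by (intro L uv)
      also have "\<dots> \<le> L * \<delta>" using js L(1) by (intro mult_left_mono) auto
      finally show "norm (F ?u - F ?v) \<le> L * \<delta>" .
      show "\<bar>real j * \<delta> - s\<bar> \<le> T / real N" using js by (simp add: \<delta>_def[symmetric])
    qed auto
    finally have "(norm (coef N \<gamma> t j - target t s))\<^sup>2 \<le> 2 * (C * \<bar>\<gamma> s - g s\<bar>)\<^sup>2 + 2 * (\<Gamma> * L * \<delta> + w * C)\<^sup>2"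
      by (intro sq) (auto simp: mult_ac)
    also have "\<dots> \<le> cell_error N \<gamma> \<Gamma> w t s"
      by (simp add: cell_error_def \<delta>_def power_mult_distrib)
    finally show ?thesis .
  next
    case False
    then have c0: "coef N \<gamma> t j = 0" by (simp add: coef_def \<delta>_def)
    show ?thesis
    proof (cases "s < t")
      case True
      have v: "t - s \<in> {0..T}" using True sT t by auto
      have "norm (target t s) = \<bar>(g s - \<gamma> s) + \<gamma> s\<bar> * norm (F (t - s))" using True by (simp add: target_def)
      also have "\<dots> \<le> (\<bar>\<gamma> s - g s\<bar> + \<Gamma>) * C"
        using \<Gamma>[OF sT(1)] by (intro mult_mono C v) auto
      finally have "(norm (target t s))\<^sup>2 \<le> 2 * (C * \<bar>\<gamma> s - g s\<bar>)\<^sup>2 + 2 * (C * \<Gamma>)\<^sup>2"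
        by (intro sq) (auto simp: algebra_simps)
      \<comment> \<open>The cell of s reaches t, so s lies within one mesh width of t and the
        indicator in \<open>cell_error\<close> is 1.\<close>
      moreover have "s \<in> {t - T / N..t}" using True False js by (auto simp: \<delta>_def[symmetric])
      moreover have "(C * \<bar>\<gamma> s - g s\<bar>)\<^sup>2 = C\<^sup>2 * (\<gamma> s - g s)\<^sup>2" by (simp add: power_mult_distrib)
      ultimately have "(norm (target t s))\<^sup>2 \<le> cell_error N \<gamma> \<Gamma> w t s"
        using zero_le_power2[of "\<Gamma> * L * (T / N) + w * C"] unfolding cell_error_def
        by (simp only: indicator_simps mult.assoc)
      then show ?thesis by (simp add: c0)
    next
      case False
      then show ?thesis by (simp add: c0 target_def cell_error_def)
    qed
  qed
qed

lemma \<nu>_finite: "finite_measure \<nu>"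
  by (rule finite_measure_lebesgue_Icc)

lemma \<nu>_space: "space \<nu> = {0..T}"
  by (simp add: space_restrict_space)

lemma \<nu>_interval: assumes "X \<in> sets borel" shows "integrable \<nu> (indicat_real X)"
proof -
  interpret finite_measure \<nu> by (rule \<nu>_finite)
  have "X \<inter> {0..T} \<in> sets \<nu>" using assms by (auto simp: sets_restrict_space)
  then have "integrable \<nu> (indicat_real (X \<inter> {0..T}))" by (simp add: emeasure_eq_measure)
  then show ?thesis
    by (rule Bochner_Integration.integrable_cong[THEN iffD1, rotated -1]) (auto simp: \<nu>_space split: split_indicator)
qed

lemma \<nu>_Ioc:
  assumes "0 \<le> a" "a \<le> b" "b \<le> T" shows "(LINT s|\<nu>. indicat_real {a<..b} s) = b - a"
proof -
  have "(LINT s|\<nu>. indicat_real {a<..b} s) = (LINT s|lebesgue. indicator {0..T} s *\<^sub>R indicat_real {a<..b} s)"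
    by (subst integral_restrict_space) auto
  also have "\<dots> = (LINT s|lebesgue. indicat_real {a<..b} s)"
    using assms by (intro Bochner_Integration.integral_cong) (auto split: split_indicator)
  also have "\<dots> = b - a" using assms by simp
  finally show ?thesis .
qed

lemma cell_error_integral:
  assumes \<gamma>: "continuous_on {0..T} \<gamma>" and t: "t \<in> {0..T}" and N: "0 < N"
  shows "integrable \<nu> (cell_error N \<gamma> \<Gamma> w t)"
    and "(LINT s|\<nu>. cell_error N \<gamma> \<Gamma> w t s) \<le> 2 * C\<^sup>2 * (LINT s|\<nu>. (\<gamma> s - g s)\<^sup>2)
      + 2 * T * (\<Gamma> * L * (T / N) + w * C)\<^sup>2 + 2 * (C * \<Gamma>)\<^sup>2 * (T / N)"
proof -
  interpret finite_measure \<nu> by (rule \<nu>_finite)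
  have "\<gamma> \<in> L2 \<nu>" using \<gamma> by (rule continuous_L2)
  then have i1: "integrable \<nu> (\<lambda>s. (\<gamma> s - g s)\<^sup>2)" using L2_D(2)[OF L2_diff[OF _ g], of \<gamma>] by simp
  have i2: "integrable \<nu> (indicat_real {t - T / N..t})" by (rule \<nu>_interval) simp
  show "integrable \<nu> (cell_error N \<gamma> \<Gamma> w t)" unfolding cell_error_def[abs_def]
    using i1 i2 by (intro Bochner_Integration.integrable_add integrable_mult_right integrable_const)
  have eq: "(LINT s|\<nu>. cell_error N \<gamma> \<Gamma> w t s) = 2 * C\<^sup>2 * (LINT s|\<nu>. (\<gamma> s - g s)\<^sup>2)
      + 2 * (\<Gamma> * L * (T / N) + w * C)\<^sup>2 * T + 2 * (C * \<Gamma>)\<^sup>2 * (LINT s|\<nu>. indicat_real {t - T / N..t} s)"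
  proof -
    have "measure \<nu> (space \<nu>) = T" using T by (simp add: \<nu>_space measure_restrict_space)
    then show ?thesis unfolding cell_error_def using i1 i2 by (simp add: lebesgue_integral_const)
  qed
  have "(LINT s|\<nu>. indicat_real {t - T / N..t} s) \<le> T / N"
  proof -
    have "(LINT s|\<nu>. indicat_real {t - T / N..t} s) = (LINT s|lebesgue. indicator {0..T} s *\<^sub>R indicat_real {t - T / N..t} s)"
      by (subst integral_restrict_space) auto
    also have "\<dots> \<le> (LINT s|lebesgue. indicat_real {t - T / N..t} s)"
    proof (rule integral_mono_AE')
      show "integrable lebesgue (indicat_real {t - T / N..t})"
        unfolding integrable_indicator_iff using lmeasurable_cbox[of "t - T / N" t]
        by (simp add: fmeasurable_def cbox_interval)
    qed (auto split: split_indicator)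
    also have "\<dots> = T / N" using T by simp
    finally show ?thesis .
  qed
  then have "2 * (C * \<Gamma>)\<^sup>2 * (LINT s|\<nu>. indicat_real {t - T / N..t} s) \<le> 2 * (C * \<Gamma>)\<^sup>2 * (T / N)"
    by (intro mult_left_mono) auto
  moreover have "2 * (\<Gamma> * L * (T / N) + w * C)\<^sup>2 * T = 2 * T * (\<Gamma> * L * (T / N) + w * C)\<^sup>2" by simp
  ultimately show "(LINT s|\<nu>. cell_error N \<gamma> \<Gamma> w t s) \<le> 2 * C\<^sup>2 * (LINT s|\<nu>. (\<gamma> s - g s)\<^sup>2)
      + 2 * T * (\<Gamma> * L * (T / N) + w * C)\<^sup>2 + 2 * (C * \<Gamma>)\<^sup>2 * (T / N)"
    unfolding eq by linarith
qed

text \<open>The mesh times the sum is the integral of a piecewise constant function, and at every s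
  in a fine cell both coefficients are compared with the same value \<open>target t s\<close>. Only
  integrated errors remain, which suits a merely square-integrable g.\<close>

lemma coef_diff_sum_le:
  assumes k: "0 < k" and N: "0 < N"
    and E: "\<And>j s. j < N \<Longrightarrow> s \<in> grid_cell (T / N) j
        \<Longrightarrow> (norm (coef N \<gamma> t j - target t s))\<^sup>2 \<le> E s"
    and E': "\<And>j s. j < N * k \<Longrightarrow> s \<in> grid_cell (T / real (N * k)) j
        \<Longrightarrow> (norm (coef (N * k) \<gamma>' t j - target t s))\<^sup>2 \<le> E' s"
    and i: "integrable \<nu> E" "integrable \<nu> E'" and nn: "\<And>s. 0 \<le> E s" "\<And>s. 0 \<le> E' s"
  shows "T / real (N * k) * (\<Sum>j<N * k. (norm (coef N \<gamma> t (j div k) - coef (N * k) \<gamma>' t j))\<^sup>2)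
    \<le> 2 * (LINT s|\<nu>. E s) + 2 * (LINT s|\<nu>. E' s)"
proof -
  define \<delta> where "\<delta> = T / real (N * k)"
  have \<delta>: "0 < \<delta>" "T / N = real k * \<delta>" "real (N * k) * \<delta> = T" using T N k by (auto simp: \<delta>_def)
  let ?x = "\<lambda>j. (norm (coef N \<gamma> t (j div k) - coef (N * k) \<gamma>' t j))\<^sup>2"
  let ?J = "grid_cell \<delta>"
  have le: "?x j \<le> 2 * E s + 2 * E' s" if j: "j < N * k" "s \<in> ?J j" for j s
  proof -
    have jk: "j div k < N" using j(1) by (simp add: less_mult_imp_div_less)
    \<comment> \<open>The fine cell j lies inside the coarse cell j div k; these are the
      inequalities between the end points in units of the fine mesh.\<close>
    have "real (j div k * k) \<le> real j" "real (Suc j) \<le> real (Suc (j div k) * k)"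
      using k dividend_less_times_div[of k j] by (auto simp del: of_nat_Suc of_nat_mult simp: algebra_simps intro!: of_nat_mono)
    then have "real (j div k * k) * \<delta> \<le> real j * \<delta>" "real (Suc j) * \<delta> \<le> real (Suc (j div k) * k) * \<delta>"
      using \<delta>(1) by (auto intro!: mult_right_mono)
    then have "real (j div k) * (T / N) \<le> real j * \<delta>" "real (Suc j) * \<delta> \<le> real (Suc (j div k)) * (T / N)"
      unfolding \<delta>(2) of_nat_mult by (simp_all only: mult.assoc)
    then have "s \<in> grid_cell (T / N) (j div k)"
      using j(2) unfolding greaterThanAtMost_iff by linarith
    from E[OF jk this] E'[of j s] j
    have 1: "(norm (coef N \<gamma> t (j div k) - target t s))\<^sup>2 \<le> E s" "(norm (coef (N * k) \<gamma>' t j - target t s))\<^sup>2 \<le> E' s"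
      by (auto simp: \<delta>_def)
    have "?x j \<le> 2 * (norm (coef N \<gamma> t (j div k) - target t s))\<^sup>2 + 2 * (norm (target t s - coef (N * k) \<gamma>' t j))\<^sup>2"
      using norm_add_power2_le[of "coef N \<gamma> t (j div k) - target t s" "target t s - coef (N * k) \<gamma>' t j"] by simp
    then show ?thesis using 1 by (simp add: norm_minus_commute)
  qed
  have "(LINT s|\<nu>. indicat_real (?J j) s) = \<delta>" if "j < N * k" for j
  proof -
    have "real (Suc j) \<le> real (N * k)" using that by (simp del: of_nat_mult)
    then have "real (Suc j) * \<delta> \<le> T" unfolding \<delta>(3)[symmetric] using \<delta>(1) by (intro mult_right_mono) auto
    then show ?thesis using \<delta>(1) by (subst \<nu>_Ioc) (auto simp: algebra_simps)
  qed
  then have "\<delta> * (\<Sum>j<N * k. ?x j) = (\<Sum>j<N * k. (LINT s|\<nu>. indicat_real (?J j) s) * ?x j)"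
    by (simp add: sum_distrib_left)
  also have "\<dots> = (\<Sum>j<N * k. LINT s|\<nu>. indicat_real (?J j) s * ?x j)"
    by simp
  also have "\<dots> = (LINT s|\<nu>. (\<Sum>j<N * k. indicat_real (?J j) s * ?x j))"
    by (intro Bochner_Integration.integral_sum[symmetric] integrable_mult_left \<nu>_interval) auto
  also have "\<dots> \<le> (LINT s|\<nu>. 2 * E s + 2 * E' s)"
  proof (rule integral_mono)
    show "integrable \<nu> (\<lambda>s. \<Sum>j<N * k. indicat_real (?J j) s * ?x j)"
      by (intro Bochner_Integration.integrable_sum integrable_mult_left \<nu>_interval) auto
    show "integrable \<nu> (\<lambda>s. 2 * E s + 2 * E' s)" using i by auto
    fix s assume "s \<in> space \<nu>"
    then have s: "0 \<le> s" "s \<le> T" by (auto simp: \<nu>_space)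
    show "(\<Sum>j<N * k. indicat_real (?J j) s * ?x j) \<le> 2 * E s + 2 * E' s"
    \<comment> \<open>Cells are open on the left, so s = 0 lies in none of them and the sum is 0;
      any other s lies in exactly one.\<close>
    proof (cases "s = 0")
      case True
      have "(\<Sum>j<N * k. indicat_real (?J j) s * ?x j) = (\<Sum>j<N * k. 0)"
      proof (rule sum.cong[OF refl])
        fix j
        have "s \<notin> ?J j" using True \<delta>(1) by (simp add: mult_less_0_iff)
        then show "indicat_real (?J j) s * ?x j = 0" by simp
      qed
      then show ?thesis using nn(1)[of s] nn(2)[of s] unfolding sum.neutral_const by linarith
    next
      case False
      then obtain j where j: "j < N * k" "s \<in> ?J j" using grid_cell_exists[of s "N * k" \<delta>] s \<delta>(3) by auto
      have "(\<Sum>i<N * k. indicat_real (?J i) s * ?x i) = (\<Sum>i<N * k. if i = j then ?x i else 0)"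
      proof (rule sum.cong[OF refl])
        fix i
        show "indicat_real (?J i) s * ?x i = (if i = j then ?x i else 0)"
        proof (cases "i = j")
          case False
          then have "s \<notin> ?J i" using grid_cell_unique[OF \<delta>(1) _ j(2)] by blast
          then show ?thesis using False by (simp only: indicator_simps if_False mult_zero_left simp_thms)
        qed (use j(2) in \<open>simp only: indicator_simps if_True mult_1 simp_thms\<close>)
      qed
      also have "\<dots> = ?x j" using j(1) by (simp only: sum.delta' sum.delta finite_lessThan lessThan_iff if_True)
      finally show ?thesis using le[OF j] by linarith
    qed
  qed
  also have "\<dots> = 2 * (LINT s|\<nu>. E s) + 2 * (LINT s|\<nu>. E' s)" using i by simp
  finally show ?thesis unfolding \<delta>_def .
qed

end

section \<open>The deterministic convolution\<close>

lemma convolution_kernel_measurable: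
  fixes F :: "real \<Rightarrow> 'e::{real_normed_vector,polish_space}"
  assumes g: "g \<in> L2 (lebesgue_on {0..T})" and F: "continuous_on {0..T} F" and t: "t \<in> {0..T}"
  shows "(\<lambda>s. indicat_real {0..t} s *\<^sub>R (g s *\<^sub>R F (t - s))) \<in> borel_measurable lebesgue"
proof -
  have "(\<lambda>s. if s \<in> {0..T} then g s else 0) \<in> borel_measurable lebesgue"
    using L2_D(1)[OF g] by (subst borel_measurable_if) auto
  moreover have "(\<lambda>s. indicat_real {0..t} s *\<^sub>R F (t - s)) \<in> borel_measurable lebesgue"
  proof -
    have "continuous_on {0..t} (\<lambda>s. F (t - s))"
      using t by (intro continuous_on_compose2[OF F] continuous_intros) auto
    then have "(\<lambda>s. indicat_real {0..t} s *\<^sub>R F (t - s)) \<in> borel_measurable borel"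
      by (intro borel_measurable_continuous_on_indicator) auto
    then show ?thesis by (simp add: measurable_completion)
  qed
  ultimately have "(\<lambda>s. (if s \<in> {0..T} then g s else 0) *\<^sub>R (indicat_real {0..t} s *\<^sub>R F (t - s))) \<in> borel_measurable lebesgue"
    by (rule borel_measurable_scaleR)
  then show ?thesis
    by (rule measurable_cong[THEN iffD1, rotated]) (use t in \<open>auto split: split_indicator\<close>)
qed

text \<open>The majorant does not depend on t, as dominated convergence requires when t
  varies.\<close>

lemma convolution_kernel_dominated:
  fixes F :: "real \<Rightarrow> 'e::{real_normed_vector,polish_space}"
  assumes g: "g \<in> L2 (lebesgue_on {0..T})" and F: "continuous_on {0..T} F"
  obtains G where "integrable lebesgue G"
    "\<forall>t\<in>{0..T}. \<forall>s. norm (indicat_real {0..t} s *\<^sub>R (g s *\<^sub>R F (t - s))) \<le> G s"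
proof -
  interpret finite_measure "lebesgue_on {0..T}"
    by (rule finite_measure_lebesgue_Icc)
  obtain C where C: "\<And>u. u \<in> {0..T} \<Longrightarrow> norm (F u) \<le> C"
    using continuous_on_Icc_norm_bounded[OF F] by blast
  define G where "G s = indicat_real {0..T} s *\<^sub>R (\<bar>g s\<bar> * \<bar>C\<bar>)" for s
  have "(\<lambda>s. 1::real) \<in> L2 (lebesgue_on {0..T})" by (simp add: L2_def)
  from L2_norm_mult_integrable[OF g this] have "integrable (lebesgue_on {0..T}) (\<lambda>s. \<bar>g s\<bar> * \<bar>C\<bar>)" by simp
  then have "integrable lebesgue G"
    unfolding G_def by (subst (asm) integrable_restrict_space) simp_all
  moreover have "norm (indicat_real {0..t} s *\<^sub>R (g s *\<^sub>R F (t - s))) \<le> G s" if "t \<in> {0..T}" for t s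
  proof (cases "s \<in> {0..t}")
    case True
    then have "norm (F (t - s)) \<le> C" using that by (intro C) auto
    then have "norm (F (t - s)) \<le> \<bar>C\<bar>" by linarith
    then have "\<bar>g s\<bar> * norm (F (t - s)) \<le> \<bar>g s\<bar> * \<bar>C\<bar>" by (intro mult_left_mono) auto
    moreover have "s \<in> {0..T}" using True that by auto
    ultimately show ?thesis using True by (simp add: G_def)
  qed (simp add: G_def)
  ultimately show thesis using that by blast
qed

lemma convolution_integrable:
  fixes F :: "real \<Rightarrow> 'e::{real_normed_vector,polish_space}"
  assumes "g \<in> L2 (lebesgue_on {0..T})" "continuous_on {0..T} F" "t \<in> {0..T}"
  shows "set_integrable lebesgue {0..t} (\<lambda>s. g s *\<^sub>R F (t - s))"
proof -
  obtain G where "integrable lebesgue G"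
    "\<forall>t\<in>{0..T}. \<forall>s. norm (indicat_real {0..t} s *\<^sub>R (g s *\<^sub>R F (t - s))) \<le> G s"
    using convolution_kernel_dominated[OF assms(1,2)] by blast
  then show ?thesis
    unfolding set_integrable_def using assms(3)
    by (intro integrable_dominated[OF convolution_kernel_measurable[OF assms] _ AE_I2]) blast+
qed

text \<open>As the upper limit moves, the kernel converges at every s except possibly at s = t,
  where the indicator jumps. Continuity in t makes the drift a Borel function of time, hence
  predictable.\<close>

lemma convolution_continuous:
  fixes F :: "real \<Rightarrow> 'e::{real_normed_vector,polish_space}"
  assumes g: "g \<in> L2 (lebesgue_on {0..T})" and F: "continuous_on {0..T} F"
  shows "continuous_on {0..T} (\<lambda>t. LINT s:{0..t}|lebesgue. g s *\<^sub>R F (t - s))"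
proof (rule continuous_on_sequentiallyI)
  fix u t assume u: "\<forall>n. u n \<in> {0..T}" and t: "t \<in> {0..T}" and ut: "u \<longlonglongrightarrow> t"
  let ?h = "\<lambda>t s. indicat_real {0..t} s *\<^sub>R (g s *\<^sub>R F (t - s))"
  obtain G where G0: "integrable lebesgue G" "\<forall>t\<in>{0..T}. \<forall>s. norm (?h t s) \<le> G s"
    using convolution_kernel_dominated[OF g F] by blast
  note G = G0(1) G0(2)[rule_format]
  have hi: "integrable lebesgue (?h t)" if "t \<in> {0..T}" for t
    using convolution_integrable[OF g F that] by (simp add: set_integrable_def)
  have hm: "?h t \<in> borel_measurable lebesgue" if "t \<in> {0..T}" for t
    using convolution_kernel_measurable[OF g F that] .
  have "(\<lambda>n. LINT s|lebesgue. norm (?h (u n) s - ?h t s)) \<longlonglongrightarrow> (LINT s::real|lebesgue. 0)"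
  proof (rule integral_dominated_convergence)
    show "integrable lebesgue (\<lambda>s. 2 * G s)" using G(1) by simp
    show "(\<lambda>s. norm (?h (u n) s - ?h t s)) \<in> borel_measurable lebesgue" for n
      by (rule measurable_compose[OF borel_measurable_diff[OF hm hm] borel_measurable_norm]) (use u t in blast)+
    show "AE s in lebesgue. norm (norm (?h (u n) s - ?h t s)) \<le> 2 * G s" for n
    proof (rule AE_I2)
      fix s show "norm (norm (?h (u n) s - ?h t s)) \<le> 2 * G s"
        using norm_triangle_ineq4[of "?h (u n) s" "?h t s"] G(2)[of "u n" s] G(2)[of t s] u t by simp
    qed
    have "AE s in lborel. s \<noteq> t" by (rule AE_lborel_singleton)
    then have "AE s in lebesgue. s \<noteq> t" by (rule AE_completion)
    then show "AE s in lebesgue. (\<lambda>n. norm (?h (u n) s - ?h t s)) \<longlonglongrightarrow> 0"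
    proof eventually_elim
      case (elim s)
      have "(\<lambda>n. ?h (u n) s) \<longlonglongrightarrow> ?h t s"
      proof (cases "s < t")
        case True
        show ?thesis
        proof (cases "0 \<le> s")
          case s: True
          have "\<forall>\<^sub>F n in sequentially. s < u n" using ut True by (rule order_tendstoD)
          then have ev: "\<forall>\<^sub>F n in sequentially. g s *\<^sub>R F (u n - s) = ?h (u n) s"
            by eventually_elim (use s in auto)
          have ev2: "\<forall>\<^sub>F n in sequentially. u n - s \<in> {0..T}"
            using \<open>\<forall>\<^sub>F n in sequentially. s < u n\<close>
          proof eventually_elim
            case (elim n)
            then show ?case using s u[rule_format, of n] by auto
          qed
          have "(\<lambda>n. F (u n - s)) \<longlonglongrightarrow> F (t - s)"
            using True s t by (intro continuous_on_tendsto_compose[OF F _ _ ev2] tendsto_intros ut) auto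
          then have "(\<lambda>n. g s *\<^sub>R F (u n - s)) \<longlonglongrightarrow> g s *\<^sub>R F (t - s)" by (intro tendsto_intros)
          then show ?thesis using Lim_transform_eventually[OF _ ev] s True by simp
        next
          case s: False
          have "?h r s = 0" for r using s by simp
          then show ?thesis by (simp only: tendsto_const)
        qed
      next
        case False
        then have "t < s" using elim by simp
        then have "\<forall>\<^sub>F n in sequentially. u n < s" using ut by (intro order_tendstoD)
        then have "\<forall>\<^sub>F n in sequentially. ?h (u n) s = ?h t s"
          by eventually_elim (use \<open>t < s\<close> in auto)
        then show ?thesis by (rule tendsto_eventually)
      qed
      then show ?case by (simp add: tendsto_norm_zero_iff LIM_zero_iff)
    qed
  qed auto
  then have L: "(\<lambda>n. LINT s|lebesgue. norm (?h (u n) s - ?h t s)) \<longlonglongrightarrow> 0" by simp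
  have "(\<lambda>n. (LINT s|lebesgue. ?h (u n) s) - (LINT s|lebesgue. ?h t s)) \<longlonglongrightarrow> 0"
  proof (rule Lim_null_comparison)
    show "\<forall>\<^sub>F n in sequentially. norm ((LINT s|lebesgue. ?h (u n) s) - (LINT s|lebesgue. ?h t s))
        \<le> (LINT s|lebesgue. norm (?h (u n) s - ?h t s))"
    proof (rule eventuallyI)
      fix n
      note hu = hi[OF u[rule_format, of n]] and ht = hi[OF t]
      show "norm ((LINT s|lebesgue. ?h (u n) s) - (LINT s|lebesgue. ?h t s))
          \<le> (LINT s|lebesgue. norm (?h (u n) s - ?h t s))"
        unfolding Bochner_Integration.integral_diff[OF hu ht, symmetric]
        by (rule norm_integral_le[OF Bochner_Integration.integrable_diff[OF hu ht]])
    qed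
  qed (rule L)
  then show "(\<lambda>n. LINT s:{0..u n}|lebesgue. g s *\<^sub>R F (u n - s)) \<longlonglongrightarrow> (LINT s:{0..t}|lebesgue. g s *\<^sub>R F (t - s))"
    unfolding set_lebesgue_integral_def by (rule LIM_zero_cancel)
qed

section \<open>Convergence in L1, and the scheme for Hurst index at least 1/2\<close>

context stoch_convolution
begin

abbreviation L1_error :: "nat \<Rightarrow> (real \<Rightarrow> real) \<Rightarrow> real \<Rightarrow> real" where
  "L1_error N \<gamma> t \<equiv> LINT s:{0..t}|lebesgue. norm (step_fun (grid_steps N \<gamma> t) s - g s *\<^sub>R F (t - s))"

text \<open>Rests on x \<le> \<eta> + x^2/\<eta>, which turns an integrable majorant of the squared
  error into an L1 bound with a free parameter \<eta>.\<close>

lemma grid_steps_L1_bound: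
  assumes t: "t \<in> {0..T}" and "0 < N" and \<eta>: "0 < \<eta>"
    and E: "\<And>j s. j < N \<Longrightarrow> s \<in> grid_cell (T / N) j
        \<Longrightarrow> (norm (coef N \<gamma> t j - target t s))\<^sup>2 \<le> E s"
    and i: "integrable \<nu> E" and nn: "\<And>s. 0 \<le> E s"
  shows "(L1_error N \<gamma> t)
    \<le> T * \<eta> + (LINT s|\<nu>. E s) / \<eta>"
proof -
  interpret finite_measure \<nu> by (rule \<nu>_finite)
  have i': "integrable \<nu> (\<lambda>s. \<eta> + E s / \<eta>)" using i by simp
  have "(L1_error N \<gamma> t)
      \<le> (LINT s|lebesgue. indicator {0..T} s *\<^sub>R (\<eta> + E s / \<eta>))"
    unfolding set_lebesgue_integral_def
  proof (rule integral_mono_AE')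
    show "integrable lebesgue (\<lambda>s. indicat_real {0..T} s *\<^sub>R (\<eta> + E s / \<eta>))"
      using i' by (subst (asm) integrable_restrict_space) auto
    have "0 \<le> indicat_real {0..T} s *\<^sub>R (\<eta> + E s / \<eta>)" for s using \<eta> nn[of s] by simp
    then show "AE s in lebesgue. 0 \<le> indicat_real {0..T} s *\<^sub>R (\<eta> + E s / \<eta>)" by (intro AE_I2)
    \<comment> \<open>The point 0 lies in no cell, and at s = t the value of \<open>target\<close>
      is 0 and not that of the integrand.\<close>
    have "AE s in lborel. s \<noteq> 0 \<and> s \<noteq> t" using AE_lborel_singleton[of 0] AE_lborel_singleton[of t] by eventually_elim simp
    then have "AE s in lebesgue. s \<noteq> 0 \<and> s \<noteq> t" by (rule AE_completion)
    then show "AE s in lebesgue. indicat_real {0..t} s *\<^sub>R norm (step_fun (grid_steps N \<gamma> t) s - g s *\<^sub>R F (t - s))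
        \<le> indicat_real {0..T} s *\<^sub>R (\<eta> + E s / \<eta>)"
    proof eventually_elim
      case (elim s)
      show ?case
      proof (cases "s \<in> {0..t}")
        case True
        then have s: "0 < s" "s < t" "s \<le> real N * (T / N)" "s \<in> {0..T}" using elim t \<open>0 < N\<close> by auto
        obtain j where j: "j < N" "s \<in> grid_cell (T / N) j"
          using grid_cell_exists[OF s(1,3)] by blast
        let ?x = "norm (coef N \<gamma> t j - target t s)"
        have "?x \<le> \<eta> + ?x\<^sup>2 / \<eta>"
        proof (cases "?x \<le> \<eta>")
          case True then show ?thesis using \<eta> by (simp add: add_increasing2)
        next
          case False
          then have "?x * \<eta> \<le> ?x * ?x" by (intro mult_left_mono) auto
          then have "?x \<le> ?x\<^sup>2 / \<eta>" using \<eta> by (simp add: field_simps power2_eq_square)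
          then show ?thesis using \<eta> by linarith
        qed
        also have "\<dots> \<le> \<eta> + E s / \<eta>" using E[OF j] \<eta> by (intro add_left_mono divide_right_mono) auto
        finally show ?thesis using step_fun_grid_steps[OF j, of \<gamma> t] True s by (simp add: target_def)
      next
        case False
        have "0 \<le> indicat_real {0..T} s *\<^sub>R (\<eta> + E s / \<eta>)" using \<eta> nn by simp
        then show ?thesis using False by simp
      qed
    qed
  qed
  also have "\<dots> = (LINT s|\<nu>. \<eta> + E s / \<eta>)" by (subst integral_restrict_space) auto
  also have "\<dots> = T * \<eta> + (LINT s|\<nu>. E s) / \<eta>"
  proof -
    have "measure \<nu> (space \<nu>) = T" using T by (simp add: \<nu>_space measure_restrict_space)
    then show ?thesis using i by (simp add: lebesgue_integral_const)
  qed
  finally show ?thesis .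
qed

definition grid_approx :: "nat \<Rightarrow> (real \<Rightarrow> real) \<Rightarrow> real \<Rightarrow> real \<Rightarrow> bool" where
  "grid_approx N \<gamma> \<Gamma> w \<longleftrightarrow> 0 < N \<and> continuous_on {0..T} \<gamma> \<and> (\<forall>x\<in>{0..T}. \<bar>\<gamma> x\<bar> \<le> \<Gamma>) \<and>
     (\<forall>x\<in>{0..T}. \<forall>y\<in>{0..T}. \<bar>x - y\<bar> \<le> T / N \<longrightarrow> \<bar>\<gamma> x - \<gamma> y\<bar> \<le> w)"

lemma grid_approx_coef_error:
  assumes "grid_approx N \<gamma> \<Gamma> w" "t \<in> {0..T}" "j < N" "s \<in> grid_cell (T / N) j"
  shows "(norm (coef N \<gamma> t j - target t s))\<^sup>2 \<le> cell_error N \<gamma> \<Gamma> w t s"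
  using assms unfolding grid_approx_def by (intro coef_error) auto

lemma cell_error_nonneg: "0 \<le> cell_error N \<gamma> \<Gamma> w t s"
  unfolding cell_error_def by (intro add_nonneg_nonneg mult_nonneg_nonneg) auto

lemma grid_steps_L1_tendsto:
  assumes t: "t \<in> {0..T}" and app: "\<And>n. grid_approx (N n) (\<gamma> n) (\<Gamma> n) (w n)"
    and e: "\<And>n. (LINT s|\<nu>. cell_error (N n) (\<gamma> n) (\<Gamma> n) (w n) t s) \<le> e n" "e \<longlonglongrightarrow> 0"
  shows "(\<lambda>n. L1_error (N n) (\<gamma> n) t) \<longlonglongrightarrow> 0"
proof (rule Lim_null_comparison)
  \<comment> \<open>Choosing \<eta> as the square root of the error balances the two terms of the L1
    bound; the summand \<open>(1/2) ^ n\<close> keeps it positive when the error bound is 0.\<close>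
  let ?\<eta> = "\<lambda>n. sqrt (e n + (1/2) ^ n)"
  have e0: "0 \<le> e n" for n
    by (rule order_trans[OF _ e(1)[of n]]) (auto intro: integral_nonneg_AE cell_error_nonneg)
  have \<eta>: "0 < ?\<eta> n" for n using e0[of n] by (simp add: add_nonneg_pos)
  have "norm (L1_error (N n) (\<gamma> n) t) \<le> (T + 1) * ?\<eta> n" for n
  proof -
    have N: "0 < N n" "continuous_on {0..T} (\<gamma> n)" using app[of n] by (auto simp: grid_approx_def)
    have "norm (L1_error (N n) (\<gamma> n) t)
      = (L1_error (N n) (\<gamma> n) t)"
      unfolding set_lebesgue_integral_def real_norm_def by (intro abs_of_nonneg integral_nonneg_AE) auto
    also have "\<dots> \<le> T * ?\<eta> n + (LINT s|\<nu>. cell_error (N n) (\<gamma> n) (\<Gamma> n) (w n) t s) / ?\<eta> n"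
      using app t N \<eta> by (intro grid_steps_L1_bound grid_approx_coef_error cell_error_integral cell_error_nonneg) auto
    also have "(LINT s|\<nu>. cell_error (N n) (\<gamma> n) (\<Gamma> n) (w n) t s) / ?\<eta> n \<le> (e n + (1/2) ^ n) / ?\<eta> n"
      using e(1)[of n] \<eta>[of n] by (intro divide_right_mono) (auto intro: add_increasing2)
    also have "(e n + (1/2) ^ n) / ?\<eta> n = ?\<eta> n"
      using e0[of n] by (intro real_div_sqrt) (simp add: add_nonneg_nonneg)
    finally show ?thesis by (simp add: algebra_simps)
  qed
  then show "\<forall>\<^sub>F n in sequentially. norm (L1_error (N n) (\<gamma> n) t) \<le> (T + 1) * ?\<eta> n" by simp
  have "(\<lambda>n. e n + (1/2) ^ n) \<longlonglongrightarrow> 0 + 0" by (intro tendsto_add e(2) LIMSEQ_power_zero) auto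
  then have "(\<lambda>n. (T + 1) * ?\<eta> n) \<longlonglongrightarrow> (T + 1) * sqrt 0" by (intro tendsto_intros) auto
  then show "(\<lambda>n. (T + 1) * ?\<eta> n) \<longlonglongrightarrow> 0" by simp
qed

text \<open>\<open>N\<close> and \<open>\<gamma>\<close> serve all t at once, whereas the constants
  of the rate may depend on t. The rate gives almost sure and mean-square limits at each t; the L1
  part identifies the integrand.\<close>

definition good_scheme :: "(nat \<Rightarrow> nat) \<Rightarrow> (nat \<Rightarrow> real \<Rightarrow> real) \<Rightarrow> bool" where
  "good_scheme N \<gamma> \<longleftrightarrow> (\<forall>t\<in>{0..T}.
     (\<exists>A q. 0 \<le> q \<and> q < 1 \<and> (\<forall>n. L2_norm M (\<lambda>\<omega>. V (N n) (\<gamma> n) t \<omega> - V (N (Suc n)) (\<gamma> (Suc n)) t \<omega>) \<le> A * q ^ n)) \<and>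
     (\<lambda>n. L1_error (N n) (\<gamma> n) t) \<longlonglongrightarrow> 0)"

text \<open>For H \<ge> 1/2 the mesh exponent in the energy bound is 1, so the bound is the mesh
  times a sum of squares and \<open>coef_diff_sum_le\<close> turns it into integrated
  errors.\<close>

lemma good_scheme_smooth:
  assumes "1/2 \<le> H" shows "\<exists>N \<gamma>. good_scheme N \<gamma>"
proof -
  \<comment> \<open>The requirements on stage n. The bound \<open>\<Gamma>\<close> may grow as
    \<gamma> approaches an unbounded g, so the mesh is made small relative to it. They are shown for
    all large m, because the final m is enlarged later to nest the grids.\<close>
  define P where "P n \<gamma> \<Gamma> m \<longleftrightarrow> grid_approx (2 ^ m) \<gamma> \<Gamma> ((1/2) ^ n) \<and> (LINT s|\<nu>. (\<gamma> s - g s)\<^sup>2) \<le> (1/4) ^ n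
      \<and> 0 \<le> \<Gamma> \<and> \<Gamma> * L * (T / 2 ^ m) \<le> (1/2) ^ n \<and> \<Gamma>\<^sup>2 * (T / 2 ^ m) \<le> (1/4) ^ n"
    for n \<gamma> \<Gamma> and m :: nat
  have "\<exists>x. \<forall>m\<ge>snd (snd x). P n (fst x) (fst (snd x)) m" for n
  proof -
    obtain \<gamma> where \<gamma>: "continuous_on UNIV \<gamma>" "(LINT s|\<nu>. (\<gamma> s - g s)\<^sup>2) \<le> (1/4) ^ n"
      using L2_approx_continuous[OF g, of "(1/4) ^ n"] by auto
    have \<gamma>c: "continuous_on {0..T} \<gamma>" using \<gamma>(1) by (rule continuous_on_subset) simp
    obtain \<Gamma>0 where \<Gamma>0: "\<And>s. s \<in> {0..T} \<Longrightarrow> norm (\<gamma> s) \<le> \<Gamma>0"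
      using continuous_on_Icc_norm_bounded[OF \<gamma>c] by blast
    define \<Gamma> where "\<Gamma> = \<bar>\<Gamma>0\<bar>"
    have \<Gamma>: "\<bar>\<gamma> s\<bar> \<le> \<Gamma>" if "s \<in> {0..T}" for s using \<Gamma>0[OF that] by (simp add: \<Gamma>_def)
    have "uniformly_continuous_on {0..T} \<gamma>" using \<gamma>c by (rule compact_uniformly_continuous) simp
    moreover have "0 < (1/2::real) ^ n" by simp
    ultimately obtain d where d: "0 < d" "\<And>x y. x \<in> {0..T} \<Longrightarrow> y \<in> {0..T} \<Longrightarrow> dist y x < d \<Longrightarrow> dist (\<gamma> y) (\<gamma> x) < (1/2) ^ n"
      unfolding uniformly_continuous_on_def by blast
    have T2: "(\<lambda>m. T / 2 ^ m) \<longlonglongrightarrow> 0"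
      using LIMSEQ_divide_realpow_zero[of 2 T] by simp
    have "\<forall>\<^sub>F m in sequentially. T / 2 ^ m < d" using T2 d(1) by (rule order_tendstoD)
    moreover have "\<forall>\<^sub>F m in sequentially. \<Gamma> * L * (T / 2 ^ m) < (1/2) ^ n"
      by (rule order_tendstoD(2)[OF tendsto_mult_right_zero[OF T2]]) simp
    moreover have "\<forall>\<^sub>F m in sequentially. \<Gamma>\<^sup>2 * (T / 2 ^ m) < (1/4) ^ n"
      by (rule order_tendstoD(2)[OF tendsto_mult_right_zero[OF T2]]) simp
    ultimately have "\<forall>\<^sub>F m in sequentially. T / 2 ^ m < d \<and> \<Gamma> * L * (T / 2 ^ m) < (1/2) ^ n \<and> \<Gamma>\<^sup>2 * (T / 2 ^ m) < (1/4) ^ n"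
      by eventually_elim simp
    then obtain m0 where m0: "\<And>m. m \<ge> m0 \<Longrightarrow> T / 2 ^ m < d \<and> \<Gamma> * L * (T / 2 ^ m) < (1/2) ^ n \<and> \<Gamma>\<^sup>2 * (T / 2 ^ m) < (1/4) ^ n"
      unfolding eventually_sequentially by blast
    have "grid_approx (2 ^ m) \<gamma> \<Gamma> ((1/2) ^ n)" if m: "m \<ge> m0" for m
      unfolding grid_approx_def
    proof (intro conjI ballI impI)
      fix x y assume xy: "x \<in> {0..T}" "y \<in> {0..T}" "\<bar>x - y\<bar> \<le> T / real (2 ^ m)"
      then have "dist x y < d" using m0[OF m] by (simp add: dist_real_def)
      then show "\<bar>\<gamma> x - \<gamma> y\<bar> \<le> (1/2) ^ n" using d(2)[OF xy(2,1)] by (simp add: dist_real_def)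
    qed (use \<gamma>c \<Gamma> in auto)
    then have "\<forall>m\<ge>m0. P n \<gamma> \<Gamma> m"
      using m0 \<gamma>(2) by (auto simp: P_def \<Gamma>_def less_imp_le)
    then show ?thesis by (intro exI[of _ "(\<gamma>, \<Gamma>, m0)"]) simp
  qed
  then have "\<forall>n. \<exists>x. \<forall>m\<ge>snd (snd x). P n (fst x) (fst (snd x)) m" by (rule allI)
  from choice[OF this] obtain x where x: "\<forall>n. \<forall>m\<ge>snd (snd (x n)). P n (fst (x n)) (fst (snd (x n))) m" by (rule exE)
  define \<gamma> \<Gamma> m0 where "\<gamma> n = fst (x n)" and "\<Gamma> n = fst (snd (x n))" and "m0 n = snd (snd (x n))" for n
  have app: "grid_approx (2 ^ m) (\<gamma> n) (\<Gamma> n) ((1/2) ^ n) \<and> (LINT s|\<nu>. (\<gamma> n s - g s)\<^sup>2) \<le> (1/4) ^ n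
      \<and> 0 \<le> (\<Gamma> n) \<and> (\<Gamma> n) * L * (T / 2 ^ m) \<le> (1/2) ^ n \<and> (\<Gamma> n)\<^sup>2 * (T / 2 ^ m) \<le> (1/4) ^ n" if "m0 n \<le> m" for n m
    using x that unfolding P_def \<gamma>_def \<Gamma>_def m0_def by blast
  \<comment> \<open>Partial sums of the thresholds: \<open>m n\<close> is at least
    \<open>m0 n\<close>, and each grid refines the previous one by the factor
    \<open>2 ^ m0 (Suc n)\<close>.\<close>
  define m where "m n = (\<Sum>k\<le>n. m0 k)" for n
  define N where "N n = (2::nat) ^ m n" for n
  have m: "m n \<ge> m0 n" for n unfolding m_def by (intro member_le_sum) auto
  have Nk: "N (Suc n) = N n * 2 ^ m0 (Suc n)" for n by (simp add: N_def m_def power_add)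
  have ga: "grid_approx (N n) (\<gamma> n) (\<Gamma> n) ((1/2) ^ n)" for n using app[OF m] by (simp add: N_def)
  \<comment> \<open>Twice \<open>2 * C\<^sup>2\<close>, from the approximation of g and from the
    cell reaching t, plus the contribution of the variation within cells.\<close>
  define A where "A = 4 * C\<^sup>2 + 2 * T * (1 + C)\<^sup>2"
  have A0: "0 \<le> A" using T by (simp add: A_def)
  let ?E = "\<lambda>n. cell_error (N n) (\<gamma> n) (\<Gamma> n) ((1/2) ^ n)"
  have Ei: "integrable \<nu> (?E n t)" if "t \<in> {0..T}" for n t
    using ga[of n] that by (intro cell_error_integral) (auto simp: grid_approx_def)
  have E: "(LINT s|\<nu>. ?E n t s) \<le> A * (1/4) ^ n" if t: "t \<in> {0..T}" for n t
  proof -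
    note b = app[OF m[of n]]
    have "(LINT s|\<nu>. ?E n t s) \<le> 2 * C\<^sup>2 * (LINT s|\<nu>. (\<gamma> n s - g s)\<^sup>2)
        + 2 * T * (\<Gamma> n * L * (T / N n) + (1/2) ^ n * C)\<^sup>2 + 2 * (C * \<Gamma> n)\<^sup>2 * (T / N n)"
      using ga[of n] t by (intro cell_error_integral) (auto simp: grid_approx_def)
    also have "\<dots> \<le> 2 * C\<^sup>2 * (1/4) ^ n + 2 * T * ((1/2) ^ n + (1/2) ^ n * C)\<^sup>2 + 2 * C\<^sup>2 * (1/4) ^ n"
    proof (intro add_mono mult_left_mono power_mono)
      show "\<Gamma> n * L * (T / real (N n)) \<le> (1/2) ^ n" using b by (simp add: N_def)
      show "0 \<le> \<Gamma> n * L * (T / real (N n)) + (1/2) ^ n * C" using b L(1) C(1) T by (simp add: N_def)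
      have "C\<^sup>2 * ((\<Gamma> n)\<^sup>2 * (T / 2 ^ m n)) \<le> C\<^sup>2 * (1/4) ^ n" using b by (intro mult_left_mono) auto
      then show "2 * (C * \<Gamma> n)\<^sup>2 * (T / real (N n)) \<le> 2 * C\<^sup>2 * (1/4) ^ n"
        by (simp add: N_def power_mult_distrib)
    qed (use b T in auto)
    also have "\<dots> = A * (1/4) ^ n"
    proof -
      have "((1/2::real) ^ n)\<^sup>2 = (1/4) ^ n" by (simp add: power2_eq_square flip: power_mult_distrib)
      moreover have "((1/2) ^ n + (1/2) ^ n * C)\<^sup>2 = ((1/2) ^ n)\<^sup>2 * (1 + C)\<^sup>2"
        by (simp add: power_mult_distrib[symmetric] algebra_simps)
      ultimately show ?thesis by (simp add: A_def algebra_simps)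
    qed
    finally show ?thesis .
  qed
  define K where "K = max 2 (2 * H * T powr (2 * H - 1))"
  have K0: "0 \<le> K" by (simp add: K_def)
  have rate: "L2_norm M (\<lambda>\<omega>. V (N n) (\<gamma> n) t \<omega> - V (N (Suc n)) (\<gamma> (Suc n)) t \<omega>) \<le> sqrt (4 * K * A) * (1/2) ^ n"
    if t: "t \<in> {0..T}" for n t
  proof (rule power2_le_imp_le)
    let ?k = "(2::nat) ^ m0 (Suc n)"
    let ?\<Sigma> = "\<Sum>j<N n * ?k. (norm (coef (N n) (\<gamma> n) t (j div ?k) - coef (N n * ?k) (\<gamma> (Suc n)) t j))\<^sup>2"
    have Np: "0 < N n" by (simp add: N_def)
    have "(L2_norm M (\<lambda>\<omega>. V (N n) (\<gamma> n) t \<omega> - V (N n * ?k) (\<gamma> (Suc n)) t \<omega>))\<^sup>2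
        \<le> K * (T / real (N n * ?k)) powr (min 1 (2 * H)) * ?\<Sigma>"
      unfolding K_def by (rule V_diff_energy) (use Np in auto)
    moreover have "(T / real (N n * ?k)) powr (min 1 (2 * H)) = T / real (N n * ?k)"
    proof -
      have "min 1 (2 * H) = 1" using assms by simp
      then show ?thesis using T by (simp only: powr_one zero_le_divide_iff of_nat_0_le_iff less_imp_le simp_thms)
    qed
    ultimately have "(L2_norm M (\<lambda>\<omega>. V (N n) (\<gamma> n) t \<omega> - V (N n * ?k) (\<gamma> (Suc n)) t \<omega>))\<^sup>2
        \<le> K * (T / real (N n * ?k) * ?\<Sigma>)" by (simp only: mult.assoc)
    also have "\<dots> \<le> K * (2 * (LINT s|\<nu>. ?E n t s) + 2 * (LINT s|\<nu>. ?E (Suc n) t s))"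
      unfolding Nk
      by (intro mult_left_mono K0 coef_diff_sum_le[OF _ Np grid_approx_coef_error[OF ga[of n] t]
            grid_approx_coef_error[OF ga[of "Suc n", unfolded Nk] t] Ei[OF t]
            Ei[OF t, of "Suc n", unfolded Nk] cell_error_nonneg cell_error_nonneg]) simp
    also have "\<dots> \<le> K * (2 * (A * (1/4) ^ n) + 2 * (A * (1/4) ^ Suc n))"
      using E[OF t, of n] E[OF t, of "Suc n"] K0 by (intro mult_left_mono add_mono) auto
    also have "\<dots> \<le> K * (4 * A * (1/4) ^ n)"
      using K0 A0 by (intro mult_left_mono) (auto simp: algebra_simps)
    also have "\<dots> = (sqrt (4 * K * A) * (1/2) ^ n)\<^sup>2"
    proof -
      have "((1/2::real) ^ n)\<^sup>2 = (1/4) ^ n" by (simp add: power2_eq_square flip: power_mult_distrib)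
      then show ?thesis using K0 A0 by (simp add: power_mult_distrib)
    qed
    finally show "(L2_norm M (\<lambda>\<omega>. V (N n) (\<gamma> n) t \<omega> - V (N (Suc n)) (\<gamma> (Suc n)) t \<omega>))\<^sup>2 \<le> (sqrt (4 * K * A) * (1/2) ^ n)\<^sup>2"
      by (simp add: Nk)
  qed (use K0 A0 in simp)
  have "good_scheme N \<gamma>"
    unfolding good_scheme_def
  proof (intro ballI conjI)
    fix t assume t: "t \<in> {0..T}"
    show "\<exists>A q. 0 \<le> q \<and> q < 1 \<and> (\<forall>n. L2_norm M (\<lambda>\<omega>. V (N n) (\<gamma> n) t \<omega> - V (N (Suc n)) (\<gamma> (Suc n)) t \<omega>) \<le> A * q ^ n)"
      using rate[OF t] by (intro exI[of _ "sqrt (4 * K * A)"] exI[of _ "1/2"]) auto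
    have "(\<lambda>n. A * (1/4) ^ n) \<longlonglongrightarrow> 0" by (intro tendsto_mult_right_zero LIMSEQ_power_zero) auto
    then show "(\<lambda>n. L1_error (N n) (\<gamma> n) t) \<longlonglongrightarrow> 0"
      by (rule grid_steps_L1_tendsto[OF t ga E[OF t]])
  qed
  then show ?thesis by blast
qed

end

section \<open>The dyadic scheme for Hurst index below 1/2\<close>

lemma holder_on_lower_exponent:
  assumes "holder_on {0..T} \<rho> g" "\<rho>' \<le> \<rho>" "0 < \<rho>'"
  obtains K where "0 \<le> K"
    "\<And>s t. s \<in> {0..T} \<Longrightarrow> t \<in> {0..T} \<Longrightarrow> \<bar>g s - g t\<bar> \<le> K * \<bar>s - t\<bar> powr \<rho>'"
proof -
  obtain K0 where K0: "\<And>s t. s \<in> {0..T} \<Longrightarrow> t \<in> {0..T} \<Longrightarrow> \<bar>g s - g t\<bar> \<le> K0 * \<bar>s - t\<bar> powr \<rho>"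
    using assms(1) unfolding holder_on_def by blast
  have le: "\<bar>g s - g t\<bar> \<le> \<bar>K0\<bar> * T powr (\<rho> - \<rho>') * \<bar>s - t\<bar> powr \<rho>'" if st: "s \<in> {0..T}" "t \<in> {0..T}" for s t
  proof (cases "s = t")
    case False
    have "\<bar>s - t\<bar> powr \<rho> = \<bar>s - t\<bar> powr (\<rho> - \<rho>') * \<bar>s - t\<bar> powr \<rho>'"
      using False by (simp flip: powr_add)
    moreover have "\<bar>s - t\<bar> powr (\<rho> - \<rho>') \<le> T powr (\<rho> - \<rho>')"
      using st assms by (intro powr_mono2) auto
    ultimately have p: "\<bar>s - t\<bar> powr \<rho> \<le> T powr (\<rho> - \<rho>') * \<bar>s - t\<bar> powr \<rho>'"
      by (simp add: mult_right_mono)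
    have "\<bar>g s - g t\<bar> \<le> K0 * \<bar>s - t\<bar> powr \<rho>" using st by (rule K0)
    also have "\<dots> \<le> \<bar>K0\<bar> * \<bar>s - t\<bar> powr \<rho>" by (intro mult_right_mono) auto
    also have "\<dots> \<le> \<bar>K0\<bar> * (T powr (\<rho> - \<rho>') * \<bar>s - t\<bar> powr \<rho>')" using p by (intro mult_left_mono) auto
    finally show ?thesis by (simp add: mult.assoc)
  qed simp
  show thesis by (rule that[OF _ le]) auto
qed

lemma continuous_on_of_modulus:
  fixes g :: "real \<Rightarrow> real"
  assumes "0 < \<rho>" "\<And>s t. s \<in> A \<Longrightarrow> t \<in> A \<Longrightarrow> \<bar>g s - g t\<bar> \<le> K * \<bar>s - t\<bar> powr \<rho>"
  shows "continuous_on A g"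
  unfolding continuous_on_def
proof
  fix t assume t: "t \<in> A"
  have "continuous_on UNIV (\<lambda>s. K * \<bar>s - t\<bar> powr \<rho>)"
    using assms(1) by (intro continuous_on_mult continuous_on_const continuous_abs_powr continuous_on_diff continuous_on_id)
  then have "((\<lambda>s. K * \<bar>s - t\<bar> powr \<rho>) \<longlongrightarrow> K * \<bar>t - t\<bar> powr \<rho>) (at t)"
    unfolding continuous_on_eq_continuous_at[OF open_UNIV] isCont_def by blast
  then have "((\<lambda>s. K * \<bar>s - t\<bar> powr \<rho>) \<longlongrightarrow> 0) (at t within A)"
    using assms(1) by (auto intro: tendsto_within_subset)
  then have "((\<lambda>s. g s - g t) \<longlongrightarrow> 0) (at t within A)"
    by (rule Lim_null_comparison[rotated]) (use assms(2) t in \<open>auto simp: eventually_at_filter\<close>)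
  then show "(g \<longlongrightarrow> g t) (at t within A)" by (rule LIM_zero_cancel)
qed

context stoch_convolution
begin

text \<open>For even j the fine and the coarse cell have the same left end, so the coefficients can
  differ only through the cutoff: the coarse cell ends one step later, which matters only if t lies
  in the next fine cell. For odd j the right ends, and with them the cutoffs, agree, and the samples
  are one step apart; there the regularity of g and F is used. The Lipschitz error \<delta> is
  written as a power \<rho> of \<delta> at the price of \<open>T powr (1 - \<rho>)\<close>.\<close>

lemma dyadic_coef_diff:
  assumes N: "0 < N" and j: "j < N * 2" and t: "t \<in> {0..T}" and \<rho>: "\<rho> \<le> 1"
    and \<Gamma>: "\<And>x. x \<in> {0..T} \<Longrightarrow> \<bar>g x\<bar> \<le> \<Gamma>"
    and K: "0 \<le> K" "\<And>x y. x \<in> {0..T} \<Longrightarrow> y \<in> {0..T} \<Longrightarrow> \<bar>g x - g y\<bar> \<le> K * \<bar>x - y\<bar> powr \<rho>"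
    and \<delta>_def: "\<delta> = T / real (N * 2)"
  shows "(norm (coef N g t (j div 2) - coef (N * 2) g t j))\<^sup>2
    \<le> ((K * C + \<Gamma> * L * T powr (1 - \<rho>)) * \<delta> powr \<rho>)\<^sup>2
      + (if t \<in> grid_cell \<delta> (Suc j) then (C * \<Gamma>)\<^sup>2 else 0)"
proof -
  have \<delta>: "0 < \<delta>" "T / N = 2 * \<delta>" "real (N * 2) * \<delta> = T" using T N by (auto simp: \<delta>_def)
  have "real (Suc j) * \<delta> \<le> real (N * 2) * \<delta>" using j \<delta>(1) by (intro mult_right_mono) auto
  then have jT: "real (Suc j) * \<delta> \<le> T" unfolding \<delta>(3) .
  have j0: "0 \<le> real j * \<delta>" and jS: "real (Suc j) * \<delta> = real j * \<delta> + \<delta>" "real (Suc (Suc j)) * \<delta> = real j * \<delta> + 2 * \<delta>"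
    using \<delta>(1) by (simp_all add: algebra_simps)
  have \<Gamma>0: "0 \<le> \<Gamma>" using \<Gamma>[of 0] T by auto
  have \<delta>T: "\<delta> \<le> T" using jT jS j0 by linarith
  have c2: "coef (N * 2) g t j = (if real j * \<delta> + \<delta> < t then g (real j * \<delta>) *\<^sub>R F (t - real j * \<delta>) else 0)"
    unfolding coef_def \<delta>_def[symmetric] jS ..
  let ?D = "(K * C + \<Gamma> * L * T powr (1 - \<rho>)) * \<delta> powr \<rho>"
  show ?thesis
  proof (cases "even j")
    case True
    then obtain i where i: "j = 2 * i" by blast
    have e: "real i * (T / N) = real j * \<delta>" "real (Suc i) * (T / N) = real j * \<delta> + 2 * \<delta>"
      unfolding \<delta>(2) i by (simp_all add: algebra_simps)
    have c1: "coef N g t (j div 2) = (if real j * \<delta> + 2 * \<delta> < t then g (real j * \<delta>) *\<^sub>R F (t - real j * \<delta>) else 0)"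
    proof -
      have "j div 2 = i" using i by simp
      then show ?thesis by (simp only: coef_def e)
    qed
    show ?thesis
    proof (cases "real j * \<delta> + \<delta> < t \<and> t \<le> real j * \<delta> + 2 * \<delta>")
      case True
      then have "norm (coef N g t (j div 2) - coef (N * 2) g t j) = \<bar>g (real j * \<delta>)\<bar> * norm (F (t - real j * \<delta>))"
        unfolding c1 c2 by simp
      also have "\<dots> \<le> \<Gamma> * C"
      proof (intro mult_mono \<Gamma> C \<Gamma>0 norm_ge_zero)
        show "real j * \<delta> \<in> {0..T}" "t - real j * \<delta> \<in> {0..T}"
          using conjunct1[OF True] conjunct2[OF True] j0 t \<delta>(1) unfolding atLeastAtMost_iff by linarith+
      qed
      finally have "(norm (coef N g t (j div 2) - coef (N * 2) g t j))\<^sup>2 \<le> (C * \<Gamma>)\<^sup>2"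
        by (intro power_mono) (auto simp: mult.commute)
      moreover have "t \<in> grid_cell \<delta> (Suc j)" using True unfolding jS by simp
      ultimately show ?thesis using zero_le_power2[of ?D] by (simp only: if_True)
    next
      case False
      then have "coef N g t (j div 2) = coef (N * 2) g t j" unfolding c1 c2 using \<delta>(1) by auto
      then show ?thesis by simp
    qed
  next
    case False
    then obtain i where i: "j = 2 * i + 1" by (elim oddE)
    have e: "real i * (T / N) = real j * \<delta> - \<delta>" "real (Suc i) * (T / N) = real j * \<delta> + \<delta>"
      unfolding \<delta>(2) i by (simp_all add: algebra_simps)
    have c1: "coef N g t (j div 2)
        = (if real j * \<delta> + \<delta> < t then g (real j * \<delta> - \<delta>) *\<^sub>R F (t - (real j * \<delta> - \<delta>)) else 0)"
    proof -
      have "j div 2 = i" using i by simp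
      then show ?thesis by (simp only: coef_def e)
    qed
    have "1 \<le> real j" using i by simp
    then have j1: "\<delta> \<le> real j * \<delta>" using \<delta>(1) by simp
    have D0: "0 \<le> ?D" using K(1) C(1) \<Gamma>0 L(1) by (intro mult_nonneg_nonneg add_nonneg_nonneg) auto
    have "norm (coef N g t (j div 2) - coef (N * 2) g t j) \<le> ?D"
    proof (cases "real j * \<delta> + \<delta> < t")
      case True
      let ?a = "real j * \<delta> - \<delta>" and ?b = "real j * \<delta>"
      have r: "?a \<in> {0..T}" "?b \<in> {0..T}" "t - ?a \<in> {0..T}" "t - ?b \<in> {0..T}"
        using True j0 j1 t \<delta>(1) unfolding atLeastAtMost_iff by linarith+
      have "coef N g t (j div 2) - coef (N * 2) g t j = (g ?a - g ?b) *\<^sub>R F (t - ?a) + g ?b *\<^sub>R (F (t - ?a) - F (t - ?b))"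
        unfolding c1 c2 using True by (simp add: scaleR_diff_left scaleR_diff_right)
      then have "norm (coef N g t (j div 2) - coef (N * 2) g t j)
          \<le> \<bar>g ?a - g ?b\<bar> * norm (F (t - ?a)) + \<bar>g ?b\<bar> * norm (F (t - ?a) - F (t - ?b))"
        by (metis norm_triangle_ineq norm_scaleR)
      also have "\<dots> \<le> (K * \<delta> powr \<rho>) * C + \<Gamma> * (L * \<delta>)"
      proof (intro add_mono mult_mono C \<Gamma> r)
        show "\<bar>g ?a - g ?b\<bar> \<le> K * \<delta> powr \<rho>" using K(2)[OF r(1,2)] \<delta>(1) by simp
        show "norm (F (t - ?a) - F (t - ?b)) \<le> L * \<delta>" using L(2)[OF r(3,4)] \<delta>(1) by simp
      qed (use K(1) \<Gamma>0 in auto)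
      also have "\<dots> \<le> (K * \<delta> powr \<rho>) * C + \<Gamma> * (L * (T powr (1 - \<rho>) * \<delta> powr \<rho>))"
      proof -
        have "\<delta> = \<delta> powr (1 - \<rho>) * \<delta> powr \<rho>" using \<delta>(1) by (simp flip: powr_add)
        also have "\<dots> \<le> T powr (1 - \<rho>) * \<delta> powr \<rho>"
          using \<delta>(1) \<delta>T \<rho> by (intro mult_right_mono powr_mono2) auto
        finally show ?thesis using \<Gamma>0 L(1) by (intro add_left_mono mult_left_mono) auto
      qed
      also have "\<dots> = ?D" by (simp add: algebra_simps)
      finally show ?thesis .
    next
      case False
      then show ?thesis unfolding c1 c2 using D0 by simp
    qed
    then have "(norm (coef N g t (j div 2) - coef (N * 2) g t j))\<^sup>2 \<le> ?D\<^sup>2" by (intro power_mono) auto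
    then show ?thesis by (auto intro: add_increasing2)
  qed
qed

text \<open>t lies in at most one cell, so the cutoff contributes one term only. As the number of
  cells is T/\<delta>, multiplication by \<delta> to the power 2H gives the exponents 2\<rho> + 2H -
  1 and 2H.\<close>

lemma dyadic_coef_diff_sum:
  assumes N: "0 < N" and t: "t \<in> {0..T}" and \<rho>: "\<rho> \<le> 1"
    and \<Gamma>: "\<And>x. x \<in> {0..T} \<Longrightarrow> \<bar>g x\<bar> \<le> \<Gamma>"
    and K: "0 \<le> K" "\<And>x y. x \<in> {0..T} \<Longrightarrow> y \<in> {0..T} \<Longrightarrow> \<bar>g x - g y\<bar> \<le> K * \<bar>x - y\<bar> powr \<rho>"
    and \<delta>_def: "\<delta> = T / real (N * 2)"
  shows "(\<Sum>j<N * 2. (norm (coef N g t (j div 2) - coef (N * 2) g t j))\<^sup>2)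
    \<le> real (N * 2) * ((K * C + \<Gamma> * L * T powr (1 - \<rho>)) * \<delta> powr \<rho>)\<^sup>2 + (C * \<Gamma>)\<^sup>2"
proof -
  let ?D = "(K * C + \<Gamma> * L * T powr (1 - \<rho>)) * \<delta> powr \<rho>"
  have \<delta>: "0 < \<delta>" using T N by (simp add: \<delta>_def)
  let ?J = "{j. j < N * 2 \<and> t \<in> grid_cell \<delta> (Suc j)}"
  have "card ?J \<le> 1"
  proof (rule card_le_Suc0_iff_eq[THEN iffD2, unfolded One_nat_def[symmetric]], simp, intro ballI)
    fix i j assume "i \<in> ?J" "j \<in> ?J"
    then show "i = j" using grid_cell_unique[OF \<delta>, of t "Suc i" "Suc j"] by blast
  qed
  then have card: "real (card ?J) \<le> 1" by simp
  have "(\<Sum>j<N * 2. (norm (coef N g t (j div 2) - coef (N * 2) g t j))\<^sup>2)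
      \<le> (\<Sum>j<N * 2. ?D\<^sup>2 + (if t \<in> grid_cell \<delta> (Suc j) then (C * \<Gamma>)\<^sup>2 else 0))"
    using dyadic_coef_diff[OF N _ t \<rho> \<Gamma> K \<delta>_def] by (intro sum_mono) blast
  also have "\<dots> = real (N * 2) * ?D\<^sup>2
      + (\<Sum>j<N * 2. if t \<in> grid_cell \<delta> (Suc j) then (C * \<Gamma>)\<^sup>2 else 0)"
    by (simp only: sum.distrib sum_constant card_lessThan)
  also have "(\<Sum>j<N * 2. if t \<in> grid_cell \<delta> (Suc j) then (C * \<Gamma>)\<^sup>2 else 0)
      = real (card ?J) * (C * \<Gamma>)\<^sup>2"
  proof -
    have "{..<N * 2} \<inter> {j. t \<in> grid_cell \<delta> (Suc j)} = ?J" by auto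
    then show ?thesis by (simp only: sum.If_cases finite_lessThan sum.neutral_const add_0_right sum_constant)
  qed
  also have "real (card ?J) * (C * \<Gamma>)\<^sup>2 \<le> 1 * (C * \<Gamma>)\<^sup>2" using card by (intro mult_right_mono) auto
  finally show ?thesis by simp
qed

text \<open>Here g itself is sampled. For H < 1/2 the energy bound is \<delta> to the power 2H - 1
  times a discrete L2 norm, and closeness in mean square does not offset this factor; the regularity
  of g does.\<close>

lemma good_scheme_rough:
  assumes "H < 1/2" "1/2 - H < \<rho>" "holder_on {0..T} \<rho> g"
  shows "good_scheme (\<lambda>n. 2 ^ n) (\<lambda>n. g)"
proof -
  \<comment> \<open>The given exponent may exceed 1, whereas \<open>dyadic_coef_diff\<close> needs
    one that is at most 1. As 1/2 - H < 1, the minimum still lies above the threshold.\<close>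
  define \<sigma> where "\<sigma> = min \<rho> 1"
  have \<sigma>: "0 < \<sigma>" "\<sigma> \<le> 1" "\<sigma> \<le> \<rho>" "1/2 - H < \<sigma>" using assms H by (auto simp: \<sigma>_def)
  obtain Q where Q: "0 \<le> Q" "\<And>s t. s \<in> {0..T} \<Longrightarrow> t \<in> {0..T} \<Longrightarrow> \<bar>g s - g t\<bar> \<le> Q * \<bar>s - t\<bar> powr \<sigma>"
    using holder_on_lower_exponent[OF assms(3) \<sigma>(3,1)] by metis
  have gc: "continuous_on {0..T} g" by (rule continuous_on_of_modulus[OF \<sigma>(1) Q(2)])
  obtain \<Gamma>0 where \<Gamma>0: "\<And>s. s \<in> {0..T} \<Longrightarrow> norm (g s) \<le> \<Gamma>0"
    using continuous_on_Icc_norm_bounded[OF gc] by blast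
  define \<Gamma> where "\<Gamma> = \<bar>\<Gamma>0\<bar>"
  have \<Gamma>: "\<bar>g s\<bar> \<le> \<Gamma>" if "s \<in> {0..T}" for s using \<Gamma>0[OF that] by (simp add: \<Gamma>_def)
  define w where "w n = Q * (T / 2 ^ n) powr \<sigma>" for n :: nat
  have ga: "grid_approx (2 ^ n) g \<Gamma> (w n)" for n
    unfolding grid_approx_def
  proof (intro conjI ballI impI gc \<Gamma>)
    fix x y assume xy: "x \<in> {0..T}" "y \<in> {0..T}" "\<bar>x - y\<bar> \<le> T / real (2 ^ n)"
    have "\<bar>x - y\<bar> powr \<sigma> \<le> (T / 2 ^ n) powr \<sigma>" using xy(3) \<sigma>(1) by (intro powr_mono2) auto
    then show "\<bar>g x - g y\<bar> \<le> w n"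
      unfolding w_def using Q(2)[OF xy(1,2)] mult_left_mono[OF _ Q(1)] by fastforce
  qed auto
  define e where "e n = 2 * T * (\<Gamma> * L * (T / 2 ^ n) + w n * C)\<^sup>2 + 2 * (C * \<Gamma>)\<^sup>2 * (T / 2 ^ n)" for n :: nat
  have E: "(LINT s|\<nu>. cell_error (2 ^ n) g \<Gamma> (w n) t s) \<le> e n" if "t \<in> {0..T}" for n t
    using cell_error_integral(2)[OF gc that, of "2 ^ n" \<Gamma> "w n"] by (simp add: e_def)
  have T2: "(\<lambda>m. T / 2 ^ m) \<longlonglongrightarrow> 0" using LIMSEQ_divide_realpow_zero[of 2 T] by simp
  have "(\<lambda>n. \<bar>T / 2 ^ n\<bar> powr \<sigma>) \<longlonglongrightarrow> \<bar>0\<bar> powr \<sigma>"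
    by (rule continuous_on_tendsto_compose[OF continuous_abs_powr[OF \<sigma>(1) continuous_on_id] T2, of UNIV]) auto
  then have "(\<lambda>n. (T / 2 ^ n) powr \<sigma>) \<longlonglongrightarrow> 0" using T \<sigma>(1) by simp
  then have w0: "w \<longlonglongrightarrow> 0" unfolding w_def by (rule tendsto_mult_right_zero)
  have "e \<longlonglongrightarrow> 2 * T * (\<Gamma> * L * 0 + 0 * C)\<^sup>2 + 2 * (C * \<Gamma>)\<^sup>2 * 0"
    unfolding e_def by (intro tendsto_intros T2 w0)
  then have e0: "e \<longlonglongrightarrow> 0" by simp
  define K where "K = max 2 (2 * H * T powr (2 * H - 1))"
  have K0: "0 \<le> K" by (simp add: K_def)
  define D where "D = Q * C + \<Gamma> * L * T powr (1 - \<sigma>)"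
  \<comment> \<open>The smaller of the two exponents of the mesh; the first is positive because
    \<sigma> > 1/2 - H.\<close>
  define a where "a = min (2 * \<sigma> + 2 * H - 1) (2 * H)"
  have a: "0 < a" using \<sigma> H by (auto simp: a_def)
  define r where "r = (1/2::real) powr a"
  have r: "0 < r" "r < 1" using a gr_one_powr[of 2 a] by (auto simp: r_def powr_divide)
  define A where "A = K * (D\<^sup>2 * T powr (2 * H + 2 * \<sigma>) + (C * \<Gamma>)\<^sup>2 * T powr (2 * H))"
  have A0: "0 \<le> A" using K0 by (simp add: A_def)
  have rate: "L2_norm M (\<lambda>\<omega>. V (2 ^ n) g t \<omega> - V (2 ^ Suc n) g t \<omega>) \<le> sqrt A * sqrt r ^ n"
    if t: "t \<in> {0..T}" for n t
  proof (rule power2_le_imp_le)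
    let ?N = "(2::nat) ^ n"
    \<comment> \<open>The finer mesh relative to T. As x \<le> 1, lowering both exponents to
      \<open>a\<close> only increases the powers.\<close>
    define x where "x = (1/2::real) ^ Suc n"
    have x: "0 < x" "x \<le> 1" unfolding x_def by (auto simp del: power_Suc intro: power_le_one)
    have Nx: "real (?N * 2) = 1 / x" by (simp add: x_def power_one_over)
    define \<delta> where "\<delta> = T / real (?N * 2)"
    have \<delta>x: "\<delta> = T * x" unfolding \<delta>_def Nx by simp
    have xa: "x powr a \<le> r ^ n"
    proof -
      have "x = (1/2) powr real (Suc n)" unfolding x_def by (rule powr_realpow[symmetric]) simp
      then have "x powr a = r powr real (Suc n)" unfolding r_def by (simp only: powr_powr mult.commute)
      also have "\<dots> = r ^ Suc n" using r(1) by (rule powr_realpow)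
      also have "\<dots> \<le> r ^ n" using r by (intro power_decreasing) auto
      finally show ?thesis .
    qed
    have pw: "\<delta> powr p = T powr p * x powr p" for p unfolding \<delta>x using T x by (intro powr_mult)
    have "(L2_norm M (\<lambda>\<omega>. V ?N g t \<omega> - V (?N * 2) g t \<omega>))\<^sup>2
        \<le> K * \<delta> powr (min 1 (2 * H)) * (\<Sum>j<?N * 2. (norm (coef ?N g t (j div 2) - coef (?N * 2) g t j))\<^sup>2)"
      unfolding K_def \<delta>_def by (rule V_diff_energy) auto
    also have "\<dots> \<le> K * \<delta> powr (min 1 (2 * H)) * (real (?N * 2) * (D * \<delta> powr \<sigma>)\<^sup>2 + (C * \<Gamma>)\<^sup>2)"
      unfolding D_def
      by (intro mult_left_mono mult_nonneg_nonneg K0 dyadic_coef_diff_sum[OF _ t \<sigma>(2) \<Gamma> Q \<delta>_def]) auto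
    also have "\<dots> = K * (D\<^sup>2 * T powr (2 * H + 2 * \<sigma>) * x powr (2 * \<sigma> + 2 * H - 1) + (C * \<Gamma>)\<^sup>2 * T powr (2 * H) * x powr (2 * H))"
    proof -
      have m: "min 1 (2 * H) = 2 * H" using assms(1) by simp
      have s: "(\<delta> powr \<sigma>)\<^sup>2 = T powr (2 * \<sigma>) * x powr (2 * \<sigma>)"
        unfolding pw mult_2 powr_add power2_eq_square by (simp only: mult_ac)
      have "x powr (2 * \<sigma> + 2 * H - 1) = x powr (2 * \<sigma>) * x powr (2 * H) / x"
        using x by (simp add: powr_diff powr_add)
      moreover have "T powr (2 * H + 2 * \<sigma>) = T powr (2 * H) * T powr (2 * \<sigma>)" by (rule powr_add)
      ultimately show ?thesis
        unfolding m pw[of "2 * H"] power_mult_distrib s Nx by (simp add: distrib_left mult_ac)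
    qed
    also have "\<dots> \<le> K * (D\<^sup>2 * T powr (2 * H + 2 * \<sigma>) * x powr a + (C * \<Gamma>)\<^sup>2 * T powr (2 * H) * x powr a)"
      using x K0 by (intro mult_left_mono add_mono powr_mono') (auto simp: a_def)
    also have "\<dots> = A * x powr a" by (simp add: A_def algebra_simps)
    also have "\<dots> \<le> A * r ^ n" using xa A0 by (rule mult_left_mono)
    also have "\<dots> = (sqrt A * sqrt r ^ n)\<^sup>2"
      using A0 r by (simp add: power_mult_distrib power_mult[symmetric] mult.commute[of n 2]) (simp add: power_mult)
    finally show "(L2_norm M (\<lambda>\<omega>. V (2 ^ n) g t \<omega> - V (2 ^ Suc n) g t \<omega>))\<^sup>2 \<le> (sqrt A * sqrt r ^ n)\<^sup>2"
      by (simp add: mult.commute)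
  qed (use A0 r in simp)
  show ?thesis
    unfolding good_scheme_def
  proof (intro ballI conjI)
    fix t assume t: "t \<in> {0..T}"
    show "\<exists>A q. 0 \<le> q \<and> q < 1 \<and> (\<forall>n. L2_norm M (\<lambda>\<omega>. V (2 ^ n) g t \<omega> - V (2 ^ Suc n) g t \<omega>) \<le> A * q ^ n)"
      using rate[OF t] r by (intro exI[of _ "sqrt A"] exI[of _ "sqrt r"]) auto
    show "(\<lambda>n. L1_error (2 ^ n) g t) \<longlonglongrightarrow> 0"
      by (rule grid_steps_L1_tendsto[OF t ga E[OF t] e0])
  qed
qed

end

section \<open>Predictable versions\<close>

lemma Cauchy_limit_measurable:
  fixes f :: "nat \<Rightarrow> 'x \<Rightarrow> 'e::{real_normed_vector,polish_space}"
  assumes f: "\<And>n. f n \<in> borel_measurable N"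
  shows "(\<lambda>x. if Cauchy (\<lambda>n. f n x) then lim (\<lambda>n. f n x) else 0) \<in> borel_measurable N"
proof (rule borel_measurable_LIMSEQ_metric)
  show "(\<lambda>x. if Cauchy (\<lambda>n. f n x) then f i x else 0) \<in> borel_measurable N" for i
    using sets_Collect_Cauchy[of f, OF f] by (intro measurable_If f) auto
  show "(\<lambda>i. if Cauchy (\<lambda>n. f n x) then f i x else 0) \<longlonglongrightarrow> (if Cauchy (\<lambda>n. f n x) then lim (\<lambda>n. f n x) else 0)" for x
    using Cauchy_convergent[of "\<lambda>n. f n x"] by (simp add: convergent_LIMSEQ_iff)
qed

context stoch_convolution
begin

abbreviation "\<P> \<equiv> predictable_algebra M (generated_filtration M B) T"

lemma filtration_space: "A \<in> generated_filtration M B r \<Longrightarrow> A \<subseteq> space M"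
  unfolding generated_filtration_def by (erule sigma_sets_into_sp[rotated]) auto

lemma predictable_generators:
  "{{0} \<times> A | A. A \<in> generated_filtration M B 0} \<union>
    {{s<..t} \<times> A | s t A. 0 \<le> s \<and> s \<le> t \<and> t \<le> T \<and> A \<in> generated_filtration M B s}
    \<subseteq> Pow ({0..T} \<times> space M)"
  using T by (auto dest: filtration_space)

lemma predictable_space: "space \<P> = {0..T} \<times> space M"
  by (simp add: predictable_algebra_def space_measure_of_conv)

lemma predictable_rectangle:
  assumes "0 \<le> r" "r \<le> T" "A \<in> generated_filtration M B r" shows "{r<..T} \<times> A \<in> sets \<P>"
  unfolding predictable_algebra_def sets_measure_of[OF predictable_generators]
  using assms by (intro sigma_sets.Basic) blast

lemma predictable_Ioc: assumes "0 \<le> r" "r \<le> T" shows "{r<..T} \<times> space M \<in> sets \<P>"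
proof (rule predictable_rectangle[OF assms])
  show "space M \<in> generated_filtration M B r"
    unfolding generated_filtration_def by (rule sigma_sets_top)
qed

lemma fst_predictable: "fst \<in> borel_measurable \<P>"
proof (rule borel_measurableI_greater)
  fix y
  consider "y < 0" | "0 \<le> y" "y \<le> T" | "T < y" by linarith
  then show "{x \<in> space \<P>. y < fst x} \<in> sets \<P>"
  proof cases
    case 1
    then have "{x \<in> space \<P>. y < fst x} = space \<P>" by (auto simp: predictable_space)
    then show ?thesis by simp
  next
    case 2
    then have "{x \<in> space \<P>. y < fst x} = {y<..T} \<times> space M" by (auto simp: predictable_space)
    then show ?thesis using predictable_Ioc[OF 2] by simp
  next
    case 3
    then have "{x \<in> space \<P>. y < fst x} = {}" by (auto simp: predictable_space)
    then show ?thesis by (simp only: sets.empty_sets)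
  qed
qed

text \<open>A variable known at time r and switched on strictly after r. Its superlevel sets are
  predictable rectangles; for a negative level the region where the process is 0 is added.\<close>

lemma adapted_predictable:
  assumes r: "0 \<le> r" "r \<le> T" and Y: "\<And>y. {\<omega> \<in> space M. y < Y \<omega>} \<in> generated_filtration M B r"
  shows "(\<lambda>x. indicat_real {r<..T} (fst x) * Y (snd x)) \<in> borel_measurable \<P>"
proof (rule borel_measurableI_greater)
  fix y
  let ?R = "{r<..T} \<times> {\<omega> \<in> space M. y < Y \<omega>}"
  have R: "?R \<in> sets \<P>" by (intro predictable_rectangle r Y)
  show "{x \<in> space \<P>. y < indicat_real {r<..T} (fst x) * Y (snd x)} \<in> sets \<P>"
  proof (cases "y < 0")
    case True
    then have "{x \<in> space \<P>. y < indicat_real {r<..T} (fst x) * Y (snd x)} = ?R \<union> (space \<P> - {r<..T} \<times> space M)"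
      using r by (auto simp: predictable_space split: split_indicator_asm)
    then show ?thesis using R predictable_Ioc[OF r] by auto
  next
    case False
    then have "{x \<in> space \<P>. y < indicat_real {r<..T} (fst x) * Y (snd x)} = ?R"
      using r by (auto simp: predictable_space split: split_indicator_asm)
    then show ?thesis using R by simp
  qed
qed

lemma increment_adapted:
  assumes "0 \<le> l" "l \<le> r" shows "{\<omega> \<in> space M. y < B r \<omega> - B l \<omega>} \<in> generated_filtration M B r"
proof -
  let ?G = "{B s -` X \<inter> space M | s X. 0 \<le> s \<and> s \<le> r \<and> X \<in> sets borel}"
  let ?N = "sigma (space M) ?G"
  have G: "?G \<subseteq> Pow (space M)" by auto
  have sp: "space ?N = space M" by (simp add: space_measure_of_conv)
  have st: "sets ?N = generated_filtration M B r" using G by (simp add: generated_filtration_def sets_measure_of)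
  have B: "B s \<in> borel_measurable ?N" if "0 \<le> s" "s \<le> r" for s
  proof (rule measurableI)
    fix X :: "real set" assume "X \<in> sets borel"
    then show "B s -` X \<inter> space ?N \<in> sets ?N"
      unfolding sp sets_measure_of[OF G] using that by (intro sigma_sets.Basic) blast
  qed simp
  have "(\<lambda>\<omega>. B r \<omega> - B l \<omega>) \<in> borel_measurable ?N" using assms by (intro borel_measurable_diff B) auto
  then have "{\<omega> \<in> space ?N. y < B r \<omega> - B l \<omega>} \<in> sets ?N" by measurable
  then show ?thesis unfolding st sp .
qed

lemma F_continuous: "continuous_on {0..T} F"
proof (rule lipschitz_on_continuous_on)
  show "L-lipschitz_on {0..T} F" using L by (intro lipschitz_onI) (auto simp: dist_norm)
qed

text \<open>Each summand is an increment known at the right end of its cell, switched on strictly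
  afterwards, times a Borel function of t. The strict inequality in \<open>coef\<close> is what
  makes this factorisation possible.\<close>

lemma V_predictable: "(\<lambda>x. V N \<gamma> (fst x) (snd x)) \<in> borel_measurable \<P>"
proof -
  let ?l = "\<lambda>j. real j * (T / N)" and ?r = "\<lambda>j. real (Suc j) * (T / N)"
  \<comment> \<open>Continuity of \<open>F\<close> is known on [0, T] only; the indicator restricts
    t to the times at which the argument lies there.\<close>
  let ?h = "\<lambda>j t. indicat_real {?l j..T} t *\<^sub>R F (t - ?l j)"
  have m: "(\<lambda>x. (indicat_real {?r j<..T} (fst x) * (B (?r j) (snd x) - B (?l j) (snd x)))
      *\<^sub>R (\<gamma> (?l j) *\<^sub>R ?h j (fst x))) \<in> borel_measurable \<P>" if j: "j < N" for j
  proof -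
    have l: "0 \<le> ?l j" "?l j \<le> ?r j" using T by (auto simp only: intro!: mult_right_mono mult_nonneg_nonneg) auto
    have "?r j \<le> real N * (T / N)" using j T by (intro mult_right_mono) auto
    then have r: "?r j \<le> T" using j by simp
    have 1: "(\<lambda>x. indicat_real {?r j<..T} (fst x) * (B (?r j) (snd x) - B (?l j) (snd x))) \<in> borel_measurable \<P>"
      using l r by (intro adapted_predictable increment_adapted) auto
    have "continuous_on {?l j..T} (\<lambda>t. F (t - ?l j))"
      using l by (intro continuous_on_compose2[OF F_continuous] continuous_intros) auto
    then have "?h j \<in> borel_measurable borel" by (intro borel_measurable_continuous_on_indicator) auto
    from measurable_compose[OF fst_predictable this]
    show ?thesis by (rule borel_measurable_scaleR[OF 1 borel_measurable_scaleR[OF borel_measurable_const]])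
  qed
  have eq: "V N \<gamma> (fst x) (snd x) = (\<Sum>j<N. (indicat_real {?r j<..T} (fst x) * (B (?r j) (snd x) - B (?l j) (snd x)))
      *\<^sub>R (\<gamma> (?l j) *\<^sub>R ?h j (fst x)))" if x: "x \<in> space \<P>" for x
    unfolding V_def grid_sum_def
  proof (rule sum.cong[OF refl])
    fix j
    have l: "?l j \<le> ?r j" using T by (intro mult_right_mono) auto
    have t: "fst x \<in> {0..T}" using x by (auto simp: predictable_space)
    show "(B (?r j) (snd x) - B (?l j) (snd x)) *\<^sub>R coef N \<gamma> (fst x) j
      = (indicat_real {?r j<..T} (fst x) * (B (?r j) (snd x) - B (?l j) (snd x))) *\<^sub>R (\<gamma> (?l j) *\<^sub>R ?h j (fst x))"
    proof (cases "?r j < fst x")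
      case True
      then have "fst x \<in> {?r j<..T}" "fst x \<in> {?l j..T}" using t l by auto
      then show ?thesis using True by (simp only: coef_def if_True indicator_simps mult_1 scaleR_one)
    next
      case False
      then have "fst x \<notin> {?r j<..T}" by simp
      then show ?thesis using False by (simp only: coef_def if_False indicator_simps mult_zero_left scaleR_zero_left scaleR_zero_right not_False_eq_True)
    qed
  qed
  show ?thesis
    by (rule iffD2[OF measurable_cong[OF eq] borel_measurable_sum[OF m]]) (simp_all only: lessThan_iff)
qed

text \<open>\<open>W\<close> is defined as a pathwise limit at all (t, \<omega>) together, with
  value 0 where the sequence is not Cauchy, so its predictability is inherited from the grid sums.
  At fixed t the exceptional set is null, and the limit is identified there.\<close>

lemma exists_predictable_wiener_integral:
  assumes scheme: "good_scheme N \<gamma>"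
  obtains W where "(\<lambda>x. W (fst x) (snd x)) \<in> borel_measurable \<P>"
    "\<And>t. t \<in> {0..T} \<Longrightarrow> has_wiener_integral M H B t (\<lambda>s. g s *\<^sub>R F (t - s)) (W t)"
proof -
  let ?V = "\<lambda>n. V (N n) (\<gamma> n)"
  define W where "W t \<omega> = (if Cauchy (\<lambda>n. ?V n t \<omega>) then lim (\<lambda>n. ?V n t \<omega>) else 0)" for t \<omega>
  have "(\<lambda>x. W (fst x) (snd x)) \<in> borel_measurable \<P>"
    unfolding W_def by (rule Cauchy_limit_measurable[OF V_predictable])
  moreover have "has_wiener_integral M H B t (\<lambda>s. g s *\<^sub>R F (t - s)) (W t)" if t: "t \<in> {0..T}" for t
  proof -
    obtain A q where q: "0 \<le> q" "q < 1"
      and rate: "\<And>n. L2_norm M (\<lambda>\<omega>. ?V n t \<omega> - ?V (Suc n) t \<omega>) \<le> A * q ^ n"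
      using scheme t unfolding good_scheme_def by blast
    have L1: "(\<lambda>n. L1_error (N n) (\<gamma> n) t) \<longlonglongrightarrow> 0"
      using scheme t unfolding good_scheme_def by blast
    have Wm: "W t \<in> borel_measurable M"
      unfolding W_def using Cauchy_limit_measurable[of "\<lambda>n. ?V n t" M] V_L2 by (auto dest: L2_D)
    have "AE \<omega> in M. Cauchy (\<lambda>n. ?V n t \<omega>)"
      by (rule L2_geometric_AE_Cauchy[OF V_L2 rate q])
    then have lim: "AE \<omega> in M. (\<lambda>n. ?V n t \<omega>) \<longlonglongrightarrow> W t \<omega>"
    proof eventually_elim
      case (elim \<omega>)
      then show ?case using Cauchy_convergent[OF elim] by (simp add: W_def convergent_LIMSEQ_iff)
    qed
    note W = L2_geometric_limit[OF V_L2 rate q Wm lim]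
    have "H0_represents H t (\<lambda>n. grid_steps (N n) (\<gamma> n) t) (\<lambda>s. g s *\<^sub>R F (t - s))"
      unfolding H0_represents_def
    proof (intro conjI allI impI L1 step_list_grid_steps convolution_integrable[OF g F_continuous t])
      fix \<epsilon> :: real assume "0 < \<epsilon>"
      then have "\<forall>\<^sub>F n in sequentially. L2_norm M (\<lambda>\<omega>. ?V n t \<omega> - W t \<omega>) < \<epsilon> / 2"
        by (intro order_tendstoD(2)[OF W(2)]) simp
      then obtain n0 where n0: "\<And>n. n \<ge> n0 \<Longrightarrow> L2_norm M (\<lambda>\<omega>. ?V n t \<omega> - W t \<omega>) < \<epsilon> / 2"
        by (auto simp: eventually_sequentially)
      have "H0_dist H (grid_steps (N m) (\<gamma> m) t) (grid_steps (N n) (\<gamma> n) t) < \<epsilon>" if "m \<ge> n0" "n \<ge> n0" for m n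
      proof -
        have "H0_dist H (grid_steps (N m) (\<gamma> m) t) (grid_steps (N n) (\<gamma> n) t) = L2_norm M (\<lambda>\<omega>. ?V m t \<omega> - ?V n t \<omega>)"
          unfolding H0_dist_eq[OF step_list_grid_steps step_list_grid_steps] step_integral_grid_steps ..
        also have "\<dots> \<le> L2_norm M (\<lambda>\<omega>. ?V m t \<omega> - W t \<omega>) + L2_norm M (\<lambda>\<omega>. W t \<omega> - ?V n t \<omega>)"
          by (intro L2_norm_diff_triangle V_L2 W(1))
        also have "\<dots> < \<epsilon>" using n0[OF that(1)] n0[OF that(2)] L2_norm_minus_commute[of M "W t" "?V n t"] by simp
        finally show ?thesis .
      qed
      then show "\<exists>N0. \<forall>m\<ge>N0. \<forall>n\<ge>N0. H0_dist H (grid_steps (N m) (\<gamma> m) t) (grid_steps (N n) (\<gamma> n) t) < \<epsilon>" by blast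
    qed
    then show ?thesis
      unfolding has_wiener_integral_def using W by (intro conjI exI[of _ "\<lambda>n. grid_steps (N n) (\<gamma> n) t"]) (simp_all only: step_integral_grid_steps)
  qed
  ultimately show thesis by (rule that)
qed

end

text \<open>The hypotheses concern the open interval while the grids live on the closed one. The end
  points form a null set, but measurability of the given function there still needs an
  argument.\<close>

lemma L2_closed_interval:
  fixes f :: "real \<Rightarrow> real"
  assumes f: "f \<in> L2 (lebesgue_on {a<..<b})" shows "f \<in> L2 (lebesgue_on {a..b})"
proof -
  let ?h = "\<lambda>x. if x \<in> {a<..<b} then f x else 0"
  have hm: "?h \<in> borel_measurable lebesgue"
    using L2_D(1)[OF f] by (subst borel_measurable_if) auto
  have "AE x in lborel. x \<noteq> a \<and> x \<noteq> b"
    using AE_lborel_singleton[of a] AE_lborel_singleton[of b] by eventually_elim simp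
  then have ae0: "AE x in lebesgue. x \<noteq> a \<and> x \<noteq> b" by (rule AE_completion)
  have "(\<lambda>x. if x \<in> {a..b} then f x else 0) \<in> borel_measurable lebesgue"
  proof -
    have S: "{x \<in> space lebesgue. x = c \<and> a \<le> b} \<in> sets lebesgue" for c :: real
      by (cases "a \<le> b") (auto simp: Collect_conv_if)
    have "(\<lambda>x. if x = b \<and> a \<le> b then f b else ?h x) \<in> borel_measurable lebesgue"
      by (rule measurable_If[OF borel_measurable_const hm S])
    from measurable_If[OF borel_measurable_const this S]
    have "(\<lambda>x. if x = a \<and> a \<le> b then f a else if x = b \<and> a \<le> b then f b else ?h x) \<in> borel_measurable lebesgue" .
    then show ?thesis by (rule measurable_cong[THEN iffD1, rotated]) auto
  qed
  then have fm: "f \<in> borel_measurable (lebesgue_on {a..b})" by (subst (asm) borel_measurable_if) auto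
  have i: "integrable lebesgue (\<lambda>x. indicat_real {a<..<b} x *\<^sub>R (norm (f x))\<^sup>2)"
    using L2_D(2)[OF f] by (subst (asm) integrable_restrict_space) simp_all
  have "integrable lebesgue (\<lambda>x. indicat_real {a..b} x *\<^sub>R (norm (f x))\<^sup>2)"
  proof (rule integrable_cong_AE[THEN iffD1, OF _ _ _ i])
    show "(\<lambda>x. indicat_real {a<..<b} x *\<^sub>R (norm (f x))\<^sup>2) \<in> borel_measurable lebesgue" using i by (rule borel_measurable_integrable)
    have "(\<lambda>x. (norm (f x))\<^sup>2) \<in> borel_measurable (lebesgue_on {a..b})"
      using fm by (intro borel_measurable_power measurable_compose[OF _ borel_measurable_norm])
    then show "(\<lambda>x. indicat_real {a..b} x *\<^sub>R (norm (f x))\<^sup>2) \<in> borel_measurable lebesgue"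
      by (subst (asm) borel_measurable_restrict_space_iff) simp_all
    show "AE x in lebesgue. indicat_real {a<..<b} x *\<^sub>R (norm (f x))\<^sup>2 = indicat_real {a..b} x *\<^sub>R (norm (f x))\<^sup>2"
      using ae0
    proof eventually_elim
      case (elim x)
      then have "x \<in> {a<..<b} \<longleftrightarrow> x \<in> {a..b}" by auto
      then show ?case by (simp only: indicator_def)
    qed
  qed
  then have "integrable (lebesgue_on {a..b}) (\<lambda>x. (norm (f x))\<^sup>2)"
    by (subst integrable_restrict_space) simp_all
  with fm show ?thesis by (simp add: L2_def)
qed

theorem theorem1p1:
  fixes D :: "'a::euclidean_space set"
    and \<alpha> b c H T :: real
    and \<mu> :: "nat \<Rightarrow> real" and \<phi> :: "nat \<Rightarrow> 'a \<Rightarrow> real"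
    and cls :: "('a \<Rightarrow> real) \<Rightarrow> ('a \<Rightarrow> real) \<Rightarrow> ('a \<Rightarrow> real) \<Rightarrow> 'h::{real_inner,polish_space}"
    and S :: "real \<Rightarrow> 'h \<Rightarrow>\<^sub>L 'h"
    and M :: "'o measure" and B :: "real \<Rightarrow> 'o \<Rightarrow> real"
    and f\<^sub>1 f\<^sub>2 :: "'a \<Rightarrow> real" and g\<^sub>1 g\<^sub>2 :: "real \<Rightarrow> real"
    and \<Phi> \<Phi>' :: "real \<Rightarrow> 'h"
  assumes domain: "open D" "bounded D" "C2_boundary D"
    and constants: "\<alpha> > 0" "b > 0" "c\<^sup>2 > 0" "\<alpha> - c\<^sup>2 / b > 0"
    and eigensystem: "dirichlet_eigensystem D \<mu> \<phi>"
    and state_space: "is_state_space D \<mu> \<phi> cls"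
    and semigroup: "C0_semigroup S" "generator S = MGT_operator D \<mu> \<phi> cls \<alpha> b c"
    and probability: "prob_space M" "complete_measure M"
    and hurst: "0 < H" "H < 1"
    and fbm: "fractional_brownian_motion M H B"
    and time: "T > 0"
    and f\<^sub>1: "f\<^sub>1 \<in> H10 D"
    and f\<^sub>2: "f\<^sub>2 \<in> L2 (lebesgue_on D)"
    and g\<^sub>2: "g\<^sub>2 \<in> L2 (lebesgue_on {0<..<T})"
    and g\<^sub>1_rough: "H < 1/2 \<Longrightarrow> \<exists>\<rho>. \<rho> > 1/2 - H \<and> holder_on {0..T} \<rho> g\<^sub>1"
    and g\<^sub>1_smooth: "H \<ge> 1/2 \<Longrightarrow> g\<^sub>1 \<in> L2 (lebesgue_on {0<..<T})"
    and \<Phi>_def: "\<Phi> = (\<lambda>t. cls (\<lambda>x. 0) (\<lambda>x. 0) (\<lambda>x. f\<^sub>1 x * g\<^sub>1 t))"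
    and \<Phi>'_def: "\<Phi>' = (\<lambda>t. cls (\<lambda>x. 0) (\<lambda>x. 0) (\<lambda>x. f\<^sub>2 x * g\<^sub>2 t))"
  shows "\<exists>X. mild_solution M H B T S \<Phi> \<Phi>' X \<and>
           (\<forall>Y. mild_solution M H B T S \<Phi> \<Phi>' Y \<longrightarrow> (\<forall>t\<in>{0..T}. AE \<omega> in M. Y t \<omega> = X t \<omega>)) \<and>
           (\<forall>t\<in>{0..T}. X t \<in> L2 M)"
proof -
  define z where "z = cls (\<lambda>x. 0) (\<lambda>x. 0) f\<^sub>1"
  define z' where "z' = cls (\<lambda>x. 0) (\<lambda>x. 0) f\<^sub>2"
  define F where "F u = blinfun_apply (S u) z" for u
  define F' where "F' u = blinfun_apply (S u) z'" for u
  interpret prob_space M by fact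
  interpret fbm_space M H B by unfold_locales (fact hurst fbm)+
  have kernel: "(\<lambda>s. blinfun_apply (S (t - s)) (\<Phi> s)) = (\<lambda>s. g\<^sub>1 s *\<^sub>R F (t - s))"
    and kernel': "(\<lambda>s. blinfun_apply (S (t - s)) (\<Phi>' s)) = (\<lambda>s. g\<^sub>2 s *\<^sub>R F' (t - s))" for t
    unfolding \<Phi>_def \<Phi>'_def F_def F'_def z_def z'_def
      state_space_scale[OF eigensystem state_space H10_L2[OF f\<^sub>1]]
      state_space_scale[OF eigensystem state_space f\<^sub>2]
    by (simp_all only: blinfun.scaleR_right)
  obtain C where C: "0 \<le> C" "\<And>u. u \<in> {0..T} \<Longrightarrow> norm (F u) \<le> C"
    unfolding F_def using semigroup_orbit_bounded[OF semigroup(1)] by metis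
  obtain y where "(z, y) \<in> generator S"
    using H10_in_generator_domain[OF eigensystem state_space semigroup(2) f\<^sub>1] unfolding z_def by blast
  then obtain L where L: "0 \<le> L"
    "\<And>u v. u \<in> {0..T} \<Longrightarrow> v \<in> {0..T} \<Longrightarrow> norm (F u - F v) \<le> L * \<bar>u - v\<bar>"
    unfolding F_def using semigroup_orbit_lipschitz[OF semigroup(1)] by metis
  have g\<^sub>1: "g\<^sub>1 \<in> L2 (lebesgue_on {0..T})"
  proof (cases "H < 1/2")
    case True
    then obtain \<rho> where \<rho>: "\<rho> > 1/2 - H" "holder_on {0..T} \<rho> g\<^sub>1" using g\<^sub>1_rough by blast
    then have "0 < \<rho>" using True by simp
    then obtain K where "\<And>s t. s \<in> {0..T} \<Longrightarrow> t \<in> {0..T} \<Longrightarrow> \<bar>g\<^sub>1 s - g\<^sub>1 t\<bar> \<le> K * \<bar>s - t\<bar> powr \<rho>"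
      using \<rho>(2) unfolding holder_on_def by blast
    with \<open>0 < \<rho>\<close> have "continuous_on {0..T} g\<^sub>1" by (rule continuous_on_of_modulus)
    then show ?thesis by (rule continuous_L2)
  next
    case False
    then show ?thesis using g\<^sub>1_smooth by (intro L2_closed_interval) simp
  qed
  interpret stoch_convolution M H B T F g\<^sub>1 C L
    by unfold_locales (fact time C L g\<^sub>1)+
  obtain N \<gamma> where "good_scheme N \<gamma>"
    using good_scheme_smooth good_scheme_rough g\<^sub>1_rough by (cases "H < 1/2") auto
  then obtain W where Wm: "(\<lambda>x. W (fst x) (snd x)) \<in> borel_measurable \<P>"
    and W: "\<forall>t\<in>{0..T}. has_wiener_integral M H B t (\<lambda>s. g\<^sub>1 s *\<^sub>R F (t - s)) (W t)"
    using exists_predictable_wiener_integral by metis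
  have g\<^sub>2': "g\<^sub>2 \<in> L2 (lebesgue_on {0..T})" using g\<^sub>2 by (rule L2_closed_interval)
  have F': "continuous_on {0..T} F'"
    unfolding F'_def using semigroup(1) by (auto simp: C0_semigroup_def intro: continuous_on_subset)
  define d where "d t = (LINT s:{0..t}|lebesgue. g\<^sub>2 s *\<^sub>R F' (t - s))" for t
  have d: "continuous_on {0..T} d" unfolding d_def by (rule convolution_continuous[OF g\<^sub>2' F'])
  define X where "X t \<omega> = W t \<omega> + d t" for t \<omega>
  have dm: "(\<lambda>x. d (fst x)) \<in> borel_measurable \<P>"
  proof -
    have "(\<lambda>t. indicat_real {0..T} t *\<^sub>R d t) \<in> borel_measurable borel"
      using d by (intro borel_measurable_continuous_on_indicator) auto
    from measurable_compose[OF fst_predictable this] show ?thesis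
      by (rule measurable_cong[THEN iffD1, rotated]) (auto simp: predictable_space)
  qed
  have "mild_solution M H B T S \<Phi> \<Phi>' X"
    unfolding mild_solution_def kernel kernel' case_prod_beta'
  proof (intro conjI ballI)
    show "(\<lambda>x. X (fst x) (snd x)) \<in> borel_measurable \<P>"
      unfolding X_def using Wm dm by (rule borel_measurable_add)
    fix t assume t: "t \<in> {0..T}"
    show "set_integrable lebesgue {0..t} (\<lambda>s. g\<^sub>2 s *\<^sub>R F' (t - s))"
      by (rule convolution_integrable[OF g\<^sub>2' F' t])
    show "\<exists>W. has_wiener_integral M H B t (\<lambda>s. g\<^sub>1 s *\<^sub>R F (t - s)) W \<and>
        (AE \<omega> in M. X t \<omega> = W \<omega> + (LINT s:{0..t}|lebesgue. g\<^sub>2 s *\<^sub>R F' (t - s)))"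
      using W t by (intro exI[of _ "W t"] conjI AE_I2) (auto simp: X_def d_def)
  qed
  moreover have "AE \<omega> in M. Y t \<omega> = X t \<omega>" if Y: "mild_solution M H B T S \<Phi> \<Phi>' Y" and t: "t \<in> {0..T}" for Y t
  proof -
    obtain W' where W': "has_wiener_integral M H B t (\<lambda>s. g\<^sub>1 s *\<^sub>R F (t - s)) W'" "AE \<omega> in M. Y t \<omega> = W' \<omega> + d t"
      using Y t unfolding mild_solution_def kernel kernel' d_def by blast
    \<comment> \<open>Both solutions carry the same drift \<open>d t\<close>, so only two Wiener
      integrals of one integrand are compared.\<close>
    have "AE \<omega> in M. W' \<omega> = W t \<omega>" using W'(1) W[rule_format, OF t] by (rule wiener_integral_unique)
    with W'(2) show ?thesis by eventually_elim (simp add: X_def)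
  qed
  moreover have "X t \<in> L2 M" if t: "t \<in> {0..T}" for t
  proof -
    have "W t \<in> L2 M" using W t by (auto simp: has_wiener_integral_def)
    moreover have "(\<lambda>_. d t) \<in> L2 M" by (simp add: L2_def)
    ultimately show ?thesis unfolding X_def by (rule L2_add)
  qed
  ultimately show ?thesis by (intro exI[of _ X]) blast
qed

end
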